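(* The following are equivalent. (a) The Lehmer conjecture is true. (b) There exists $C>1$ such that almost no prime is $C$-wild, i.e. as $X\to+\infty$, $$|\{p\le X: p \text{ prime and } C\text{-wild}\}| = o(|\{p\le X: p\text{ prime}\}|).$$
   Context: $\log$ denotes the base-$2$ logarithm and $[y]$ the integer part of $y$. Given $C\ge 1$, a prime $p$ is called $C$-wild if there exists $x\in\mathbb{F}_p^\times$ of multiplicative order at least $(\log p)^2$ such that not every element of $\mathbb{F}_p$ is a sum of at most $(\log p)^C$ elements of the geometric progression $H=\{x,x^2,\dots,x^{[C\log p]}\}$ (elements of $H$ may be used repeatedly in a sum). For an algebraic number $\alpha$ with minimal polynomial $a_0\prod_{i=1}^n(X-\alpha_i)\in\mathbb{Z}[X]$, its Mahler measure is $M(\alpha)=|a_0|\prod_{i=1}^n\max\{1,|\alpha_i|\}$. The Lehmer conjecture asserts that there is a numerical constant $c_0>0$ such that every algebraic number $\alpha$ that is not a root of unity satisfies $M(\alpha)>1+c_0$.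
   Formalization: The Lehmer conjecture is stated for nonzero algebraic numbers that are not roots of unity; read literally it would include 0, which is not a root of unity and has Mahler measure 1, making the conjecture trivially false. *)

theory Defs
  imports
    "HOL-Number_Theory.Number_Theory"
    "HOL-Library.Landau_Symbols"
    "Berlekamp_Zassenhaus.Mahler_Measure"
begin

text \<open>
  The field with \<open>p\<close> elements is represented by residues modulo \<open>p\<close>, its non-zero elements by
  \<open>{1..<p}\<close>; \<open>ord p x\<close> is the multiplicative order of \<open>x\<close> modulo \<open>p\<close>.
\<close>

definition geom_prog :: "real \<Rightarrow> nat \<Rightarrow> nat \<Rightarrow> nat set" where
  "geom_prog C p x = {x ^ i mod p | i. 1 \<le> i \<and> int i \<le> \<lfloor>C * log 2 (real p)\<rfloor>}"

text \<open>
  A list records the summands with repetition. The empty list is allowed, so \<open>0\<close> counts as a sum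
  of at most \<open>B\<close> elements whenever \<open>B \<ge> 0\<close>.
\<close>

definition sum_of_at_most :: "real \<Rightarrow> nat \<Rightarrow> nat set \<Rightarrow> nat \<Rightarrow> bool" where
  "sum_of_at_most B p H y \<longleftrightarrow>
     (\<exists>hs. set hs \<subseteq> H \<and> real (length hs) \<le> B \<and> [sum_list hs = y] (mod p))"

definition wild :: "real \<Rightarrow> nat \<Rightarrow> bool" where
  "wild C p \<longleftrightarrow> prime p \<and>
     (\<exists>x\<in>{1..<p}. real (ord p x) \<ge> (log 2 (real p))\<^sup>2 \<and>
        \<not> (\<forall>y\<in>{0..<p}. sum_of_at_most (log 2 (real p) powr C) p (geom_prog C p x) y))"

definition is_int_min_poly :: "complex \<Rightarrow> int poly \<Rightarrow> bool" where
  "is_int_min_poly \<alpha> f \<longleftrightarrow>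
     irreducible f \<and> lead_coeff f > 0 \<and> poly (map_poly of_int f) \<alpha> = 0"

definition int_min_poly :: "complex \<Rightarrow> int poly" where
  "int_min_poly \<alpha> = (THE f. is_int_min_poly \<alpha> f)"

lemma ex1_int_min_poly:
  assumes "algebraic \<alpha>"
  shows "\<exists>!f. is_int_min_poly \<alpha> f"
proof -
  let ?R = "\<lambda>f :: int poly. poly (map_poly of_int f) \<alpha> = 0"
  have Rmult: "?R (f * g) \<longleftrightarrow> ?R f \<or> ?R g" for f g
    by (simp add: hom_distribs)
  have Rsub: "?R f" if "?R (f + g)" "?R g" for f g
    using that by (simp add: hom_distribs)
  have const: "f = 0" if "?R f" "degree f = 0" for f
    proof -
    obtain a where "f = [:a:]" using \<open>degree f = 0\<close> by (rule degree_eq_zeroE)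
    with \<open>?R f\<close> show ?thesis by (cases "a = 0") (simp_all add: hom_distribs)
  qed
  obtain p where p: "p \<noteq> 0" "?R p"
    using assms algebraicE' by blast
  obtain m where m: "m \<noteq> 0" "?R m"
    and min: "\<And>f. f \<noteq> 0 \<Longrightarrow> ?R f \<Longrightarrow> degree m \<le> degree f"
    using ex_has_least_nat[of "\<lambda>f. f \<noteq> 0 \<and> ?R f" p degree] p by blast
  have m_dvd: "\<exists>c s. c \<noteq> 0 \<and> smult c f = m * s" if "?R f" for f
  proof -
    obtain s r where sr: "pseudo_divmod f m = (s, r)" by (cases "pseudo_divmod f m")
    define c where "c = lead_coeff m ^ (Suc (degree f) - degree m)"
    have eq: "smult c f = m * s + r" and r: "r = 0 \<or> degree r < degree m"
      using pseudo_divmod[OF m(1) sr] by (simp_all add: c_def)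
    have "?R (smult c f)" using that by (simp add: hom_distribs)
    then have "?R (r + m * s)" by (simp add: eq add.commute)
    moreover have "?R (m * s)" using m by (simp add: Rmult)
    ultimately have "?R r" by (rule Rsub)
    with r min[of r] have "r = 0" by fastforce
    moreover have "c \<noteq> 0" using m by (simp add: c_def)
    ultimately show ?thesis using eq by auto
  qed
  have uniq: "normalize f = normalize (primitive_part m)" if f: "irreducible f" "?R f" for f
  proof -
    obtain c s where cs: "c \<noteq> 0" "smult c f = m * s" using m_dvd[OF f(2)] by blast
    have "f \<noteq> 0" using f by auto
    then have deg: "degree f \<noteq> 0" using const f by blast
    have "content f = 1"
    proof -
      have "f = [:content f:] * primitive_part f" by simp
      with f(1) have "is_unit [:content f:] \<or> is_unit (primitive_part f)"
        by (metis irreducibleD)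
      moreover have "\<not> is_unit (primitive_part f)"
        using deg by (metis degree_primitive_part poly_dvd_1)
      ultimately have "is_unit (content f)" by (simp add: const_poly_dvd_1)
      then show ?thesis by (metis is_unit_normalize normalize_content)
    qed
    then have ppf: "primitive_part f = f" using primitive_part_prim by blast
    have "primitive_part (smult c f) = primitive_part m * primitive_part s"
      by (simp add: cs primitive_part_mult)
    then have eq: "[:unit_factor c:] * f = primitive_part m * primitive_part s"
      by (simp add: primitive_part_smult ppf)
    have u: "is_unit [:unit_factor c:]" using cs by (simp add: const_poly_dvd_1)
    have "irreducible ([:unit_factor c:] * f)"
      using f(1) irreducible_mult_unit_left[OF u] by blast
    then have "is_unit (primitive_part m) \<or> is_unit (primitive_part s)"
      unfolding eq by (metis irreducibleD)
    moreover have "\<not> is_unit (primitive_part m)"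
    proof
      assume "is_unit (primitive_part m)"
      then have "degree m = 0" by (metis degree_primitive_part poly_dvd_1)
      then show False using const m by blast
    qed
    ultimately have us: "is_unit (primitive_part s)" by blast
    have "normalize ([:unit_factor c:] * f) = normalize f"
      using u by (simp only: normalize_mult_unit_left)
    moreover have "normalize (primitive_part m * primitive_part s) = normalize (primitive_part m)"
      using us by (simp only: normalize_mult_unit_right)
    ultimately show ?thesis using eq by metis
  qed
  have norm: "normalize f = f" if "lead_coeff f > 0" for f :: "int poly"
    using that by (simp add: normalize_poly_def sgn_if)
  obtain f where f: "prime f" "?R f"
  proof -
    have "normalize (prod_mset (prime_factorization p)) = normalize p"
      using p(1) by (rule prod_mset_prime_factorization_weak)
    then have "p dvd prod_mset (prime_factorization p)" by (simp add: associated_iff_dvd)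
    then have "?R (prod_mset (prime_factorization p))"
      using p(2) Rmult by (elim dvdE) simp
    moreover have "\<exists>f\<in>#A. ?R f" if "?R (prod_mset A)" for A
      using that by (induction A) (auto simp: Rmult)
    ultimately show ?thesis using that by (metis in_prime_factors_imp_prime)
  qed
  have "lead_coeff f > 0"
  proof -
    have "f \<noteq> 0" using f by auto
    moreover have "normalize f = f" using f by (simp add: prime_def)
    ultimately have "unit_factor f = 1" by (metis unit_factor_normalize)
    then have "sgn (lead_coeff f) = 1" by (simp add: unit_factor_poly_def one_poly_eq_simps)
    then show ?thesis by (simp add: sgn_1_pos)
  qed
  with f have "is_int_min_poly \<alpha> f"
    by (auto simp: is_int_min_poly_def prime_elem_iff_irreducible prime_def)
  moreover have "g = h" if "is_int_min_poly \<alpha> g" "is_int_min_poly \<alpha> h" for g h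
    using that uniq norm unfolding is_int_min_poly_def by metis
  ultimately show ?thesis by blast
qed

definition algebraic_mahler_measure :: "complex \<Rightarrow> real" where
  "algebraic_mahler_measure \<alpha> = mahler_measure (int_min_poly \<alpha>)"

text \<open>
  The number \<open>0\<close> has Mahler measure \<open>1\<close> and is not a root of unity; as usual, the conjecture is
  understood to exclude it, since it would be trivially false otherwise.
\<close>

definition lehmer_conjecture :: bool where
  "lehmer_conjecture \<longleftrightarrow>
     (\<exists>c\<^sub>0>0. \<forall>\<alpha>. algebraic \<alpha> \<and> \<alpha> \<noteq> 0 \<and> \<not> (\<exists>n>0. \<alpha> ^ n = 1) \<longrightarrow>
        algebraic_mahler_measure \<alpha> > 1 + c\<^sub>0)"

end

theory Submission
  imports Defs "HOL-Real_Asymp.Real_Asymp"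
begin

text \<open>
  Suppose the conjecture fails, and let \<open>g\<close> be the minimal polynomial of some \<open>\<alpha>\<close> whose Mahler
  measure is barely above 1. If \<open>x\<close> is a root of \<open>g\<close> modulo \<open>p\<close>, the sums of few powers of \<open>x\<close> are
  the images of polynomials with small values at all conjugates of \<open>\<alpha>\<close>, and there are fewer than
  \<open>p\<close> classes of such polynomials modulo \<open>g\<close>; so \<open>p\<close> is wild unless \<open>x\<close> has small order, which
  happens for a set of primes with convergent sum of \<open>ln p / p\<close>. The primes having a root of \<open>g\<close> are not
  negligible: a random element \<open>r\<close> of a box in \<open>\<int>[X]/(g)\<close> generates an ideal whose least positive
  integer is large and, for most \<open>r\<close>, a squarefree product of such primes, while few \<open>r\<close> lie in an
  ideal of large index. This elementary count replaces the Chebotarev or prime ideal theorem.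

  Conversely, if \<open>y\<close> is not a short sum of powers of \<open>x\<close>, Fourier analysis yields \<open>\<xi> \<noteq> 0\<close> such that
  all \<open>\<xi> x\<^sup>i\<close> are congruent to integers \<open>u\<^sub>i\<close> that are small compared with \<open>p\<close>. By pigeonhole \<open>x\<close>
  is a root modulo \<open>p\<close> of some \<open>P\<close> with coefficients in \<open>{-1, 0, 1}\<close>, and by smallness the congruence
  relations among the \<open>u\<^sub>i\<close> are equalities. Hence all polynomials with small coefficients that vanish
  at \<open>x\<close> modulo \<open>p\<close> share an irreducible factor \<open>g\<close> of \<open>P\<close>, and small polynomials take at most
  \<open>p\<close> values at a root \<open>\<alpha>\<close> of \<open>g\<close>. If \<open>\<alpha>\<close> is not a root of unity this contradicts the growth of
  the number of values like a power of the Mahler measure; if it is one, then \<open>x\<close> has too small an order.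
\<close>

section \<open>Polynomials modulo a monic irreducible polynomial\<close>

text \<open>The two directions treat constants in opposite ways. From sparse wild primes to the
  conjecture, \<open>g\<close> is fixed while \<open>p\<close> varies, so every bound may depend on
  \<open>g\<close> and crude height and packing constants suffice. In the converse, \<open>g\<close>
  is produced from \<open>p\<close> and may have degree of order log p, so no constant may depend on
  \<open>g\<close>: hence a growth bound without any constant (\<open>msr_power_le\<close>) and an
  explicit bound for orders of roots of unity.

  Primes are weighted by ln p / p: double counting gives order ln B over the primes with a root,
  while partial summation bounds the share of the wild ones by a small multiple of this.

  The threshold (log p)^2 for the order serves both directions. A prime with an element of order m
  below it exceeds 2^(sqrt m), which makes the exceptional sum converge; and a root of unity of
  degree n has order at most 2 n^2, which is too small once 8^n \<le> p.\<close>

lemma monic_division: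
  fixes g f :: "int poly"
  assumes "monic g"
  shows "\<exists>r. (\<forall>i\<ge>degree g. coeff r i = 0) \<and> g dvd f - r"
proof -
  have g0: "g \<noteq> 0" using assms by auto
  obtain q r where qr: "pseudo_divmod f g = (q, r)" by (cases "pseudo_divmod f g")
  have "f = g * q + r" and r: "r = 0 \<or> degree r < degree g"
    using pseudo_divmod[OF g0 qr] assms by simp_all
  then have "g dvd f - r" by simp
  moreover have "\<forall>i\<ge>degree g. coeff r i = 0" using r by (auto intro: coeff_eq_0)
  ultimately show ?thesis by blast
qed

text \<open>Gauss's lemma: the cofactor \<open>w\<close> has the content of
  \<open>smult c f\<close>, so \<open>c\<close> divides all its coefficients and can be
  cancelled.\<close>

lemma primitive_dvd_smultD:
  fixes t f :: "int poly"
  assumes "content t = 1" "c \<noteq> 0" "t dvd smult c f"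
  shows "t dvd f"
proof -
  obtain w where w: "smult c f = t * w" using assms(3) by (elim dvdE)
  have "content (smult c f) = content w" using w assms(1) by (simp add: content_mult)
  then have "content w = \<bar>c\<bar> * content f" by simp
  then have "c dvd content w" by simp
  then have "[:c:] dvd w" by (simp add: const_poly_dvd_iff_dvd_content)
  then obtain w' where w': "w = [:c:] * w'" by (elim dvdE)
  have "smult c f = smult c (t * w')" using w w' by simp
  then have "f = t * w'" using assms(2) by (simp only: smult_cancel simp_thms)
  then show ?thesis by simp
qed

text \<open>Integer polynomials do not form a principal ideal domain, so the Bezout identity holds
  only up to an integer \<open>c\<close>. A nonzero combination \<open>t\<close> of least degree
  divides multiples of \<open>f\<close> and \<open>h\<close> by pseudo-division; by Gauss's lemma
  its primitive part \<open>d\<close> divides \<open>f\<close> and \<open>h\<close>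
  themselves.\<close>

lemma int_poly_bezout:
  fixes f h :: "int poly"
  assumes "h \<noteq> 0"
  shows "\<exists>d c a b. c \<noteq> 0 \<and> d dvd f \<and> d dvd h \<and> smult c d = a * f + b * h"
proof -
  define I where "I = {t. t \<noteq> 0 \<and> (\<exists>a b. t = a * f + b * h)}"
  have "h \<in> I" using assms unfolding I_def by (simp, intro exI[of _ 0] exI[of _ 1], simp)
  then obtain t where t: "t \<in> I" and min: "\<And>s. s \<in> I \<Longrightarrow> degree t \<le> degree s"
    using ex_has_least_nat[of "\<lambda>t. t \<in> I" h degree] by blast
  obtain a b where tab: "t = a * f + b * h" and t0: "t \<noteq> 0" using t by (auto simp: I_def)
  have key: "\<exists>c. c \<noteq> 0 \<and> t dvd smult c s" if s: "s = a' * f + b' * h" for s a' b'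
  proof -
    obtain q r where qr: "pseudo_divmod s t = (q, r)" by (cases "pseudo_divmod s t")
    define c where "c = lead_coeff t ^ (Suc (degree s) - degree t)"
    have eq: "smult c s = t * q + r" and r: "r = 0 \<or> degree r < degree t"
      using pseudo_divmod[OF t0 qr] by (simp_all add: c_def)
    have "r = smult c s - t * q" using eq by simp
    also have "\<dots> = (smult c a' - a * q) * f + (smult c b' - b * q) * h"
      unfolding s tab by (simp add: algebra_simps smult_add_right)
    finally have "r \<noteq> 0 \<Longrightarrow> r \<in> I" unfolding I_def by blast
    then have "r = 0" using r min[of r] by fastforce
    moreover have "c \<noteq> 0" using t0 by (simp add: c_def)
    ultimately show ?thesis using eq by auto
  qed
  define d where "d = primitive_part t"
  have dt: "smult (content t) d = t" by (simp add: d_def)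
  have cd: "content d = 1" using t0 by (simp add: d_def)
  have ct: "content t \<noteq> 0" using t0 by simp
  have ddvd: "d dvd t" using dt by (metis dvd_smult dvd_refl)
  have "d dvd s" if "s = a' * f + b' * h" for s a' b'
    using key[OF that] cd ddvd by (meson dvd_trans primitive_dvd_smultD)
  from this[of f 1 0] this[of h 0 1] have "d dvd f" "d dvd h" by auto
  moreover have "smult (content t) d = a * f + b * h" using dt tab by simp
  ultimately show ?thesis using ct by blast
qed

definition box :: "nat \<Rightarrow> real \<Rightarrow> int poly set" where
  "box n \<rho> = {f. (\<forall>i\<ge>n. coeff f i = 0) \<and> (\<forall>i. \<bar>real_of_int (coeff f i)\<bar> \<le> \<rho>)}"

lemma boxI: "(\<And>i. i \<ge> n \<Longrightarrow> coeff f i = 0) \<Longrightarrow> (\<And>i. \<bar>real_of_int (coeff f i)\<bar> \<le> \<rho>) \<Longrightarrow> f \<in> box n \<rho>"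
  by (simp add: box_def)

lemma box_nonneg: "f \<in> box n \<rho> \<Longrightarrow> 0 \<le> \<rho>"
  unfolding box_def by (auto intro: order_trans[OF abs_ge_zero])

lemma card_inj_coeffs:
  fixes A :: "int poly set" and \<phi> :: "int poly \<Rightarrow> nat \<Rightarrow> int"
  assumes "\<And>f i. f \<in> A \<Longrightarrow> i < n \<Longrightarrow> \<phi> f i \<in> I"
    and "\<And>f f'. f \<in> A \<Longrightarrow> f' \<in> A \<Longrightarrow> (\<And>i. i < n \<Longrightarrow> \<phi> f i = \<phi> f' i) \<Longrightarrow> f = f'"
    and "finite I"
  shows "finite A \<and> card A \<le> card I ^ n"
proof -
  define F where "F = (\<lambda>f. \<lambda>i\<in>{..<n}. \<phi> f i)"
  have inj: "inj_on F A"
  proof (rule inj_onI)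
    fix f f' assume "f \<in> A" "f' \<in> A" "F f = F f'"
    then show "f = f'" using assms(2)[of f f'] unfolding F_def
      by (metis lessThan_iff restrict_apply')
  qed
  have sub: "F ` A \<subseteq> PiE {..<n} (\<lambda>_. I)" using assms(1) unfolding F_def by (intro image_subsetI) (simp add: restrict_PiE_iff)
  have fin: "finite (PiE {..<n} (\<lambda>_. I))" using assms(3) by (intro finite_PiE) auto
  have "finite A" using inj_on_finite[OF inj sub fin] .
  moreover have "card A \<le> card (PiE {..<n} (\<lambda>_. I))" using card_inj_on_le[OF inj sub fin] .
  ultimately show ?thesis by (simp add: card_PiE)
qed

lemma card_box:
  assumes "\<rho> \<ge> 0"
  shows "finite (box n \<rho>) \<and> real (card (box n \<rho>)) \<le> (2 * \<rho> + 1) ^ n"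
proof -
  define I where "I = {- \<lfloor>\<rho>\<rfloor> .. \<lfloor>\<rho>\<rfloor>}"
  have 1: "finite (box n \<rho>) \<and> card (box n \<rho>) \<le> card I ^ n"
  proof (rule card_inj_coeffs[of _ _ coeff])
    fix f i assume "f \<in> box n \<rho>" "i < n"
    then have "\<bar>real_of_int (coeff f i)\<bar> \<le> \<rho>" by (auto simp: box_def)
    then have "real_of_int \<bar>coeff f i\<bar> \<le> \<rho>" by simp
    then have "\<bar>coeff f i\<bar> \<le> \<lfloor>\<rho>\<rfloor>" by (simp only: le_floor_iff)
    then show "coeff f i \<in> I" by (auto simp: I_def)
  next
    fix f f' assume "f \<in> box n \<rho>" "f' \<in> box n \<rho>" "\<And>i. i < n \<Longrightarrow> coeff f i = coeff f' i"
    then have "coeff f i = coeff f' i" for i by (cases "i < n") (auto simp: box_def)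
    then show "f = f'" by (rule poly_eqI)
  qed (simp add: I_def)
  have 2: "real (card I) \<le> 2 * \<rho> + 1"
    using assms by (simp add: I_def)
  have "real (card (box n \<rho>)) \<le> real (card I ^ n)"
    using 1 by (simp only: of_nat_le_iff)
  then have 3: "real (card (box n \<rho>)) \<le> real (card I) ^ n" by simp
  have "real (card I) ^ n \<le> (2 * \<rho> + 1) ^ n"
    using 2 by (intro power_mono) auto
  from order_trans[OF 3 this] 1 show ?thesis by blast
qed

lemma poly_as_sum_below:
  fixes f :: "int poly"
  assumes "\<And>i. i \<ge> m \<Longrightarrow> coeff f i = 0"
  shows "f = (\<Sum>i<m. smult (coeff f i) (monom 1 i))"
proof (rule poly_eqI)
  fix j
  have "coeff (\<Sum>i<m. smult (coeff f i) (monom 1 i)) j = (\<Sum>i<m. coeff f i * (if i = j then 1 else 0))"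
    by (simp add: coeff_sum)
  also have "\<dots> = (\<Sum>i<m. if j = i then coeff f i else 0)" by (intro sum.cong) auto
  also have "\<dots> = coeff f j" using assms[of j] by (subst sum.delta') auto
  finally show "coeff f j = coeff (\<Sum>i<m. smult (coeff f i) (monom 1 i)) j" by simp
qed

locale monic_irreducible =
  fixes g :: "int poly" and n :: nat
  assumes monic: "monic g" and irr: "irreducible g" and deg: "degree g = n"
begin

lemma prime_g: "prime_elem g" using irr by (rule irreducible_imp_prime_elem)

lemma g_nonzero: "g \<noteq> 0" using irr by auto

lemma n_pos: "n > 0"
proof (rule ccontr)
  assume "\<not> n > 0"
  then have "degree g = 0" using deg by simp
  then obtain a where a: "g = [:a:]" by (rule degree_eq_zeroE)
  have "a = 1" using monic unfolding a degree_pCons_0 coeff_pCons_0 .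
  then have "g = 1" using a by (simp only: one_pCons)
  then have "is_unit g" by (simp only: one_dvd)
  then show False using irr irreducible_not_unit by blast
qed

definition red :: "int poly \<Rightarrow> int poly" where
  "red f = (SOME r. (\<forall>i\<ge>n. coeff r i = 0) \<and> g dvd f - r)"

lemma red: "i \<ge> n \<Longrightarrow> coeff (red f) i = 0" "g dvd f - red f"
proof -
  have "\<exists>r. (\<forall>i\<ge>n. coeff r i = 0) \<and> g dvd f - r" using monic_division[OF monic] deg by simp
  from someI_ex[OF this] show "i \<ge> n \<Longrightarrow> coeff (red f) i = 0" "g dvd f - red f"
    unfolding red_def by auto
qed

lemma dvd_small_zero:
  assumes "g dvd f" "\<And>i. i \<ge> n \<Longrightarrow> coeff f i = 0"
  shows "f = 0"
proof (rule ccontr)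
  assume "f \<noteq> 0"
  then have "n \<le> degree f" using assms(1) deg by (metis dvd_imp_degree_le)
  then show False using assms(2)[of "degree f"] \<open>f \<noteq> 0\<close> by simp
qed

lemma red_unique:
  assumes "g dvd f - r" "\<And>i. i \<ge> n \<Longrightarrow> coeff r i = 0"
  shows "red f = r"
proof -
  have "g dvd (f - r) - (f - red f)" using assms(1) red(2) by (rule dvd_diff)
  then have "red f - r = 0" by (intro dvd_small_zero) (use assms(2) red(1) in auto)
  then show ?thesis by simp
qed

lemma red_add: "red (a + b) = red a + red b"
proof (rule red_unique)
  have "g dvd (a - red a) + (b - red b)" using red(2) by (intro dvd_add)
  then show "g dvd a + b - (red a + red b)" by (simp add: algebra_simps)
qed (use red(1) in auto)

lemma red_smult: "red (smult c a) = smult c (red a)"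
proof (rule red_unique)
  have "g dvd smult c (a - red a)" using red(2) by (intro dvd_smult)
  then show "g dvd smult c a - smult c (red a)" by (simp add: smult_diff_right)
qed (use red(1) in auto)

lemma red_0 [simp]: "red 0 = 0" by (rule red_unique) auto

lemma red_sum: "red (sum f A) = (\<Sum>x\<in>A. red (f x))"
  by (induction A rule: infinite_finite_induct) (auto simp: red_add)

lemma red_small: "(\<And>i. i \<ge> n \<Longrightarrow> coeff f i = 0) \<Longrightarrow> red f = f"
  by (rule red_unique) auto

lemma red_eq_iff: "red a = red b \<longleftrightarrow> g dvd a - b"
proof
  assume "red a = red b"
  then have "a - b = (a - red a) - (b - red b)" by simp
  then show "g dvd a - b" using red(2) by (metis dvd_diff)
next
  assume "g dvd a - b"
  then have "g dvd (a - b) + (b - red b)" using red(2) by (intro dvd_add)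
  then show "red a = red b" by (intro red_unique) (use red(1) in auto)
qed

text \<open>Controls the growth of heights under multiplication modulo \<open>g\<close>: a product
  has n^2 terms, each a monomial of degree below 2n that must be reduced. The summand 1 ensures
  \<open>mulC_ge_1\<close>.\<close>

definition mulC :: real where
  "mulC = 1 + real n ^ 2 * (\<Sum>k<2*n. \<Sum>i<n. \<bar>real_of_int (coeff (red (monom 1 k)) i)\<bar>)"

lemma mulC_ge_1: "mulC \<ge> 1"
  unfolding mulC_def by (auto intro!: mult_nonneg_nonneg sum_nonneg)

lemma red_monom_bound:
  assumes "k < 2 * n"
  shows "real n ^ 2 * \<bar>real_of_int (coeff (red (monom 1 k)) i)\<bar> \<le> mulC"
proof (cases "i < n")
  case True
  have "\<bar>real_of_int (coeff (red (monom 1 k)) i)\<bar> \<le> (\<Sum>i<n. \<bar>real_of_int (coeff (red (monom 1 k)) i)\<bar>)"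
    by (rule member_le_sum) (use True in auto)
  also have "\<dots> \<le> (\<Sum>k<2*n. \<Sum>i<n. \<bar>real_of_int (coeff (red (monom 1 k)) i)\<bar>)"
    by (rule member_le_sum[of k "{..<2*n}" "\<lambda>k. \<Sum>i<n. \<bar>real_of_int (coeff (red (monom 1 k)) i)\<bar>"]) (use assms in \<open>auto intro: sum_nonneg\<close>)
  finally have "real n ^ 2 * \<bar>real_of_int (coeff (red (monom 1 k)) i)\<bar> \<le> real n ^ 2 * (\<Sum>k<2*n. \<Sum>i<n. \<bar>real_of_int (coeff (red (monom 1 k)) i)\<bar>)"
    by (rule mult_left_mono) simp
  then show ?thesis unfolding mulC_def by linarith
next
  case False
  then show ?thesis using red(1)[of i] mulC_ge_1 by simp
qed

lemma red_mult_box: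
  assumes "a \<in> box n \<rho>" "b \<in> box n \<sigma>"
  shows "red (a * b) \<in> box n (mulC * \<rho> * \<sigma>)"
proof (rule boxI)
  have a: "a = (\<Sum>i<n. smult (coeff a i) (monom 1 i))" and b: "b = (\<Sum>i<n. smult (coeff b i) (monom 1 i))"
    using assms by (auto simp: box_def intro!: poly_as_sum_below)
  have nn: "\<rho> \<ge> 0" "\<sigma> \<ge> 0" using assms box_nonneg by auto
  have ab: "a * b = (\<Sum>i<n. \<Sum>j<n. smult (coeff a i * coeff b j) (monom 1 (i + j)))"
    by (subst a, subst b) (simp add: sum_product mult_monom smult_monom)
  have eq: "red (a * b) = (\<Sum>i<n. \<Sum>j<n. smult (coeff a i * coeff b j) (red (monom 1 (i + j))))"
    unfolding ab by (simp add: red_sum red_smult)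
  fix k
  have "\<bar>real_of_int (coeff (red (a * b)) k)\<bar> \<le> (\<Sum>i<n. \<Sum>j<n. \<bar>real_of_int (coeff a i * coeff b j * coeff (red (monom 1 (i + j))) k)\<bar>)"
    unfolding eq by (simp add: coeff_sum) (rule order_trans[OF sum_abs], rule sum_mono, rule sum_abs)
  also have "\<dots> \<le> (\<Sum>i<n. \<Sum>j<n. \<rho> * \<sigma> * (mulC / real n ^ 2))"
  proof (intro sum_mono)
    fix i j assume ij: "i \<in> {..<n}" "j \<in> {..<n}"
    have "\<bar>real_of_int (coeff (red (monom 1 (i + j))) k)\<bar> \<le> mulC / real n ^ 2"
      using red_monom_bound[of "i + j" k] ij n_pos by (simp add: field_simps)
    moreover have "\<bar>real_of_int (coeff a i)\<bar> \<le> \<rho>" "\<bar>real_of_int (coeff b j)\<bar> \<le> \<sigma>"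
      using assms by (auto simp: box_def)
    ultimately show "\<bar>real_of_int (coeff a i * coeff b j * coeff (red (monom 1 (i + j))) k)\<bar> \<le> \<rho> * \<sigma> * (mulC / real n ^ 2)"
      unfolding of_int_mult abs_mult using nn by (intro mult_mono) auto
  qed
  also have "\<dots> = mulC * \<rho> * \<sigma>" using n_pos by (simp add: power2_eq_square)
  finally show "\<bar>real_of_int (coeff (red (a * b)) k)\<bar> \<le> mulC * \<rho> * \<sigma>" .
qed (use red(1) in auto)

text \<open>As \<open>g\<close> is irreducible, the gcd is a unit, so a positive integer lies in the
  ideal (s, g). It plays the role of a resultant and makes \<open>b\<close> an inverse of
  \<open>s\<close> up to the factor \<open>N\<close>.\<close>

lemma coprime_const:
  assumes "\<not> g dvd s"
  shows "\<exists>N b. N > 0 \<and> g dvd s * b - [:N:]"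
proof -
  obtain d c a b where h: "c \<noteq> 0" "d dvd s" "d dvd g" "smult c d = a * s + b * g"
    using int_poly_bezout[OF g_nonzero, of s] by blast
  have "\<not> g dvd d" using h(2) assms by (meson dvd_trans)
  then have "is_unit d" using h(3) irr by (metis irreducibleD')
  then obtain u where "d = [:u:]" "u dvd 1" unfolding is_unit_poly_iff by blast
  then have u: "d = [:u:]" "u = 1 \<or> u = -1" by auto
  define N where "N = \<bar>c\<bar>"
  define e where "e = sgn c * u"
  have e: "e * (c * u) = N" using u(2) by (auto simp: e_def N_def abs_sgn)
  have "[:c * u:] = a * s + b * g" using h(4) u(1) by simp
  then have "smult e [:c * u:] = smult e (a * s + b * g)" by simp
  then have "[:N:] = smult e a * s + smult e b * g" using e by (simp add: smult_add_right)
  then have "s * smult e a - [:N:] = g * (- smult e b)" by (simp add: algebra_simps)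
  then have "g dvd s * smult e a - [:N:]" by (simp only: dvd_triv_left)
  moreover have "N > 0" using h(1) by (simp add: N_def)
  ultimately show ?thesis by blast
qed

end

section \<open>Ideals and packing bounds\<close>

definition is_ideal :: "int poly set \<Rightarrow> bool" where
  "is_ideal J \<longleftrightarrow> 0 \<in> J \<and> (\<forall>a\<in>J. \<forall>b\<in>J. a + b \<in> J) \<and> (\<forall>a\<in>J. \<forall>f. f * a \<in> J)"

lemma ideal_0: "is_ideal J \<Longrightarrow> 0 \<in> J"
  and ideal_add: "is_ideal J \<Longrightarrow> a \<in> J \<Longrightarrow> b \<in> J \<Longrightarrow> a + b \<in> J"
  and ideal_mult: "is_ideal J \<Longrightarrow> a \<in> J \<Longrightarrow> f * a \<in> J"
  and ideal_mult': "is_ideal J \<Longrightarrow> a \<in> J \<Longrightarrow> a * f \<in> J"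
  by (auto simp: is_ideal_def mult.commute)

lemma ideal_diff: "is_ideal J \<Longrightarrow> a \<in> J \<Longrightarrow> b \<in> J \<Longrightarrow> a - b \<in> J"
  using ideal_add[of J a "- b"] ideal_mult[of J b "-1"] by simp

lemma ideal_smult: "is_ideal J \<Longrightarrow> a \<in> J \<Longrightarrow> smult c a \<in> J"
  using ideal_mult[of J a "[:c:]"] by simp

lemma ideal_dvd: "is_ideal J \<Longrightarrow> a \<in> J \<Longrightarrow> a dvd b \<Longrightarrow> b \<in> J"
  by (elim dvdE) (simp add: ideal_mult')

text \<open>A finite incongruent set witnesses a lower bound for the index of \<open>J\<close>;
  quotient rings are never formed.\<close>

definition incongruent :: "int poly set \<Rightarrow> int poly set \<Rightarrow> bool" where
  "incongruent J F \<longleftrightarrow> (\<forall>a\<in>F. \<forall>b\<in>F. a - b \<in> J \<longrightarrow> a = b)"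

text \<open>Imitates polynomials over the field with \<open>p\<close> elements inside
  \<open>int poly\<close>: top coefficients divisible by \<open>p\<close> move to \<open>f2\<close>,
  so that \<open>f1\<close> is zero or keeps its degree modulo \<open>p\<close>.\<close>

lemma truncate_mod:
  fixes f :: "int poly" and p :: int
  shows "\<exists>f1 f2. f = f1 + [:p:] * f2 \<and> degree f1 \<le> degree f \<and> (f1 = 0 \<or> \<not> p dvd lead_coeff f1)"
proof (induction "degree f" arbitrary: f rule: less_induct)
  case less
  show ?case
  proof (cases "\<not> p dvd lead_coeff f")
    case True
    then show ?thesis by (intro exI[of _ f] exI[of _ 0]) auto
  next
    case False
    then obtain k where k: "lead_coeff f = p * k" by (auto elim: dvdE)
    define m where "m = monom k (degree f)"
    define h where "h = f - [:p:] * m"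
    have fh: "f = h + [:p:] * m" by (simp add: h_def)
    show ?thesis
    proof (cases "degree f = 0")
      case True
      then have "h = 0" using k unfolding h_def m_def
        by (intro poly_eqI) (auto simp: coeff_eq_0)
      then show ?thesis using fh by (intro exI[of _ 0] exI[of _ m]) auto
    next
      case False
      have "degree h < degree f"
      proof (rule degree_lessI)
        show "h \<noteq> 0 \<or> degree f > 0" using False by simp
        show "\<forall>i\<ge>degree f. coeff h i = 0"
          using k by (auto simp: h_def m_def coeff_eq_0)
      qed
      from less[OF this] obtain f1 f2 where
        "h = f1 + [:p:] * f2" "degree f1 \<le> degree h" "f1 = 0 \<or> \<not> p dvd lead_coeff f1" by blast
      moreover from this have "f = f1 + [:p:] * (f2 + m)" using fh by (simp add: algebra_simps smult_add_right)
      ultimately show ?thesis using \<open>degree h < degree f\<close>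
        by (intro exI[of _ f1] exI[of _ "f2 + m"]) auto
    qed
  qed
qed

text \<open>If \<open>f\<close> were nonzero modulo \<open>p\<close>, its truncation could be
  multiplied by an inverse of its leading coefficient modulo \<open>p\<close> and corrected by a
  multiple of \<open>p\<close>; the result would be a monic element of \<open>J\<close> of too small
  a degree.\<close>

lemma ideal_below_minimal_monic:
  fixes p :: nat
  assumes p: "prime p" and J: "is_ideal J" "[:int p:] \<in> J"
    and min: "\<And>h'. h' \<in> J \<Longrightarrow> monic h' \<Longrightarrow> d \<le> degree h'"
    and f: "f \<in> J" "f = 0 \<or> degree f < d"
  shows "[:int p:] dvd f"
proof (cases "f = 0")
  case False
  obtain f1 f2 where f12: "f = f1 + [:int p:] * f2" "degree f1 \<le> degree f"
    "f1 = 0 \<or> \<not> int p dvd lead_coeff f1" using truncate_mod by blast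
  have "f1 = 0"
  proof (rule ccontr)
    assume n0: "f1 \<noteq> 0"
    then have nd: "\<not> int p dvd lead_coeff f1" using f12 by simp
    have deg: "degree f1 < d" using f(2) f12(2) False by linarith
    have "f - f2 * [:int p:] \<in> J" using f(1) J by (intro ideal_diff ideal_mult)
    then have f1J: "f1 \<in> J" using f12(1) by (simp add: mult.commute)
    have "prime (int p)" using p by simp
    then have "gcd (int p) (lead_coeff f1) = 1"
      using nd prime_imp_coprime coprime_iff_gcd_eq_1 by blast
    then have "gcd (lead_coeff f1) (int p) = 1" by (simp add: gcd.commute)
    then obtain u v where uv: "u * lead_coeff f1 + v * int p = 1"
      using bezout_int[of "lead_coeff f1" "int p"] by metis
    define h where "h = smult u f1 + monom v (degree f1) * [:int p:]"
    have "h \<in> J" unfolding h_def using J f1J by (intro ideal_add ideal_smult ideal_mult)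
    have c1: "coeff h (degree f1) = 1" using uv by (simp add: h_def mult.commute)
    have "degree h \<le> degree f1" unfolding h_def
      by (rule degree_le) (auto simp: coeff_eq_0)
    with c1 have "degree h = degree f1" by (metis coeff_eq_0 le_neq_implies_less zero_neq_one)
    then show False using min[OF \<open>h \<in> J\<close>] c1 deg by simp
  qed
  then have "f = [:int p:] * f2" using f12(1) by simp
  then show ?thesis by (rule dvdI)
qed simp

text \<open>These correspond to the ideals of the quotient by (p, g), a finite ring when
  \<open>g\<close> is monic and \<open>p\<close> is prime.\<close>

definition ideals_over :: "nat \<Rightarrow> int poly \<Rightarrow> int poly set set" where
  "ideals_over p g = {J. is_ideal J \<and> [:int p:] \<in> J \<and> g \<in> J}"

text \<open>Division of \<open>g\<close> by the monic \<open>c\<close> over the integers leaves a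
  remainder that, modulo \<open>p\<close>, is a multiple of \<open>c\<close> of smaller degree,
  hence zero. So the quotient is a monic cofactor of the right degree.\<close>

lemma ideals_over_cofactor:
  assumes p: "prime p" and mon: "monic c" "monic g" and le: "degree c \<le> degree g"
    and g: "g = c * a + [:int p:] * b"
  shows "\<exists>a' b'. monic a' \<and> degree c + degree a' = degree g \<and> g = c * a' + [:int p:] * b'"
proof -
  have c0: "c \<noteq> 0" "g \<noteq> 0" using mon by auto
  obtain q r where qr: "pseudo_divmod g c = (q, r)" by (cases "pseudo_divmod g c")
  have gq: "g = c * q + r" and r: "r = 0 \<or> degree r < degree c"
    using pseudo_divmod[OF c0(1) qr] mon by simp_all
  have cq: "degree (c * q) = degree g \<and> lead_coeff (c * q) = 1"
  proof (cases "r = 0")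
    case False
    then have lt: "degree r < degree g" using r le by simp
    have cqr: "c * q = g - r" using gq by simp
    have "degree (c * q) = degree g" unfolding cqr
      using lt by (metis add_uminus_conv_diff degree_add_eq_left degree_minus)
    then show ?thesis using mon lt unfolding cqr by (simp add: coeff_eq_0)
  qed (use gq mon in auto)
  have q0: "q \<noteq> 0" using cq c0 by auto
  have mq: "monic q" using cq mon by (metis lead_coeff_mult mult_1)
  have dq: "degree c + degree q = degree g" using cq c0 q0 by (simp add: degree_mult_eq)
  obtain w1 w2 where w: "a - q = w1 + [:int p:] * w2" "w1 = 0 \<or> \<not> int p dvd lead_coeff w1"
    using truncate_mod by blast
  have cw: "c * w1 = r - [:int p:] * (b + c * w2)"
  proof -
    have "c * q + r = c * a + [:int p:] * b" using gq g by simp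
    then have "r - [:int p:] * b = c * (a - q)" by (simp only: algebra_simps) algebra
    then show ?thesis unfolding w(1) by (simp only: algebra_simps) algebra
  qed
  have "w1 = 0"
  proof (rule ccontr)
    assume w0: "w1 \<noteq> 0"
    let ?k = "degree c + degree w1"
    have "coeff (c * w1) ?k = lead_coeff w1" using mon by (simp add: coeff_mult_degree_sum)
    moreover have "coeff r ?k = 0" using r by (auto intro: coeff_eq_0)
    ultimately have "lead_coeff w1 = - int p * coeff (b + c * w2) ?k" using cw by simp
    then have "int p dvd lead_coeff w1" by simp
    with w w0 show False by simp
  qed
  then have "r = [:int p:] * (b + c * w2)" using cw by simp
  then show ?thesis using gq mq dq by blast
qed

text \<open>Let \<open>c\<close> be a monic divisor of \<open>g\<close> modulo \<open>p\<close> of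
  least positive degree, with cofactor \<open>g'\<close>. An ideal inside (c, p) is determined by
  its quotient by \<open>c\<close>; any other one is comaximal with (c, p) and therefore contains
  \<open>g'\<close>. Both kinds embed into the ideals over \<open>g'\<close>, so the count at most
  doubles.\<close>

lemma card_ideals_over:
  assumes p: "prime p" and "monic g"
  shows "finite (ideals_over p g) \<and> card (ideals_over p g) \<le> 2 ^ degree g"
  using assms(2)
proof (induction "degree g" arbitrary: g rule: less_induct)
  case less
  show ?case
  proof (cases "degree g = 0")
    case True
    then have g1: "g = 1" using less.prems by (metis monic_degree_0)
    have "ideals_over p g \<subseteq> {UNIV}"
      unfolding ideals_over_def g1 using ideal_mult[of _ 1] by auto
    then show ?thesis using True card_mono[of "{UNIV}" "ideals_over p g"] finite_subset by auto
  next
    case False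
    define cand where "cand c \<longleftrightarrow> monic c \<and> degree c \<ge> 1 \<and> (\<exists>a b. g = c * a + [:int p:] * b)" for c
    have "g = g * 1 + [:int p:] * 0" by simp
    then have "cand g" using False less.prems unfolding cand_def
      by (metis One_nat_def Suc_leI gr0I)
    then obtain c where c: "cand c" and cmin: "\<And>c'. cand c' \<Longrightarrow> degree c \<le> degree c'"
      using ex_has_least_nat[of cand g degree] by blast
    have cle: "degree c \<le> degree g" using cmin \<open>cand g\<close> by simp
    obtain a b where mc: "monic c" "degree c \<ge> 1" and "g = c * a + [:int p:] * b"
      using c by (auto simp: cand_def)
    then obtain g' b' where g': "monic g'" "degree c + degree g' = degree g" "g = c * g' + [:int p:] * b'"
      using ideals_over_cofactor[OF p _ less.prems cle] by blast
    have IH: "finite (ideals_over p g') \<and> card (ideals_over p g') \<le> 2 ^ degree g'"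
      using less.hyps[of g'] g' mc by simp
    define C where "C = {c * x + [:int p:] * y | x y. True}"
    define A where "A = {J \<in> ideals_over p g. J \<subseteq> C}"
    define B where "B = {J \<in> ideals_over p g. \<not> J \<subseteq> C}"
    have un: "ideals_over p g = A \<union> B" by (auto simp: A_def B_def)
    have Bsub: "B \<subseteq> ideals_over p g'"
    proof
      fix J assume "J \<in> B"
      then have J: "is_ideal J" "[:int p:] \<in> J" "g \<in> J" and nsub: "\<not> J \<subseteq> C"
        by (auto simp: B_def ideals_over_def)
      \<comment> \<open>The sum of \<open>J\<close> and (c, p). Its monic element \<open>h\<close>
        of least degree is constant: otherwise it would divide \<open>g\<close> modulo
        \<open>p\<close>, agree with \<open>c\<close> modulo \<open>p\<close> by minimality, and
        force \<open>J\<close> into (c, p).\<close>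
      define K where "K = {j + (c * x + [:int p:] * y) | j x y. j \<in> J}"
      have KI: "j + (c * x + [:int p:] * y) \<in> K" if "j \<in> J" for j x y
        using that by (auto simp: K_def)
      have K: "is_ideal K" unfolding is_ideal_def
      proof (intro conjI ballI allI)
        show "0 \<in> K" using KI[of 0 0 0] ideal_0[OF J(1)] by simp
      next
        fix u v assume "u \<in> K" "v \<in> K"
        then obtain j x y j' x' y' where *: "j \<in> J" "j' \<in> J" "u = j + (c * x + [:int p:] * y)" "v = j' + (c * x' + [:int p:] * y')"
          by (auto simp: K_def)
        have "u + v = (j + j') + (c * (x + x') + [:int p:] * (y + y'))" unfolding * by (simp only: algebra_simps)
        then show "u + v \<in> K" using KI[of "j + j'"] ideal_add[OF J(1) *(1,2)] by simp
      next
        fix u f assume "u \<in> K"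
        then obtain j x y where *: "j \<in> J" "u = j + (c * x + [:int p:] * y)" by (auto simp: K_def)
        have "f * u = f * j + (c * (f * x) + [:int p:] * (f * y))" unfolding * by (simp only: algebra_simps)
        then show "f * u \<in> K" using KI[of "f * j"] ideal_mult[OF J(1) *(1)] by simp
      qed
      have JK: "j \<in> K" if "j \<in> J" for j using KI[OF that, of 0 0] by simp
      have cK: "c \<in> K" using KI[of 0 1 0] ideal_0[OF J(1)] by simp
      obtain h where h: "h \<in> K" "monic h" and hmin: "\<And>h'. h' \<in> K \<Longrightarrow> monic h' \<Longrightarrow> degree h \<le> degree h'"
        using ex_has_least_nat[of "\<lambda>h. h \<in> K \<and> monic h" c degree] cK mc by blast
      have pK: "[:int p:] \<in> K" using JK J by simp
      have div: "\<exists>x y. f = h * x + [:int p:] * y" if f: "f \<in> K" for f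
      proof -
        obtain q r where qr: "pseudo_divmod f h = (q, r)" by (cases "pseudo_divmod f h")
        have h0: "h \<noteq> 0" using h by auto
        have fq: "f = h * q + r" and r: "r = 0 \<or> degree r < degree h"
          using pseudo_divmod[OF h0 qr] h by simp_all
        have "f - q * h \<in> K" using K f h by (intro ideal_diff ideal_mult)
        then have "r \<in> K" using fq by (simp add: mult.commute)
        then have "[:int p:] dvd r" using ideal_below_minimal_monic[OF p K pK hmin _ r] by blast
        then show ?thesis using fq by (metis dvdE)
      qed
      have "degree h = 0"
      proof (rule ccontr)
        assume "degree h \<noteq> 0"
        then have "cand h" using div[OF JK[OF J(3)]] h unfolding cand_def by simp
        then have eq: "degree h = degree c" using cmin hmin[OF cK] mc by (simp add: le_antisym)
        have "c - h = 0 \<or> degree (c - h) < degree h"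
        proof (cases "c = h")
          case False
          have "degree (c - h) < degree h"
          proof (rule degree_lessI)
            show "c - h \<noteq> 0 \<or> degree h > 0" using False by simp
            show "\<forall>i\<ge>degree h. coeff (c - h) i = 0"
            proof (intro allI impI)
              fix i assume "i \<ge> degree h"
              then consider "i = degree h" | "i > degree h" by linarith
              then show "coeff (c - h) i = 0"
                by cases (use eq mc h in \<open>auto simp: coeff_eq_0\<close>)
            qed
          qed
          then show ?thesis by simp
        qed simp
        then have "[:int p:] dvd c - h"
          using ideal_below_minimal_monic[OF p K pK hmin ideal_diff[OF K cK h(1)]] by blast
        then obtain z where z: "c - h = [:int p:] * z" by (elim dvdE)
        have "J \<subseteq> C"
        proof
          fix j assume "j \<in> J"
          then obtain x y where xy: "j = h * x + [:int p:] * y" using div[OF JK] by blast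
          have "h = c - [:int p:] * z" using z by (simp add: algebra_simps)
          then have "j = (c - [:int p:] * z) * x + [:int p:] * y" using xy by (simp only:)
          also have "(c - P * z) * x + P * y = c * x + P * (y - z * x)" for P
            by (simp add: algebra_simps)
          finally have "j = c * x + [:int p:] * (y - z * x)" .
          then show "j \<in> C" unfolding C_def by blast
        qed
        with nsub show False ..
      qed
      then have "1 \<in> K" using h by (metis monic_degree_0)
      then obtain j x y where j: "j \<in> J" "1 = j + (c * x + [:int p:] * y)" by (auto simp: K_def)
      have "g' = g' * (j + (c * x + [:int p:] * y))" using j(2) by simp
      also have "\<dots> = g' * j + (g - [:int p:] * b') * x + [:int p:] * (g' * y)"
        unfolding g'(3) by (simp only: algebra_simps) algebra
      also have "\<dots> \<in> J" using J j(1) by (intro ideal_add ideal_diff ideal_mult ideal_mult') auto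
      finally show "J \<in> ideals_over p g'" using J by (simp add: ideals_over_def)
    qed
    have inj: "inj_on (\<lambda>J. {f. c * f \<in> J}) A"
    proof (rule inj_onI)
      have sub: "J \<subseteq> J'" if J: "J \<in> A" "J' \<in> A" and eq: "{f. c * f \<in> J} = {f. c * f \<in> J'}" for J J'
      proof
        fix f assume f: "f \<in> J"
        have i: "is_ideal J" "is_ideal J'" "[:int p:] \<in> J" "[:int p:] \<in> J'" "J \<subseteq> C"
          using J by (auto simp: A_def ideals_over_def)
        obtain x y where xy: "f = c * x + [:int p:] * y" using f i(5) by (auto simp: C_def)
        have "f - [:int p:] * y \<in> J" using i f by (intro ideal_diff ideal_mult') auto
        then have "c * x \<in> J" using xy by simp
        then have "c * x \<in> J'" using eq by blast
        moreover have "[:int p:] * y \<in> J'" using i by (intro ideal_mult') auto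
        ultimately show "f \<in> J'" unfolding xy using i by (intro ideal_add) auto
      qed
      fix J J' assume "J \<in> A" "J' \<in> A" "{f. c * f \<in> J} = {f. c * f \<in> J'}"
      then show "J = J'" using sub[of J J'] sub[of J' J] by auto
    qed
    have img: "(\<lambda>J. {f. c * f \<in> J}) ` A \<subseteq> ideals_over p g'"
    proof
      fix M assume "M \<in> (\<lambda>J. {f. c * f \<in> J}) ` A"
      then obtain J where M: "M = {f. c * f \<in> J}" and i: "is_ideal J" "[:int p:] \<in> J" "g \<in> J"
        by (auto simp: A_def ideals_over_def)
      have "is_ideal M" unfolding is_ideal_def M
        using ideal_0[OF i(1)] ideal_add[OF i(1)] ideal_mult[OF i(1)]
        by (auto simp: distrib_left mult.left_commute[of c])
      moreover have "[:int p:] \<in> M" using ideal_mult[OF i(1,2), of c] by (simp add: M)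
      moreover have "g - b' * [:int p:] \<in> J" using i by (intro ideal_diff ideal_mult)
      then have "g' \<in> M" using g'(3) by (simp add: M mult.commute)
      ultimately show "M \<in> ideals_over p g'" by (simp add: ideals_over_def)
    qed
    have A: "finite A" "card A \<le> 2 ^ degree g'"
      using inj_on_finite[OF inj img] card_inj_on_le[OF inj img] IH by auto
    have B: "finite B" "card B \<le> 2 ^ degree g'"
      using finite_subset[OF Bsub] card_mono[OF _ Bsub] IH by auto
    have "card (ideals_over p g) \<le> 2 ^ degree g' + 2 ^ degree g'"
      unfolding un using card_Un_le[of A B] A B by linarith
    also have "\<dots> = 2 ^ Suc (degree g')" by simp
    also have "\<dots> \<le> 2 ^ degree g" using g'(2) mc by (intro power_increasing) auto
    finally show ?thesis using A B un by simp
  qed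
qed

section \<open>Packing bounds for ideals containing a small element\<close>

context monic_irreducible
begin

text \<open>Every class modulo \<open>J\<close> has a small representative. With b / N as inverse of
  \<open>s\<close>, the coefficients of a b / N are rounded down to \<open>q a\<close>; modulo
  \<open>g\<close>, the difference \<open>a - s * q a\<close> is \<open>s\<close> times a polynomial
  with coefficients in [0, 1), hence of height at most \<open>mulC * \<rho>\<close>.\<close>

lemma ideal_index_le:
  assumes J: "is_ideal J" "g \<in> J" and s: "s \<in> J" "s \<in> box n \<rho>" "s \<noteq> 0"
    and F: "finite F" "incongruent J F"
  shows "real (card F) \<le> (3 * mulC * \<rho>) ^ n"
proof -
  have ng: "\<not> g dvd s" using s(2,3) dvd_small_zero[of s] by (auto simp: box_def)
  obtain N b where N: "N > 0" and b: "g dvd s * b - [:N:]" using coprime_const[OF ng] by blast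
  have \<rho>: "\<rho> \<ge> 1"
  proof -
    obtain i where "coeff s i \<noteq> 0" using s(3) by (metis leading_coeff_0_iff)
    then have "1 \<le> \<bar>real_of_int (coeff s i)\<bar>" by linarith
    also have "\<dots> \<le> \<rho>" using s(2) by (auto simp: box_def)
    finally show ?thesis .
  qed
  define q where "q a = map_poly (\<lambda>x. x div N) (red (a * b))" for a
  define f where "f a = map_poly (\<lambda>x. x mod N) (red (a * b))" for a
  define rep where "rep a = red (a - s * q a)" for a
  have cq: "coeff (q a) i = coeff (red (a * b)) i div N" for a i by (simp add: q_def coeff_map_poly)
  have cf: "coeff (f a) i = coeff (red (a * b)) i mod N" for a i by (simp add: f_def coeff_map_poly)
  have eq: "red (a * b) = smult N (q a) + f a" for a
    by (intro poly_eqI) (simp add: cq cf)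
  have fbox: "f a \<in> box n (real_of_int N)" for a
  proof (rule boxI)
    show "coeff (f a) i = 0" if "i \<ge> n" for i using red(1)[OF that] by (simp add: cf)
    fix i
    have "0 \<le> coeff (f a) i" "coeff (f a) i < N" using N by (simp_all add: cf)
    then show "\<bar>real_of_int (coeff (f a) i)\<bar> \<le> real_of_int N" by simp
  qed
  have "smult N (rep a) = red (s * f a)" for a
  proof -
    have "g dvd smult N (a - s * q a) - s * f a"
    proof -
      have "smult N (a - s * q a) - s * f a = smult N a - s * red (a * b)"
        unfolding eq by (simp add: algebra_simps smult_diff_right)
      also have "\<dots> = s * (a * b - red (a * b)) - a * (s * b - [:N:])"
        by (simp add: algebra_simps)
      also have "g dvd \<dots>" by (rule dvd_diff[OF dvd_mult[OF red(2)] dvd_mult[OF b]])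
      finally show ?thesis .
    qed
    then show ?thesis unfolding rep_def red_smult[symmetric] by (simp only: red_eq_iff)
  qed
  then have Nrep: "smult N (rep a) \<in> box n (mulC * \<rho> * N)" for a
    using red_mult_box[OF s(2) fbox] by metis
  have repbox: "rep a \<in> box n (mulC * \<rho>)" for a
  proof (rule boxI)
    show "coeff (rep a) i = 0" if "i \<ge> n" for i using red(1)[OF that] by (simp add: rep_def)
    fix i
    have "real_of_int N * \<bar>real_of_int (coeff (rep a) i)\<bar> \<le> real_of_int N * (mulC * \<rho>)"
      using Nrep[of a] N by (auto simp: box_def abs_mult mult.commute)
    then show "\<bar>real_of_int (coeff (rep a) i)\<bar> \<le> mulC * \<rho>" using N by simp
  qed
  have repJ: "a - rep a \<in> J" for a
  proof -
    have "(a - s * q a) - rep a \<in> J" using ideal_dvd[OF J red(2)] by (simp add: rep_def)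
    then have "((a - s * q a) - rep a) + s * q a \<in> J" using J s by (intro ideal_add ideal_mult')
    then show ?thesis by simp
  qed
  have inj: "inj_on rep F"
  proof (rule inj_onI)
    fix a a' assume a: "a \<in> F" "a' \<in> F" "rep a = rep a'"
    have "(a - rep a) - (a' - rep a') \<in> J" by (rule ideal_diff[OF J(1) repJ repJ])
    then show "a = a'" using a F by (auto simp: incongruent_def)
  qed
  have nn: "mulC * \<rho> \<ge> 1" using mult_mono[OF mulC_ge_1 \<rho>] \<rho> mulC_ge_1 by simp
  then have bx: "finite (box n (mulC * \<rho>))" "real (card (box n (mulC * \<rho>))) \<le> (2 * (mulC * \<rho>) + 1) ^ n"
    using card_box[of "mulC * \<rho>" n] by auto
  have "card F \<le> card (box n (mulC * \<rho>))"
    using card_inj_on_le[OF inj _ bx(1)] repbox by blast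
  then have "real (card F) \<le> (2 * (mulC * \<rho>) + 1) ^ n" using bx(2) by linarith
  also have "2 * (mulC * \<rho>) + 1 \<le> 3 * mulC * \<rho>" unfolding mult.assoc using nn by linarith
  then have "(2 * (mulC * \<rho>) + 1) ^ n \<le> (3 * mulC * \<rho>) ^ n" using nn by (intro power_mono) auto
  finally show ?thesis .
qed

lemma one_plus_power_le:
  fixes x :: real
  assumes "x \<ge> 0"
  shows "(1 + x) ^ m \<le> 2 ^ m * (1 + x ^ m)"
proof (cases "x \<le> 1")
  case True
  have "(1 + x) ^ m \<le> 2 ^ m" using True assms by (intro power_mono) auto
  also have "\<dots> \<le> 2 ^ m * (1 + x ^ m)" using assms by simp
  finally show ?thesis .
next
  case False
  have "(1 + x) ^ m \<le> (2 * x) ^ m" using False by (intro power_mono) auto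
  also have "\<dots> \<le> 2 ^ m * (1 + x ^ m)" by (simp add: power_mult_distrib)
  finally show ?thesis .
qed

definition packC :: real where "packC = (6 * mulC) ^ n"

lemma packC_ge_1: "packC \<ge> 1" unfolding packC_def using mulC_ge_1 by (intro one_le_power) auto

text \<open>By \<open>ideal_index_le\<close>, a nonzero element of \<open>J\<close> has height at
  least \<open>x\<close>, since the index is at least \<open>q\<close>. So a cube whose side
  \<open>w\<close> is \<open>x\<close> rounded up contains at most one point of \<open>R\<close>,
  and at most (1 + B/x)^n cubes cover the box.\<close>

lemma card_box_ideal_le:
  fixes B :: nat
  assumes J: "is_ideal J" "g \<in> J" and F: "finite F" "incongruent J F" "card F = q" "q > 0"
    and R: "\<And>r i. r \<in> R \<Longrightarrow> i \<ge> n \<Longrightarrow> coeff r i = 0"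
      "\<And>r i. r \<in> R \<Longrightarrow> i < n \<Longrightarrow> coeff r i \<in> {0..<int B}"
      "\<And>r r'. r \<in> R \<Longrightarrow> r' \<in> R \<Longrightarrow> r - r' \<in> J"
  shows "finite R" "real (card R) \<le> packC * (1 + real B ^ n / real q)"
proof -
  define x where "x = root n (real q) / (3 * mulC)"
  have x0: "x > 0" using F n_pos mulC_ge_1 by (simp add: x_def)
  have xn: "(3 * mulC * x) ^ n = real q" using mulC_ge_1 n_pos F by (simp add: x_def)
  define w where "w = \<lceil>x\<rceil>"
  have w: "w \<ge> 1" "real_of_int w - 1 < x" "x \<le> real_of_int w" using x0 unfolding w_def by linarith+
  have "finite R \<and> card R \<le> card {0..int B div w} ^ n"
  proof (rule card_inj_coeffs[of _ _ "\<lambda>r i. coeff r i div w"])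
    fix r i assume "r \<in> R" "i < n"
    then have "coeff r i \<in> {0..<int B}" by (rule R(2))
    then show "coeff r i div w \<in> {0..int B div w}" using w
      by (auto intro: zdiv_mono1 simp: pos_imp_zdiv_nonneg_iff)
  next
    fix r r' assume r: "r \<in> R" "r' \<in> R" and same: "\<And>i. i < n \<Longrightarrow> coeff r i div w = coeff r' i div w"
    show "r = r'"
    proof (rule ccontr)
      assume "r \<noteq> r'"
      have "r - r' \<in> box n (real_of_int (w - 1))"
      proof (rule boxI)
        show "coeff (r - r') i = 0" if "i \<ge> n" for i using R(1) r that by simp
        fix i
        show "\<bar>real_of_int (coeff (r - r') i)\<bar> \<le> real_of_int (w - 1)"
        proof (cases "i < n")
          case True
          have "coeff r i - coeff r' i = coeff r i mod w - coeff r' i mod w"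
            using same[OF True] by (metis add_diff_cancel_left mult_div_mod_eq)
          moreover have "0 \<le> coeff r i mod w" "coeff r i mod w < w" "0 \<le> coeff r' i mod w" "coeff r' i mod w < w"
            using w(1) by simp_all
          ultimately have "\<bar>coeff r i - coeff r' i\<bar> \<le> w - 1" by linarith
          then show ?thesis by (metis coeff_diff of_int_abs of_int_le_iff)
        next
          case False
          then show ?thesis using R(1) r w by simp
        qed
      qed
      moreover have "r - r' \<noteq> 0" using \<open>r \<noteq> r'\<close> by simp
      ultimately have "real q \<le> (3 * mulC * real_of_int (w - 1)) ^ n"
        using ideal_index_le[OF J R(3)[OF r] _ _ F(1,2)] F(3) by blast
      also have "\<dots> < (3 * mulC * x) ^ n"
        using w mulC_ge_1 n_pos by (intro power_strict_mono) auto
      finally show False using xn by simp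
    qed
  qed simp
  then show "finite R" and cR: "real (card R) \<le> packC * (1 + real B ^ n / real q)"
  proof -
    assume a: "finite R \<and> card R \<le> card {0..int B div w} ^ n"
    show "finite R" using a by simp
    have "real (card {0..int B div w}) = real_of_int (int B div w) + 1"
      using w by (simp add: pos_imp_zdiv_nonneg_iff)
    also have "\<dots> \<le> 1 + real B / x"
    proof -
      have "real_of_int (int B div w) \<le> real B / real_of_int w"
        by (metis of_int_of_nat_eq real_of_int_div4)
      also have "\<dots> \<le> real B / x" using w x0 by (intro divide_left_mono) auto
      finally show ?thesis by simp
    qed
    finally have c: "real (card {0..int B div w}) \<le> 1 + real B / x" .
    have "real (card R) \<le> real (card {0..int B div w} ^ n)" using a by (simp only: of_nat_le_iff)
    also have "\<dots> = real (card {0..int B div w}) ^ n" by simp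
    also have "\<dots> \<le> (1 + real B / x) ^ n" using c by (intro power_mono) auto
    also have "\<dots> \<le> 2 ^ n * (1 + (real B / x) ^ n)" using x0 by (intro one_plus_power_le) auto
    also have "(real B / x) ^ n = (3 * mulC) ^ n * (real B ^ n / real q)"
      using xn[symmetric] x0 mulC_ge_1 by (simp add: power_divide power_mult_distrib)
    also have "2 ^ n * (1 + (3 * mulC) ^ n * (real B ^ n / real q)) \<le> 2 ^ n * ((3 * mulC) ^ n + (3 * mulC) ^ n * (real B ^ n / real q))"
    proof -
      have "1 \<le> (3 * mulC) ^ n" using mulC_ge_1 by (intro one_le_power) auto
      then show ?thesis by simp
    qed
    also have "\<dots> = packC * (1 + real B ^ n / real q)"
    proof -
      have "packC = 2 ^ n * (3 * mulC) ^ n" unfolding packC_def power_mult_distrib[symmetric] by simp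
      then show ?thesis by (simp only: distrib_left mult_1_right mult.assoc)
    qed
    finally show "real (card R) \<le> packC * (1 + real B ^ n / real q)" .
  qed
qed

text \<open>The least positive integer in the ideal (r, g), used in place of the norm of
  \<open>r\<close>.\<close>

definition least_const :: "int poly \<Rightarrow> nat" where
  "least_const r = (LEAST m. m > 0 \<and> (\<exists>b. g dvd r * b - [:int m:]))"

lemma least_const:
  assumes "\<not> g dvd r"
  shows "least_const r > 0" "\<exists>b. g dvd r * b - [:int (least_const r):]"
    and "\<And>k. k > 0 \<Longrightarrow> g dvd r * b - [:int k:] \<Longrightarrow> least_const r \<le> k"
proof -
  obtain N b where N: "N > 0" "g dvd r * b - [:N:]" using coprime_const[OF assms] by blast
  have "\<exists>m::nat. m > 0 \<and> (\<exists>b. g dvd r * b - [:int m:])"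
    using N by (intro exI[of _ "nat N"]) auto
  from LeastI_ex[OF this] show "least_const r > 0" "\<exists>b. g dvd r * b - [:int (least_const r):]" by (simp_all add: least_const_def)
  show "least_const r \<le> k" if "k > 0" "g dvd r * b - [:int k:]" for k b
    unfolding least_const_def by (rule Least_le) (use that in blast)
qed

definition gen_ideal :: "nat \<Rightarrow> int poly \<Rightarrow> int poly set" where
  "gen_ideal q r = {[:int q:] * a + g * b + r * c | a b c. True}"

lemma gen_idealI: "[:int q:] * a + g * b + r * c \<in> gen_ideal q r" by (auto simp: gen_ideal_def)

lemma gen_ideal: "is_ideal (gen_ideal q r)" "[:int q:] \<in> gen_ideal q r" "g \<in> gen_ideal q r" "r \<in> gen_ideal q r"
proof -
  show "is_ideal (gen_ideal q r)" unfolding is_ideal_def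
  proof (intro conjI ballI allI)
    show "0 \<in> gen_ideal q r" using gen_idealI[of q 0 0 r 0] by simp
  next
    fix u v assume "u \<in> gen_ideal q r" "v \<in> gen_ideal q r"
    then obtain a b c a' b' c' where "u = [:int q:] * a + g * b + r * c" "v = [:int q:] * a' + g * b' + r * c'"
      by (auto simp: gen_ideal_def)
    then have "u + v = [:int q:] * (a + a') + g * (b + b') + r * (c + c')"
      by (simp add: algebra_simps smult_add_right)
    then show "u + v \<in> gen_ideal q r" by (metis gen_idealI)
  next
    fix u f assume "u \<in> gen_ideal q r"
    then obtain a b c where "u = [:int q:] * a + g * b + r * c"
      by (auto simp: gen_ideal_def)
    then have "f * u = [:int q:] * (f * a) + g * (f * b) + r * (f * c)"
      by (simp only: distrib_left ac_simps)
    then show "f * u \<in> gen_ideal q r" by (metis gen_idealI)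
  qed
  show "[:int q:] \<in> gen_ideal q r" using gen_idealI[of q 1 0 r 0] by simp
  show "g \<in> gen_ideal q r" using gen_idealI[of q 0 1 r 0] by simp
  show "r \<in> gen_ideal q r" using gen_idealI[of q 0 0 r 1] by simp
qed

text \<open>Multiplication by \<open>least_const r\<close> divided by \<open>q\<close> carries (q,
  g, r) into (r, g). A constant not divisible by \<open>q\<close> would thus yield a positive
  integer in (r, g) below \<open>least_const r\<close>.\<close>

lemma const_in_gen_ideal:
  assumes r: "\<not> g dvd r" and q: "q dvd least_const r" and k: "[:k:] \<in> gen_ideal q r"
  shows "int q dvd k"
proof -
  have q0: "q > 0" using q least_const(1)[OF r] by (auto intro: Nat.gr0I)
  define d where "d = gcd k (int q)"
  obtain u v where uv: "u * k + v * int q = d" unfolding d_def using bezout_int by blast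
  have "smult u [:k:] + smult v [:int q:] \<in> gen_ideal q r"
    using gen_ideal k by (intro ideal_add ideal_smult) auto
  then have "[:d:] \<in> gen_ideal q r" using uv by simp
  then obtain a b c where abc: "[:d:] = [:int q:] * a + g * b + r * c" by (auto simp: gen_ideal_def)
  obtain m' where "least_const r = q * m'" using q by (elim dvdE)
  then have m': "least_const r = m' * q" by (simp only: mult.commute)
  have m'0: "m' > 0" using m' least_const(1)[OF r] by (cases m') auto
  obtain e where e: "g dvd r * e - [:int (least_const r):]" using least_const(2)[OF r] by blast
  have dpos: "d > 0" using q0 by (simp add: d_def)
  have "[:int m':] * [:d:] = [:int m':] * ([:int q:] * a + g * b + r * c)" using abc by simp
  also have "\<dots> = [:int (least_const r):] * a + g * ([:int m':] * b) + r * ([:int m':] * c)"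
  proof -
    have "[:int (least_const r):] = [:int m':] * [:int q:]" by (simp add: m')
    then show ?thesis by (simp only: distrib_left ac_simps)
  qed
  finally have "r * (e * a + [:int m':] * c) - [:int m':] * [:d:] = (r * e - [:int (least_const r):]) * a - g * ([:int m':] * b)"
    by (simp only: algebra_simps)
  also have "g dvd \<dots>" by (rule dvd_diff[OF dvd_mult2[OF e] dvd_triv_left])
  also have "[:int m':] * [:d:] = [:int (m' * nat d):]" using dpos by simp
  finally have "g dvd r * (e * a + [:int m':] * c) - [:int (m' * nat d):]" .
  moreover have "m' * nat d > 0" using m'0 dpos by simp
  ultimately have "least_const r \<le> m' * nat d" using least_const(3)[OF r] by blast
  then have "q \<le> nat d" using m' m'0 by simp
  moreover have "nat d dvd q" unfolding d_def by (simp add: nat_dvd_iff)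
  ultimately have "nat d = q" using q0 by (simp add: dvd_imp_le le_antisym)
  then have "d = int q" using dpos by simp
  then show ?thesis unfolding d_def by (metis gcd_dvd1)
qed

lemma incongruent_consts:
  assumes "\<And>k. [:k:] \<in> J \<Longrightarrow> int q dvd k"
  shows "incongruent J ((\<lambda>i. [:int i:]) ` {..<q})" "card ((\<lambda>i. [:int i:]) ` {..<q}) = q"
proof -
  show "incongruent J ((\<lambda>i. [:int i:]) ` {..<q})"
    unfolding incongruent_def
  proof (intro ballI impI)
    fix a b assume "a \<in> (\<lambda>i. [:int i:]) ` {..<q}" "b \<in> (\<lambda>i. [:int i:]) ` {..<q}" "a - b \<in> J"
    then obtain i j where ij: "i < q" "j < q" "a = [:int i:]" "b = [:int j:]" by auto
    have "int q dvd int i - int j" using assms[of "int i - int j"] \<open>a - b \<in> J\<close> ij by simp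
    then have "int i mod int q = int j mod int q" by (simp add: mod_eq_dvd_iff)
    then show "a = b" using ij by simp
  qed
  show "card ((\<lambda>i. [:int i:]) ` {..<q}) = q" by (subst card_image) (auto simp: inj_on_def)
qed

text \<open>If no X - x lies in the proper ideal \<open>J\<close>, then 1 and X are linearly
  independent over the prime field modulo \<open>J\<close>, so the index is at least p^2.\<close>

lemma incongruent_linear:
  assumes p: "prime p" and J: "is_ideal J" "[:int p:] \<in> J" "1 \<notin> J"
    and nr: "\<And>x. [:- x, 1:] \<notin> J"
  defines "F \<equiv> (\<lambda>(a, b). [:int a, int b:]) ` ({..<p} \<times> {..<p})"
  shows "incongruent J F" "finite F" "card F = p\<^sup>2"
proof -
  show "finite F" by (simp add: F_def)
  show "card F = p\<^sup>2" unfolding F_def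
    by (subst card_image) (auto simp: inj_on_def power2_eq_square)
  have inv: "\<exists>u v. u * k + v * int p = 1" if "\<not> int p dvd k" for k
  proof -
    have "prime (int p)" using p by simp
    then have "gcd (int p) k = 1" using that prime_imp_coprime coprime_iff_gcd_eq_1 by blast
    then show ?thesis using bezout_int[of k "int p"] by (metis gcd.commute)
  qed
  have red1: False if u: "[:x, y:] \<in> J" and y: "\<not> int p dvd y" for x y
  proof -
    obtain u v where uv: "u * y + v * int p = 1" using inv[OF y] by blast
    have "smult u [:x, y:] + [:0, v:] * [:int p:] \<in> J" using J that by (intro ideal_add ideal_smult ideal_mult)
    also have "smult u [:x, y:] + [:0, v:] * [:int p:] = [:- (- u * x), 1:]"
      using uv by (simp add: mult.commute[of v])
    finally show False using nr by blast
  qed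
  have red0: False if u: "[:x:] \<in> J" and x: "\<not> int p dvd x" for x
  proof -
    obtain u v where uv: "u * x + v * int p = 1" using inv[OF x] by blast
    have "smult u [:x:] + smult v [:int p:] \<in> J" using J that by (intro ideal_add ideal_smult)
    also have "smult u [:x:] + smult v [:int p:] = 1" using uv by simp
    finally show False using J by blast
  qed
  have small: "i = j" if "int p dvd int i - int j" "i < p" "j < p" for i j
  proof -
    have "int i mod int p = int j mod int p" using that(1) by (simp only: mod_eq_dvd_iff)
    then show ?thesis using that by simp
  qed
  show "incongruent J F" unfolding incongruent_def
  proof (intro ballI impI)
    fix s t assume "s \<in> F" "t \<in> F" "s - t \<in> J"
    then obtain a b a' b' where ab: "a < p" "b < p" "a' < p" "b' < p" "s = [:int a, int b:]" "t = [:int a', int b':]"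
      by (auto simp: F_def)
    have "b = b'" using red1[of "int a - int a'" "int b - int b'"] \<open>s - t \<in> J\<close> ab small by auto
    moreover from this have "a = a'" using red0[of "int a - int a'"] \<open>s - t \<in> J\<close> ab small by auto
    ultimately show "s = t" using ab by simp
  qed
qed

lemma synthetic_div_int: "\<exists>w. f = [:- x, 1:] * w + [:poly f x:]" for f :: "int poly"
proof -
  have "poly (f - [:poly f x:]) x = 0" by simp
  then obtain w where "f - [:poly f x:] = [:- x, 1:] * w" by (metis poly_eq_0_iff_dvd dvdE)
  then show ?thesis by (intro exI[of _ w]) (simp add: algebra_simps)
qed

lemma root_in_ideal:
  assumes "is_ideal J" "[:- x, 1:] \<in> J" "f \<in> J"
  shows "[:poly f x:] \<in> J"
proof -
  obtain w where w: "f = [:- x, 1:] * w + [:poly f x:]" using synthetic_div_int by blast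
  have "f - [:- x, 1:] * w \<in> J" using assms by (intro ideal_diff ideal_mult')
  then show ?thesis using w by (metis add_diff_cancel_left')
qed

text \<open>A step in the style of Hensel: write X - x = p a + g b + r c. Replacing \<open>a\<close>
  by its value at \<open>x\<close> changes p a by a multiple of p (X - x), which lies in (p^2, g,
  r). So x + p a(x) serves as \<open>y\<close>.\<close>

lemma root_lift:
  assumes "[:- x, 1:] \<in> gen_ideal p r"
  shows "\<exists>y. [:- y, 1:] \<in> gen_ideal (p\<^sup>2) r"
proof -
  obtain a b c where abc: "[:- x, 1:] = [:int p:] * a + g * b + r * c" using assms by (auto simp: gen_ideal_def)
  obtain w where w: "a = [:- x, 1:] * w + [:poly a x:]" using synthetic_div_int by blast
  let ?J = "gen_ideal (p\<^sup>2) r"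
  have "[:int p:] * [:- x, 1:] = [:int (p\<^sup>2):] * a + g * ([:int p:] * b) + r * ([:int p:] * c)"
    unfolding abc by (simp add: algebra_simps power2_eq_square smult_add_right)
  then have "[:int p:] * [:- x, 1:] \<in> ?J" by (metis gen_idealI)
  then have "([:int p:] * [:- x, 1:]) * w + (g * b + r * c) \<in> ?J"
    by (intro ideal_add[OF gen_ideal(1)] ideal_mult'[OF gen_ideal(1) gen_ideal(3)] ideal_mult'[OF gen_ideal(1) gen_ideal(4)] ideal_mult'[OF gen_ideal(1), of "[:int p:] * [:- x, 1:]"])
  also have "([:int p:] * [:- x, 1:]) * w + (g * b + r * c) = [:- x, 1:] - [:int p * poly a x:]"
  proof -
    have "(P * X) * w + (g * b + r * c) = X - P * A" if "a = X * w + A" "X = P * a + g * b + r * c" for P X A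
    proof -
      have "X * w = a - A" "g * b + r * c = X - P * a" using that by (simp, metis add.assoc add_diff_cancel_left')
      then have "(P * X) * w + (g * b + r * c) = P * (a - A) + (X - P * a)" by (simp only: mult.assoc)
      then show ?thesis by (simp add: algebra_simps)
    qed
    moreover have "[:int p:] * [:poly a x:] = [:int p * poly a x:]" by simp
    ultimately show ?thesis using w abc by metis
  qed
  also have "\<dots> = [:- (x + int p * poly a x), 1:]" by simp
  finally show ?thesis by blast
qed

end

text \<open>The ideal generated by \<open>q\<close> and X - x, written as the kernel of an
  evaluation.\<close>

definition root_ideal :: "nat \<Rightarrow> int \<Rightarrow> int poly set" where
  "root_ideal q x = {f. int q dvd poly f x}"

lemma root_ideal: "is_ideal (root_ideal q x)" "[:k:] \<in> root_ideal q x \<longleftrightarrow> int q dvd k"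
  by (auto simp: is_ideal_def root_ideal_def)

definition nbox :: "nat \<Rightarrow> nat \<Rightarrow> int poly set" where
  "nbox n B = {r. (\<forall>i\<ge>n. coeff r i = 0) \<and> (\<forall>i<n. coeff r i \<in> {0..<int B})}"

lemma card_nbox: "finite (nbox n B) \<and> card (nbox n B) = B ^ n"
proof -
  have 1: "finite (nbox n B) \<and> card (nbox n B) \<le> card {0..<int B} ^ n"
  proof (rule card_inj_coeffs[of _ _ coeff])
    fix f f' assume "f \<in> nbox n B" "f' \<in> nbox n B" "\<And>i. i < n \<Longrightarrow> coeff f i = coeff f' i"
    then have "coeff f i = coeff f' i" for i by (cases "i < n") (auto simp: nbox_def)
    then show "f = f'" by (rule poly_eqI)
  qed (auto simp: nbox_def)
  define G where "G h = (\<Sum>i<n. monom (h i) i)" for h :: "nat \<Rightarrow> int"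
  have cG: "coeff (G h) j = (if j < n then h j else 0)" for h j
    by (simp add: G_def coeff_sum)
  have inj: "inj_on G (PiE {..<n} (\<lambda>_. {0..<int B}))"
  proof (rule inj_onI)
    fix h h' assume h: "h \<in> PiE {..<n} (\<lambda>_. {0..<int B})" "h' \<in> PiE {..<n} (\<lambda>_. {0..<int B})" "G h = G h'"
    show "h = h'"
    proof (rule PiE_ext[OF h(1,2)])
      fix i assume "i \<in> {..<n}"
      then show "h i = h' i" using cG[of h i] cG[of h' i] h(3) by simp
    qed
  qed
  have "G ` PiE {..<n} (\<lambda>_. {0..<int B}) \<subseteq> nbox n B"
  proof (rule image_subsetI)
    fix h assume "h \<in> PiE {..<n} (\<lambda>_. {0..<int B})"
    then have "h i \<in> {0..<int B}" if "i < n" for i using PiE_mem[of h "{..<n}" _ i] that by blast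
    then show "G h \<in> nbox n B" unfolding nbox_def by (simp only: cG mem_Collect_eq) simp
  qed
  from card_inj_on_le[OF inj this] 1 have "B ^ n \<le> card (nbox n B)"
    by (simp add: card_PiE)
  then show ?thesis using 1 by simp
qed

section \<open>Primes modulo which a polynomial has a root\<close>

lemma sum_inverse_squares_tail:
  assumes "T > 0"
  shows "(\<Sum>k\<in>{T<..M}. 1 / real k ^ 2) \<le> 1 / real T"
proof (cases "T \<le> M")
  case True
  then have "(\<Sum>k\<in>{T<..M}. 1 / real k ^ 2) \<le> 1 / real T - 1 / real M"
  proof (induction M rule: dec_induct)
    case (step m)
    have "{T<..Suc m} = insert (Suc m) {T<..m}" using step by auto
    then have "(\<Sum>k\<in>{T<..Suc m}. 1 / real k ^ 2) = 1 / real (Suc m) ^ 2 + (\<Sum>k\<in>{T<..m}. 1 / real k ^ 2)"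
      by simp
    also have "\<dots> \<le> 1 / real (Suc m) ^ 2 + (1 / real T - 1 / real m)" using step by simp
    also have "1 / real (Suc m) ^ 2 \<le> 1 / real m - 1 / real (Suc m)"
    proof -
      have m: "real m > 0" using step assms by simp
      then have "1 / real m - 1 / real (Suc m) = 1 / (real m * real (Suc m))" by (simp add: field_simps)
      moreover have "1 / real (Suc m) ^ 2 \<le> 1 / (real m * real (Suc m))"
        unfolding power2_eq_square using m by (intro divide_left_mono mult_right_mono) auto
      ultimately show ?thesis by linarith
    qed
    finally show ?case by simp
  qed simp
  also have "\<dots> \<le> 1 / real T" by simp
  finally show ?thesis .
qed simp

section \<open>Roots modulo p and modulo p^2\<close>

context monic_irreducible
begin

text \<open>\<open>\<Delta>\<close> is a positive integer in the ideal generated by \<open>g\<close>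
  and its derivative; it replaces the discriminant.\<close>

lemma simple_roots_mod:
  "\<exists>\<Delta>::nat. \<Delta> > 0 \<and> (\<forall>p x. prime p \<longrightarrow> \<not> p dvd \<Delta> \<longrightarrow> int p dvd poly g x \<longrightarrow> \<not> int p dvd poly (pderiv g) x)"
proof -
  have "\<not> g dvd pderiv g"
  proof
    assume "g dvd pderiv g"
    then have "pderiv g = 0" by (rule dvd_small_zero) (use deg n_pos in \<open>auto simp: coeff_pderiv coeff_eq_0\<close>)
    then show False using n_pos deg by (simp add: pderiv_eq_0_iff)
  qed
  then obtain N b where N: "N > 0" "g dvd pderiv g * b - [:N:]" using coprime_const by blast
  have "\<not> int p dvd poly (pderiv g) x" if p: "prime p" "\<not> p dvd nat N" "int p dvd poly g x" for p x
  proof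
    assume d: "int p dvd poly (pderiv g) x"
    obtain k where "pderiv g * b - [:N:] = g * k" using N(2) by (elim dvdE)
    then have "poly (pderiv g * b - [:N:]) x = poly (g * k) x" by simp
    then have "N = poly (pderiv g) x * poly b x - poly g x * poly k x" by simp
    then have "int p dvd N" using d p(3) by simp
    then show False using p(2) N by (simp add: int_dvd_int_iff[symmetric])
  qed
  then show ?thesis using N(1) by (intro exI[of _ "nat N"]) auto
qed

text \<open>A simple root modulo \<open>p\<close> has at most one lift modulo p^2, so roots modulo
  p^2 are told apart by the ideals (p, X - x), which number at most 2^n.\<close>

lemma card_roots_mod_square:
  assumes p: "prime p" and simple: "\<And>x. int p dvd poly g x \<Longrightarrow> \<not> int p dvd poly (pderiv g) x"
  shows "card {x \<in> {..<p\<^sup>2}. int (p\<^sup>2) dvd poly g (int x)} \<le> 2 ^ n"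
proof -
  let ?R = "{x \<in> {..<p\<^sup>2}. int (p\<^sup>2) dvd poly g (int x)}"
  have pr: "int p dvd poly g (int x)" if "x \<in> ?R" for x
    using that by (auto simp: power2_eq_square intro: dvd_mult_left)
  have inj: "inj_on (\<lambda>x. root_ideal p (int x)) ?R"
  proof (rule inj_onI)
    fix x y assume x: "x \<in> ?R" and y: "y \<in> ?R" and eq: "root_ideal p (int x) = root_ideal p (int y)"
    define d where "d = int y - int x"
    have "[:- int x, 1:] \<in> root_ideal p (int x)" by (simp add: root_ideal_def)
    then have "[:- int x, 1:] \<in> root_ideal p (int y)" using eq by simp
    then have pd: "int p dvd d" by (simp add: root_ideal_def d_def)
    obtain w where w: "g = [:- int x, 1:] * w + [:poly g (int x):]" using synthetic_div_int by blast
    obtain v where v: "w = [:- int x, 1:] * v + [:poly w (int x):]" using synthetic_div_int by blast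
    have "poly (pderiv g) (int x) = poly w (int x)"
      by (subst w) (simp add: pderiv_add pderiv_diff pderiv_smult pderiv_pCons)
    moreover have "poly g (int y) = d * poly w (int y) + poly g (int x)" by (subst w) (simp add: d_def algebra_simps)
    moreover have "poly w (int y) = d * poly v (int y) + poly w (int x)" by (subst v) (simp add: d_def algebra_simps)
    ultimately have e: "poly g (int y) - poly g (int x) = d * (poly (pderiv g) (int x) + d * poly v (int y))" by simp
    have "\<not> int p dvd poly (pderiv g) (int x) + d * poly v (int y)"
      using simple[OF pr[OF x]] pd by (metis dvd_add_left_iff dvd_mult2)
    have prod: "int (p\<^sup>2) dvd d * (poly (pderiv g) (int x) + d * poly v (int y))"
      unfolding e[symmetric] using x y by (intro dvd_diff) auto
    have cop: "gcd (int (p\<^sup>2)) (poly (pderiv g) (int x) + d * poly v (int y)) = 1"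
    proof -
      have "prime (int p)" using p by simp
      then have "gcd (int p) (poly (pderiv g) (int x) + d * poly v (int y)) = 1"
        using \<open>\<not> int p dvd poly (pderiv g) (int x) + d * poly v (int y)\<close> prime_imp_coprime coprime_iff_gcd_eq_1 by blast
      then have "gcd (int p ^ 2) (poly (pderiv g) (int x) + d * poly v (int y)) = 1"
        by (metis coprime_iff_gcd_eq_1 coprime_power_left_iff)
      then show ?thesis by simp
    qed
    have "int (p\<^sup>2) dvd d"
      by (rule iffD1[OF coprime_dvd_mult_left_iff[OF iffD2[OF coprime_iff_gcd_eq_1 cop]] prod])
    then have "int y mod int (p\<^sup>2) = int x mod int (p\<^sup>2)" unfolding d_def by (simp only: mod_eq_dvd_iff)
    then show "x = y" using x y by (simp add: zmod_int[symmetric])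
  qed
  have "(\<lambda>x. root_ideal p (int x)) ` ?R \<subseteq> ideals_over p g"
    using pr by (auto simp: ideals_over_def root_ideal) (simp add: root_ideal_def)
  from card_inj_on_le[OF inj this] card_ideals_over[OF p monic] show ?thesis by (simp add: deg)
qed

end

section \<open>Elements of a box with large least constant, and their bad primes\<close>

locale density_setup = monic_irreducible +
  fixes T B :: nat
  assumes T_pos: "T > 0" and B_pos: "B > 0"
    and simple: "\<And>p x. prime p \<Longrightarrow> p > T \<Longrightarrow> int p dvd poly g x \<Longrightarrow> \<not> int p dvd poly (pderiv g) x"
begin

definition Q :: nat where "Q = fact T"
definition K :: nat where "K = nat \<lceil>2 * mulC\<rceil>"

text \<open>
  The constant term \<open>Q K B\<close> dominates the remaining coefficients, so that \<open>least_const\<close> is at least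
  \<open>B\<close>; being 1 modulo \<open>Q = T!\<close> keeps it free of prime factors up to \<open>T\<close>.
\<close>

definition large_elem :: "int poly \<Rightarrow> int poly" where "large_elem r' = smult (int Q) ([:int (K * B):] + r') + 1"

text \<open>An ideal over \<open>g\<close> containing some \<open>large_elem r\<close> has index at
  most \<open>(heightC * B) ^ n\<close>. The value does not involve \<open>B\<close>, which can
  therefore tend to infinity later.\<close>

definition heightC :: real where "heightC = 3 * mulC * real (Q * (K + 2))"

lemma Q_pos: "Q > 0" by (simp add: Q_def)

lemma K_ge: "real K \<ge> 2 * mulC" using mulC_ge_1 unfolding K_def by linarith

lemma large_elem_box:
  assumes "r \<in> nbox n B"
  shows "large_elem r \<in> box n (real (Q * (K + 2) * B))"
proof (rule boxI)
  show "coeff (large_elem r) i = 0" if "i \<ge> n" for i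
    using that n_pos assms by (auto simp: large_elem_def nbox_def coeff_pCons split: nat.splits)
  fix i
  have c: "0 \<le> coeff r i" "coeff r i \<le> int B"
    using assms by (cases "i < n", auto simp: nbox_def)+
  have "coeff (large_elem r) i = int Q * ((if i = 0 then int (K * B) else 0) + coeff r i) + (if i = 0 then 1 else 0)"
    by (simp add: large_elem_def coeff_pCons split: nat.splits)
  also have "\<bar>\<dots>\<bar> \<le> int Q * (int (K * B) + int B) + 1"
  proof -
    define t where "t = (if i = 0 then int (K * B) else 0) + coeff r i"
    have t: "0 \<le> t" "t \<le> int (K * B) + int B" using c by (auto simp: t_def simp del: of_nat_mult)
    have "0 \<le> int Q * t" "int Q * t \<le> int Q * (int (K * B) + int B)"
      using t by (auto intro!: mult_left_mono simp del: of_nat_mult)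
    then show ?thesis unfolding t_def[symmetric] by simp
  qed
  also have "\<dots> \<le> int Q * (int (K * B) + int B) + int Q * int B"
  proof -
    have "1 * 1 \<le> int Q * int B" using Q_pos B_pos by (intro mult_mono) auto
    then show ?thesis by linarith
  qed
  also have "\<dots> = int (Q * (K + 2) * B)" by (simp add: algebra_simps)
  finally show "\<bar>real_of_int (coeff (large_elem r) i)\<bar> \<le> real (Q * (K + 2) * B)"
    by linarith
qed

lemma large_elem_nonzero:
  assumes "r \<in> nbox n B"
  shows "large_elem r \<noteq> 0" "\<not> g dvd large_elem r"
proof -
  have "coeff r 0 \<ge> 0" using assms n_pos by (auto simp: nbox_def)
  then have "coeff (large_elem r) 0 > 0" by (simp add: large_elem_def)
  then show "large_elem r \<noteq> 0" by auto
  then show "\<not> g dvd large_elem r" using large_elem_box[OF assms] dvd_small_zero by (auto simp: box_def)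
qed

text \<open>Let \<open>s\<close> turn the large element into its least constant modulo
  \<open>g\<close>, and look at a coefficient of \<open>s\<close> of largest absolute value
  \<open>\<sigma>\<close>. The scalar part \<open>k0\<close> of the large element contributes
  \<open>k0 * \<sigma>\<close> there, while the rest is at most
  \<open>Q * mulC * B * \<sigma>\<close> and cannot cancel it because \<open>K\<close> is at least
  \<open>2 * mulC\<close>.\<close>

lemma least_const_large_elem_ge:
  assumes "r \<in> nbox n B"
  shows "B \<le> least_const (large_elem r)"
proof -
  obtain b where b: "g dvd large_elem r * b - [:int (least_const (large_elem r)):]" using least_const(2)[OF large_elem_nonzero(2)[OF assms]] by blast
  have mpos: "least_const (large_elem r) > 0" using least_const(1)[OF large_elem_nonzero(2)[OF assms]] .
  define s where "s = red b"
  have "g dvd large_elem r * s - [:int (least_const (large_elem r)):]"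
  proof -
    have "large_elem r * s - [:int (least_const (large_elem r)):] = (large_elem r * b - [:int (least_const (large_elem r)):]) - large_elem r * (b - red b)"
      by (simp add: s_def algebra_simps)
    also have "g dvd \<dots>" by (rule dvd_diff[OF b dvd_mult[OF red(2)]])
    finally show ?thesis .
  qed
  then have rs: "red (large_elem r * s) = [:int (least_const (large_elem r)):]"
    by (rule red_unique) (use n_pos in \<open>auto simp: coeff_pCons split: nat.splits\<close>)
  have s0: "s \<noteq> 0" using rs mpos by auto
  define \<sigma> where "\<sigma> = Max ((\<lambda>i. \<bar>coeff s i\<bar>) ` {..<n})"
  have fin: "finite ((\<lambda>i. \<bar>coeff s i\<bar>) ` {..<n})" "(\<lambda>i. \<bar>coeff s i\<bar>) ` {..<n} \<noteq> {}" using n_pos by auto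
  obtain i where i: "i < n" "\<sigma> = \<bar>coeff s i\<bar>" using Max_in[OF fin] unfolding \<sigma>_def by auto
  have le: "\<bar>coeff s j\<bar> \<le> \<sigma>" for j
  proof (cases "j < n")
    case True
    then show ?thesis unfolding \<sigma>_def using fin by (intro Max_ge) auto
  next
    case False
    then show ?thesis using i(2) red(1)[of j b] by (simp add: s_def)
  qed
  have sbox: "s \<in> box n (real_of_int \<sigma>)"
  proof (rule boxI)
    show "\<bar>real_of_int (coeff s j)\<bar> \<le> real_of_int \<sigma>" for j using le[of j] by linarith
  qed (use red(1) in \<open>simp add: s_def\<close>)
  have "\<sigma> \<noteq> 0"
  proof
    assume "\<sigma> = 0"
    then have "coeff s j = 0" for j using le[of j] by simp
    then show False using s0 by (simp add: poly_eq_iff)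
  qed
  then have \<sigma>1: "\<sigma> \<ge> 1" using i(2) by linarith
  have "r \<in> box n (real B)"
  proof (rule boxI)
    fix j
    show "\<bar>real_of_int (coeff r j)\<bar> \<le> real B" using assms by (cases "j < n") (auto simp: nbox_def)
  qed (use assms in \<open>auto simp: nbox_def\<close>)
  then have rsb: "red (r * s) \<in> box n (mulC * real B * real_of_int \<sigma>)" by (rule red_mult_box[OF _ sbox])
  define k0 where "k0 = 1 + int Q * int (K * B)"
  have "large_elem r * s = smult k0 s + smult (int Q) (r * s)"
    by (simp add: large_elem_def k0_def algebra_simps smult_add_left smult_add_right)
  then have "red (large_elem r * s) = smult k0 s + smult (int Q) (red (r * s))"
    using red_small[of s] red(1)[of _ b] by (simp add: red_add red_smult s_def)
  then have "coeff [:int (least_const (large_elem r)):] i = k0 * coeff s i + int Q * coeff (red (r * s)) i"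
    using rs by simp
  then have "real (least_const (large_elem r)) \<ge> \<bar>real_of_int (k0 * coeff s i + int Q * coeff (red (r * s)) i)\<bar>"
    by (simp add: coeff_pCons split: nat.splits flip: of_int_mult of_int_add of_int_abs)
  moreover have "\<bar>real_of_int (k0 * coeff s i + int Q * coeff (red (r * s)) i)\<bar>
      \<ge> real_of_int k0 * real_of_int \<sigma> - real Q * (mulC * real B * real_of_int \<sigma>)"
  proof -
    have "\<bar>real_of_int (coeff (red (r * s)) i)\<bar> \<le> mulC * real B * real_of_int \<sigma>" using rsb by (auto simp: box_def)
    then have 1: "real Q * \<bar>real_of_int (coeff (red (r * s)) i)\<bar> \<le> real Q * (mulC * real B * real_of_int \<sigma>)"
      by (intro mult_left_mono) auto
    have "k0 \<ge> 0" by (simp add: k0_def)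
    then have 2: "\<bar>real_of_int (k0 * coeff s i)\<bar> = real_of_int k0 * real_of_int \<sigma>" using i(2) by (simp add: abs_mult)
    have 3: "\<bar>real_of_int (int Q * coeff (red (r * s)) i)\<bar> = real Q * \<bar>real_of_int (coeff (red (r * s)) i)\<bar>"
      by (simp add: abs_mult)
    show ?thesis using 1 2 3 unfolding of_int_add by linarith
  qed
  moreover have "real_of_int k0 * real_of_int \<sigma> - real Q * (mulC * real B * real_of_int \<sigma>) \<ge> real B"
  proof -
    have "real_of_int k0 * real_of_int \<sigma> - real Q * (mulC * real B * real_of_int \<sigma>)
      = real_of_int \<sigma> * (1 + real Q * real B * (real K - mulC))" by (simp add: k0_def algebra_simps)
    moreover have "1 * real B * 1 \<le> real Q * real B * (real K - mulC)"
      using Q_pos K_ge mulC_ge_1 by (intro mult_mono) auto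
    moreover from this have "1 * (real B) \<le> real_of_int \<sigma> * (1 + real Q * real B * (real K - mulC))"
      using \<sigma>1 by (intro mult_mono) auto
    ultimately show ?thesis by simp
  qed
  ultimately have "real B \<le> real (least_const (large_elem r))" by linarith
  then show ?thesis by simp
qed

text \<open>Such a prime divides \<open>Q\<close>, so the large element is 1 modulo
  \<open>p\<close>, and 1 would lie in an ideal whose integers are all multiples of
  \<open>p\<close>.\<close>

lemma small_prime_not_dvd_least_const:
  assumes "r \<in> nbox n B" "prime p" "p \<le> T"
  shows "\<not> p dvd least_const (large_elem r)"
proof
  assume p: "p dvd least_const (large_elem r)"
  have "p dvd Q" unfolding Q_def using assms prime_dvd_fact_iff by blast
  then obtain k where "Q = p * k" by (elim dvdE)
  then have "smult (int Q) ([:int (K * B):] + r) = [:int p:] * smult (int k) ([:int (K * B):] + r)"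
    by (simp add: mult.commute[of "int k"])
  then have "[:int p:] dvd smult (int Q) ([:int (K * B):] + r)" by (simp only: dvd_triv_left)
  then have "smult (int Q) ([:int (K * B):] + r) \<in> gen_ideal p (large_elem r)" using ideal_dvd[OF gen_ideal(1) gen_ideal(2)] by blast
  then have "large_elem r - smult (int Q) ([:int (K * B):] + r) \<in> gen_ideal p (large_elem r)"
    by (rule ideal_diff[OF gen_ideal(1) gen_ideal(4)])
  then have "[:1:] \<in> gen_ideal p (large_elem r)" by (simp add: large_elem_def)
  then have "int p dvd 1" using const_in_gen_ideal[OF large_elem_nonzero(2)[OF assms(1)] p] by blast
  then show False using assms(2) by simp
qed

lemma index_le_heightC:
  assumes "r \<in> nbox n B" "is_ideal J" "g \<in> J" "large_elem r \<in> J" "finite F" "incongruent J F"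
  shows "real (card F) \<le> (heightC * real B) ^ n"
proof -
  have "real (card F) \<le> (3 * mulC * real (Q * (K + 2) * B)) ^ n"
    using ideal_index_le[OF assms(2,3,4) large_elem_box[OF assms(1)] large_elem_nonzero(1)[OF assms(1)] assms(5,6)] .
  then show ?thesis by (simp add: heightC_def mult_ac)
qed

text \<open>Two large elements differ by Q (r - r'), and \<open>Q\<close> is invertible modulo p^j
  because p > T. So the box elements themselves are congruent modulo \<open>J\<close>, and the
  packing bound applies to them.\<close>

lemma card_large_elem_in_ideal:
  assumes J: "is_ideal J" "g \<in> J" and p: "prime p" "p > T" and pj: "[:int (p ^ j):] \<in> J"
    and F: "finite F" "incongruent J F" "card F = q" "q > 0"
  shows "real (card {r \<in> nbox n B. large_elem r \<in> J}) \<le> packC * (1 + real B ^ n / real q)"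
proof (rule card_box_ideal_le[OF J F])
  fix r r' assume r: "r \<in> {r \<in> nbox n B. large_elem r \<in> J}" "r' \<in> {r \<in> nbox n B. large_elem r \<in> J}"
  have "\<not> p dvd Q" using p unfolding Q_def by (simp add: prime_dvd_fact_iff)
  then have "gcd Q (p ^ j) = 1"
    using p by (metis coprime_iff_gcd_eq_1 coprime_power_right_iff prime_imp_coprime gcd.commute)
  then have "gcd (int Q) (int (p ^ j)) = 1" by (simp only: gcd_int_int_eq)
  then obtain u v where uv: "u * int Q + v * int (p ^ j) = 1" using bezout_int[of "int Q" "int (p ^ j)"] by metis
  have "large_elem r - large_elem r' \<in> J" using r J by (intro ideal_diff) auto
  then have "smult u (large_elem r - large_elem r') + [:int (p ^ j):] * smult v (r - r') \<in> J"
    using J pj by (intro ideal_add ideal_smult ideal_mult') auto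
  also have "smult u (large_elem r - large_elem r') + [:int (p ^ j):] * smult v (r - r') = smult (u * int Q + v * int (p ^ j)) (r - r')"
    by (simp add: large_elem_def smult_add_left smult_diff_right smult_add_right algebra_simps)
  finally show "r - r' \<in> J" using uv by simp
qed (auto simp: nbox_def)

text \<open>The elements for which \<open>p\<close> divides the least constant in an unwanted way:
  to a higher power, or without a visible root of \<open>g\<close> modulo \<open>p\<close>.\<close>

definition bad :: "nat \<Rightarrow> int poly set" where
  "bad p = {r \<in> nbox n B. p dvd least_const (large_elem r) \<and> (p\<^sup>2 dvd least_const (large_elem r) \<or> (\<forall>x. [:- x, 1:] \<notin> gen_ideal p (large_elem r)))}"

lemma one_notin_gen_ideal:
  assumes "r \<in> nbox n B" "prime p" "p dvd least_const (large_elem r)"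
  shows "1 \<notin> gen_ideal p (large_elem r)"
proof
  assume "1 \<in> gen_ideal p (large_elem r)"
  then have "[:1:] \<in> gen_ideal p (large_elem r)" by (simp add: one_poly_eq_simps)
  then have "int p dvd 1" using const_in_gen_ideal[OF large_elem_nonzero(2)[OF assms(1)] assms(3)] by blast
  then show False using assms(2) by simp
qed

text \<open>Both kinds of badness put the large element into an ideal of index at least p^2, taken
  from a short list. Without any X - x, \<open>incongruent_linear\<close> bounds the index;
  otherwise the root lifts modulo p^2 and the ideal is (p^2, X - y).\<close>

lemma bad_cover:
  assumes p: "prime p" "p > T" and r: "r \<in> bad p"
  shows "(\<exists>J\<in>ideals_over p g. large_elem r \<in> J \<and> (\<exists>F. finite F \<and> incongruent J F \<and> card F = p\<^sup>2))
     \<or> (\<exists>x<p\<^sup>2. int (p\<^sup>2) dvd poly g (int x) \<and> large_elem r \<in> root_ideal (p\<^sup>2) (int x))"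
proof (cases "\<exists>x. [:- x, 1:] \<in> gen_ideal p (large_elem r)")
  case False
  have r': "r \<in> nbox n B" "p dvd least_const (large_elem r)" using r by (auto simp: bad_def)
  have "gen_ideal p (large_elem r) \<in> ideals_over p g" using gen_ideal by (auto simp: ideals_over_def)
  moreover have "\<exists>F. finite F \<and> incongruent (gen_ideal p (large_elem r)) F \<and> card F = p\<^sup>2"
    using incongruent_linear[OF p(1) gen_ideal(1,2) one_notin_gen_ideal[OF r'(1) p(1) r'(2)]] False by blast
  ultimately show ?thesis using gen_ideal(4) by blast
next
  case True
  have r': "r \<in> nbox n B" "p\<^sup>2 dvd least_const (large_elem r)" using r True by (auto simp: bad_def)
  obtain y where y: "[:- y, 1:] \<in> gen_ideal (p\<^sup>2) (large_elem r)" using True root_lift by blast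
  have dv: "int (p\<^sup>2) dvd poly f y" if "f \<in> gen_ideal (p\<^sup>2) (large_elem r)" for f
    by (rule const_in_gen_ideal[OF large_elem_nonzero(2)[OF r'(1)] r'(2) root_in_ideal[OF gen_ideal(1) y that]])
  define x where "x = nat (y mod int (p\<^sup>2))"
  have p2: "int (p\<^sup>2) > 0" using p by (simp add: prime_gt_0_nat)
  have x: "x < p\<^sup>2" "int x = y mod int (p\<^sup>2)" unfolding x_def using p2 by (auto simp: nat_less_iff)
  have "int (p\<^sup>2) dvd poly f (int x) \<longleftrightarrow> int (p\<^sup>2) dvd poly f y" for f
  proof -
    obtain w where w: "f = [:- y, 1:] * w + [:poly f y:]" using synthetic_div_int by blast
    have "poly f (int x) = (int x - y) * poly w (int x) + poly f y" by (subst w) (simp add: algebra_simps)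
    moreover have "int x mod int (p\<^sup>2) = y mod int (p\<^sup>2)" unfolding x(2) by (simp only: mod_mod_trivial)
    then have "int (p\<^sup>2) dvd int x - y" by (simp only: mod_eq_dvd_iff)
    ultimately show ?thesis by (simp add: dvd_add_right_iff)
  qed
  then have "int (p\<^sup>2) dvd poly g (int x)" "large_elem r \<in> root_ideal (p\<^sup>2) (int x)"
    using dv[OF gen_ideal(3)] dv[OF gen_ideal(4)] by (auto simp: root_ideal_def)
  then show ?thesis using x by blast
qed

lemma card_bad:
  assumes p: "prime p" "p > T"
  shows "real (card (bad p)) \<le> 2 ^ Suc n * packC * (1 + real B ^ n / real p ^ 2)"
proof -
  define \<J> where "\<J> = {J \<in> ideals_over p g. \<exists>F. finite F \<and> incongruent J F \<and> card F = p\<^sup>2}"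
  define X where "X = {x \<in> {..<p\<^sup>2}. int (p\<^sup>2) dvd poly g (int x)}"
  define N where "N J = {r \<in> nbox n B. large_elem r \<in> J}" for J
  let ?b = "packC * (1 + real B ^ n / real p ^ 2)"
  have b0: "?b \<ge> 0" using packC_ge_1 by auto
  have p2: "p\<^sup>2 > 0" using p by (simp add: prime_gt_0_nat)
  have fin\<J>: "finite \<J>" "card \<J> \<le> 2 ^ n"
    using card_ideals_over[OF p(1) monic] card_mono[of "ideals_over p g" \<J>] deg
    by (auto simp: \<J>_def)
  have X: "finite X" "card X \<le> 2 ^ n"
    using card_roots_mod_square[OF p(1)] simple[OF p] by (auto simp: X_def)
  have finN: "finite (N J)" for J using card_nbox by (simp add: N_def)
  have "bad p \<subseteq> (\<Union>J\<in>\<J>. N J) \<union> (\<Union>x\<in>X. N (root_ideal (p\<^sup>2) (int x)))"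
  proof
    fix r assume r: "r \<in> bad p"
    then have "r \<in> nbox n B" by (simp add: bad_def)
    then show "r \<in> (\<Union>J\<in>\<J>. N J) \<union> (\<Union>x\<in>X. N (root_ideal (p\<^sup>2) (int x)))"
      using bad_cover[OF p r] by (auto simp: N_def \<J>_def X_def)
  qed
  then have "card (bad p) \<le> card ((\<Union>J\<in>\<J>. N J) \<union> (\<Union>x\<in>X. N (root_ideal (p\<^sup>2) (int x))))"
    using fin\<J> X finN by (intro card_mono) auto
  also have "\<dots> \<le> (\<Sum>J\<in>\<J>. card (N J)) + (\<Sum>x\<in>X. card (N (root_ideal (p\<^sup>2) (int x))))"
    by (rule order_trans[OF card_Un_le]) (intro add_mono card_UN_le fin\<J> X)
  finally have "real (card (bad p)) \<le> (\<Sum>J\<in>\<J>. real (card (N J))) + (\<Sum>x\<in>X. real (card (N (root_ideal (p\<^sup>2) (int x)))))"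
    by (simp flip: of_nat_sum of_nat_add)
  also have "\<dots> \<le> (\<Sum>J\<in>\<J>. ?b) + (\<Sum>x\<in>X. ?b)"
  proof (intro add_mono sum_mono)
    fix J assume "J \<in> \<J>"
    then obtain F where J: "is_ideal J" "g \<in> J" "[:int p:] \<in> J" and F: "finite F" "incongruent J F" "card F = p\<^sup>2"
      by (auto simp: \<J>_def ideals_over_def)
    show "real (card (N J)) \<le> ?b"
      using card_large_elem_in_ideal[OF J(1,2) p _ F p2, of 1] J(3) by (simp add: N_def)
  next
    fix x assume "x \<in> X"
    then have gx: "g \<in> root_ideal (p\<^sup>2) (int x)" by (auto simp: X_def root_ideal_def)
    note inc = incongruent_consts[of "root_ideal (p\<^sup>2) (int x)" "p\<^sup>2"]
    show "real (card (N (root_ideal (p\<^sup>2) (int x)))) \<le> ?b"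
      using card_large_elem_in_ideal[OF root_ideal(1) gx p _ _ inc(1) inc(2) p2, of 2] by (simp add: N_def root_ideal)
  qed
  also have "\<dots> = real (card \<J> + card X) * ?b"
    by (simp only: sum_constant of_nat_add distrib_right)
  also have "\<dots> \<le> 2 ^ Suc n * ?b"
  proof (rule mult_right_mono[OF _ b0])
    have "card \<J> + card X \<le> 2 ^ Suc n" using fin\<J> X by simp
    then have "real (card \<J> + card X) \<le> real (2 ^ Suc n)" by (simp only: of_nat_le_iff)
    then show "real (card \<J> + card X) \<le> 2 ^ Suc n" by simp
  qed
  finally show ?thesis by (simp add: mult.assoc)
qed

text \<open>An ideal containing a large element has bounded index, so only primes up to the square
  root of that bound can be bad. Without this cutoff the summand 1 in \<open>card_bad\<close> could
  not be summed over the primes.\<close>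

lemma bad_prime_le:
  assumes p: "prime p" "p > T" and "bad p \<noteq> {}"
  shows "real p ^ 2 \<le> (heightC * real B) ^ n"
proof -
  obtain r where r: "r \<in> bad p" using assms by blast
  then have rb: "r \<in> nbox n B" by (simp add: bad_def)
  from bad_cover[OF p r] show ?thesis
  proof
    assume "\<exists>J\<in>ideals_over p g. large_elem r \<in> J \<and> (\<exists>F. finite F \<and> incongruent J F \<and> card F = p\<^sup>2)"
    then obtain J F where J: "is_ideal J" "g \<in> J" "large_elem r \<in> J" and F: "finite F" "incongruent J F" "card F = p\<^sup>2"
      by (auto simp: ideals_over_def)
    show ?thesis using index_le_heightC[OF rb J F(1,2)] F(3) by simp
  next
    assume "\<exists>x<p\<^sup>2. int (p\<^sup>2) dvd poly g (int x) \<and> large_elem r \<in> root_ideal (p\<^sup>2) (int x)"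
    then obtain x where "g \<in> root_ideal (p\<^sup>2) (int x)" "large_elem r \<in> root_ideal (p\<^sup>2) (int x)"
      by (auto simp: root_ideal_def)
    then have "real (card ((\<lambda>i. [:int i:]) ` {..<p\<^sup>2})) \<le> (heightC * real B) ^ n"
      by (intro index_le_heightC[OF rb root_ideal(1) _ _ _ incongruent_consts(1)]) (simp_all only: root_ideal(2) finite_imageI finite_lessThan)
    moreover have "card ((\<lambda>i. [:int i:]) ` {..<p\<^sup>2}) = p\<^sup>2"
      by (rule incongruent_consts(2)[of "root_ideal (p\<^sup>2) (int x)"]) (simp only: root_ideal(2))
    ultimately show ?thesis by simp
  qed
qed

end

lemma ln_squarefree_eq_sum:
  fixes m :: nat
  assumes "m > 0" "\<And>p. prime p \<Longrightarrow> \<not> p\<^sup>2 dvd m"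
  shows "ln (real m) = (\<Sum>p\<in>prime_factors m. ln (real p))"
proof -
  have "multiplicity p m = 1" if p: "p \<in> prime_factors m" for p
  proof -
    have "prime p" "p dvd m" using p by auto
    then have "multiplicity p m \<ge> 1"
      using assms(1) by (simp add: Suc_leI prime_multiplicity_gt_zero_iff)
    moreover have "\<not> multiplicity p m \<ge> 2" using assms(2)[OF \<open>prime p\<close>] multiplicity_dvd' by blast
    ultimately show ?thesis by linarith
  qed
  then have "(\<Prod>p\<in>prime_factors m. p ^ multiplicity p m) = \<Prod>(prime_factors m)"
    by (intro prod.cong) auto
  with prime_factorization_nat[OF assms(1)] have "m = \<Prod>(prime_factors m)" by (rule trans)
  then have "real m = real (\<Prod>(prime_factors m))" by (rule arg_cong)
  also have "\<dots> = (\<Prod>p\<in>prime_factors m. real p)" by simp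
  also have "ln \<dots> = (\<Sum>p\<in>prime_factors m. ln (real p))"
    by (rule ln_prod) (auto intro: prime_gt_0_nat)
  finally show ?thesis .
qed

section \<open>Double counting of root primes over the good elements\<close>

context density_setup
begin

definition root_primes :: "nat set" where
  "root_primes = {p. prime p \<and> real p \<le> (heightC * real B) ^ n \<and> (\<exists>x. int p dvd poly g x)}"

definition good :: "int poly set" where
  "good = nbox n B - (\<Union>p\<in>{p. prime p \<and> p > T}. bad p)"

lemma finite_root_primes: "finite root_primes"
proof (rule finite_subset)
  show "root_primes \<subseteq> {..nat \<lfloor>(heightC * real B) ^ n\<rfloor>}"
    by (auto simp: root_primes_def le_nat_floor)
qed simp

lemma heightC_ge_1: "heightC \<ge> 1"
proof -
  have "1 \<le> Q * (K + 2)" using Q_pos by simp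
  then have "real 1 \<le> real (Q * (K + 2))" by (simp only: of_nat_le_iff)
  then have "1 \<le> real (Q * (K + 2))" by (simp only: of_nat_1)
  then have "1 * 1 \<le> (3 * mulC) * real (Q * (K + 2))" using mulC_ge_1 by (intro mult_mono) auto
  then show ?thesis by (simp only: heightC_def mult_1)
qed

text \<open>Summed over the bad primes, the terms 1 of \<open>card_bad\<close> contribute at most
  the square root of \<open>(heightC * B) ^ n\<close>, and the terms B^n / p^2 at most B^n / T. The
  hypotheses limit each part to a quarter of the box.\<close>

lemma card_good:
  assumes T: "2 ^ Suc n * packC / real T \<le> 1 / 4"
    and B: "2 ^ Suc n * packC * sqrt ((heightC * real B) ^ n) \<le> real B ^ n / 4"
  shows "real B ^ n / 2 \<le> real (card good)"
proof -
  define M where "M = nat \<lfloor>sqrt ((heightC * real B) ^ n)\<rfloor>"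
  define P where "P = {p. prime p \<and> p > T \<and> p \<le> M}"
  have finP: "finite P" by (simp add: P_def)
  have un: "(\<Union>p\<in>{p. prime p \<and> p > T}. bad p) = (\<Union>p\<in>P. bad p)"
  proof -
    have "p \<le> M" if "prime p" "p > T" "bad p \<noteq> {}" for p
    proof -
      have "real p \<le> sqrt ((heightC * real B) ^ n)"
        by (rule real_le_rsqrt) (rule bad_prime_le[OF that])
      then show ?thesis by (simp add: M_def le_nat_floor)
    qed
    then show ?thesis unfolding P_def by blast
  qed
  let ?c = "2 ^ Suc n * packC"
  have c0: "?c \<ge> 0" using packC_ge_1 by simp
  have "card (\<Union>p\<in>P. bad p) \<le> (\<Sum>p\<in>P. card (bad p))" by (rule card_UN_le[OF finP])
  then have "real (card (\<Union>p\<in>P. bad p)) \<le> (\<Sum>p\<in>P. real (card (bad p)))"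
    by (simp flip: of_nat_sum)
  also have "\<dots> \<le> (\<Sum>p\<in>P. ?c * (1 + real B ^ n / real p ^ 2))"
    by (intro sum_mono card_bad) (auto simp: P_def)
  also have "\<dots> = ?c * (\<Sum>p\<in>P. 1 + real B ^ n / real p ^ 2)" by (simp only: sum_distrib_left)
  finally have le: "real (card (\<Union>p\<in>P. bad p)) \<le> ?c * (\<Sum>p\<in>P. 1 + real B ^ n / real p ^ 2)" .
  have "(\<Sum>p\<in>P. 1 + real B ^ n / real p ^ 2) \<le> (\<Sum>p\<in>{T<..M}. 1 + real B ^ n / real p ^ 2)"
    by (rule sum_mono2) (auto simp: P_def)
  also have "\<dots> = real (card {T<..M}) + real B ^ n * (\<Sum>p\<in>{T<..M}. 1 / real p ^ 2)"
    by (simp add: sum.distrib sum_distrib_left)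
  also have "\<dots> \<le> sqrt ((heightC * real B) ^ n) + real B ^ n * (1 / real T)"
  proof (rule add_mono)
    have "real (card {T<..M}) \<le> real M" by simp
    also have "\<dots> \<le> sqrt ((heightC * real B) ^ n)"
      unfolding M_def using heightC_ge_1 by (intro of_nat_floor) auto
    finally show "real (card {T<..M}) \<le> sqrt ((heightC * real B) ^ n)" .
  next
    show "real B ^ n * (\<Sum>p\<in>{T<..M}. 1 / real p ^ 2) \<le> real B ^ n * (1 / real T)"
      by (rule mult_left_mono[OF sum_inverse_squares_tail[OF T_pos]]) simp
  qed
  finally have "?c * (\<Sum>p\<in>P. 1 + real B ^ n / real p ^ 2) \<le> ?c * (sqrt ((heightC * real B) ^ n) + real B ^ n * (1 / real T))"
    by (rule mult_left_mono[OF _ c0])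
  from le this have "real (card (\<Union>p\<in>P. bad p)) \<le> ?c * (sqrt ((heightC * real B) ^ n) + real B ^ n * (1 / real T))"
    by (rule order_trans)
  also have "\<dots> = ?c * sqrt ((heightC * real B) ^ n) + real B ^ n * (?c / real T)" by (simp add: algebra_simps)
  also have "\<dots> \<le> real B ^ n / 4 + real B ^ n * (1 / 4)"
    by (intro add_mono B mult_left_mono T) simp
  finally have bad: "real (card (\<Union>p\<in>P. bad p)) \<le> real B ^ n / 2" by simp
  have sub: "(\<Union>p\<in>P. bad p) \<subseteq> nbox n B" by (auto simp: bad_def)
  have fin: "finite (nbox n B)" "card (nbox n B) = B ^ n" using card_nbox by auto
  have "card good = B ^ n - card (\<Union>p\<in>P. bad p)"
    unfolding good_def un using card_Diff_subset[OF finite_subset[OF sub fin(1)] sub] fin(2) by simp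
  moreover have "card (\<Union>p\<in>P. bad p) \<le> B ^ n" using card_mono[OF fin(1) sub] fin(2) by simp
  ultimately have "real (card good) = real B ^ n - real (card (\<Union>p\<in>P. bad p))" by (simp add: of_nat_diff)
  with bad show ?thesis by simp
qed

lemma good_prime_factor:
  assumes r: "r \<in> good" and p: "prime p" "p dvd least_const (large_elem r)"
  shows "p > T" "\<not> p\<^sup>2 dvd least_const (large_elem r)" "p \<in> root_primes"
proof -
  have rb: "r \<in> nbox n B" using r by (simp add: good_def)
  show T: "p > T" using small_prime_not_dvd_least_const[OF rb p(1)] p(2) by (cases "p \<le> T") auto
  then have nb: "r \<notin> bad p" using r p by (auto simp: good_def)
  then show "\<not> p\<^sup>2 dvd least_const (large_elem r)" using rb p by (auto simp: bad_def)
  obtain x where x: "[:- x, 1:] \<in> gen_ideal p (large_elem r)" using nb rb p by (auto simp: bad_def)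
  have "int p dvd poly g x"
    by (rule const_in_gen_ideal[OF large_elem_nonzero(2)[OF rb] p(2) root_in_ideal[OF gen_ideal(1) x gen_ideal(3)]])
  moreover have "real p \<le> (heightC * real B) ^ n"
    using index_le_heightC[OF rb gen_ideal(1,3,4) _ incongruent_consts(1)] incongruent_consts(2)[of "gen_ideal p (large_elem r)" p]
      const_in_gen_ideal[OF large_elem_nonzero(2)[OF rb] p(2)] by force
  ultimately show "p \<in> root_primes" using p by (auto simp: root_primes_def)
qed

lemma good_ln_le:
  assumes r: "r \<in> good"
  shows "ln (real B) \<le> (\<Sum>p | p \<in> root_primes \<and> p dvd least_const (large_elem r). ln (real p))"
proof -
  have rb: "r \<in> nbox n B" using r by (simp add: good_def)
  have mpos: "least_const (large_elem r) > 0" using least_const(1)[OF large_elem_nonzero(2)[OF rb]] .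
  have "ln (real B) \<le> ln (real (least_const (large_elem r)))" using least_const_large_elem_ge[OF rb] B_pos by simp
  also have "\<dots> = (\<Sum>p\<in>prime_factors (least_const (large_elem r)). ln (real p))"
    by (rule ln_squarefree_eq_sum[OF mpos]) (use good_prime_factor(2)[OF r] in \<open>auto simp: power2_eq_square dest: dvd_mult_left\<close>)
  also have "\<dots> \<le> (\<Sum>p | p \<in> root_primes \<and> p dvd least_const (large_elem r). ln (real p))"
  proof (rule sum_mono2)
    show "finite {p. p \<in> root_primes \<and> p dvd least_const (large_elem r)}" using finite_root_primes by simp
    show "prime_factors (least_const (large_elem r)) \<subseteq> {p. p \<in> root_primes \<and> p dvd least_const (large_elem r)}"
      using good_prime_factor(3)[OF r] by auto
    show "0 \<le> ln (real p)" if "p \<in> {p. p \<in> root_primes \<and> p dvd least_const (large_elem r)} - prime_factors (least_const (large_elem r))" for p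
      using that prime_ge_1_nat[of p] by (auto simp: root_primes_def)
  qed
  finally show ?thesis .
qed

text \<open>If \<open>p\<close> divides the least constant, the large element lies in one of at most
  2^n ideals over \<open>p\<close>, each of index at least \<open>p\<close>. Primes up to
  \<open>T\<close> do not occur.\<close>

lemma card_good_divisible:
  assumes p: "prime p"
  shows "real (card {r \<in> good. p dvd least_const (large_elem r)}) \<le> 2 ^ n * packC * (1 + real B ^ n / real p)"
proof (cases "p > T")
  case True
  define \<J> where "\<J> = {J \<in> ideals_over p g. \<exists>F. finite F \<and> incongruent J F \<and> card F = p}"
  define N where "N J = {r \<in> nbox n B. large_elem r \<in> J}" for J
  let ?b = "packC * (1 + real B ^ n / real p)"
  have b0: "?b \<ge> 0" using packC_ge_1 by auto
  have fin\<J>: "finite \<J>" "card \<J> \<le> 2 ^ n"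
    using card_ideals_over[OF p(1) monic] card_mono[of "ideals_over p g" \<J>] deg
    by (auto simp: \<J>_def)
  have finN: "finite (N J)" for J using card_nbox by (simp add: N_def)
  have "{r \<in> good. p dvd least_const (large_elem r)} \<subseteq> (\<Union>J\<in>\<J>. N J)"
  proof
    fix r assume r: "r \<in> {r \<in> good. p dvd least_const (large_elem r)}"
    then have rb: "r \<in> nbox n B" and d: "p dvd least_const (large_elem r)" by (auto simp: good_def)
    have "gen_ideal p (large_elem r) \<in> ideals_over p g" using gen_ideal by (auto simp: ideals_over_def)
    moreover have "finite ((\<lambda>i. [:int i:]) ` {..<p})" by simp
    ultimately have "gen_ideal p (large_elem r) \<in> \<J>"
      unfolding \<J>_def using incongruent_consts[OF const_in_gen_ideal[OF large_elem_nonzero(2)[OF rb] d]] by blast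
    then show "r \<in> (\<Union>J\<in>\<J>. N J)" using gen_ideal(4) rb by (auto simp: N_def)
  qed
  then have "card {r \<in> good. p dvd least_const (large_elem r)} \<le> card (\<Union>J\<in>\<J>. N J)"
    using fin\<J> finN by (intro card_mono) auto
  also have "\<dots> \<le> (\<Sum>J\<in>\<J>. card (N J))" by (rule card_UN_le[OF fin\<J>(1)])
  finally have "real (card {r \<in> good. p dvd least_const (large_elem r)}) \<le> (\<Sum>J\<in>\<J>. real (card (N J)))"
    by (simp flip: of_nat_sum)
  also have "\<dots> \<le> (\<Sum>J\<in>\<J>. ?b)"
  proof (intro sum_mono)
    fix J assume "J \<in> \<J>"
    then obtain F where J: "is_ideal J" "g \<in> J" "[:int p:] \<in> J" and F: "finite F" "incongruent J F" "card F = p"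
      by (auto simp: \<J>_def ideals_over_def)
    show "real (card (N J)) \<le> ?b"
      using card_large_elem_in_ideal[OF J(1,2) p True _ F prime_gt_0_nat[OF p], of 1] J(3) by (simp add: N_def)
  qed
  also have "\<dots> = real (card \<J>) * ?b" by (simp only: sum_constant)
  also have "\<dots> \<le> 2 ^ n * ?b"
  proof (rule mult_right_mono[OF _ b0])
    show "real (card \<J>) \<le> 2 ^ n" using fin\<J>(2) by (simp flip: of_nat_le_iff)
  qed
  finally show ?thesis by (simp add: mult.assoc)
next
  case False
  then have "{r \<in> good. p dvd least_const (large_elem r)} = {}" using good_prime_factor(1)[OF _ p] by blast
  then have "real (card {r \<in> good. p dvd least_const (large_elem r)}) = 0" by (simp only: card.empty of_nat_0)
  also have "0 \<le> 2 ^ n * packC * (1 + real B ^ n / real p)" using packC_ge_1 by (intro mult_nonneg_nonneg) auto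
  finally show ?thesis .
qed

text \<open>Pairs of a good \<open>r\<close> and a root prime \<open>p\<close> dividing its least
  constant are counted with weight ln p. Each \<open>r\<close> contributes at least ln B, each
  \<open>p\<close> at most a constant times B^n ln p / p.\<close>

lemma root_primes_sum_ge:
  assumes T: "2 ^ Suc n * packC / real T \<le> 1 / 4"
    and B: "2 ^ Suc n * packC * sqrt ((heightC * real B) ^ n) \<le> real B ^ n / 4"
  shows "ln (real B) / (2 ^ Suc n * packC * (heightC ^ n + 1)) \<le> (\<Sum>p\<in>root_primes. ln (real p) / real p)"
proof -
  have fing: "finite good" using card_nbox by (simp add: good_def)
  have lnB: "ln (real B) \<ge> 0" using B_pos by simp
  have "(real B ^ n / 2) * ln (real B) \<le> real (card good) * ln (real B)"
    by (rule mult_right_mono[OF card_good[OF T B] lnB])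
  also have "\<dots> = (\<Sum>r\<in>good. ln (real B))" by simp
  also have "\<dots> \<le> (\<Sum>r\<in>good. \<Sum>p | p \<in> root_primes \<and> p dvd least_const (large_elem r). ln (real p))"
    by (intro sum_mono good_ln_le)
  also have "\<dots> = (\<Sum>p\<in>root_primes. \<Sum>r | r \<in> good \<and> p dvd least_const (large_elem r). ln (real p))"
    by (rule sum.swap_restrict[OF fing finite_root_primes])
  also have "\<dots> = (\<Sum>p\<in>root_primes. real (card {r \<in> good. p dvd least_const (large_elem r)}) * ln (real p))" by simp
  also have "\<dots> \<le> (\<Sum>p\<in>root_primes. (2 ^ n * packC * ((heightC ^ n + 1) * (real B ^ n / real p))) * ln (real p))"
  proof (intro sum_mono mult_right_mono)
    fix p assume p: "p \<in> root_primes"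
    then have pr: "prime p" "real p \<le> (heightC * real B) ^ n" by (auto simp: root_primes_def)
    have p0: "real p > 0" using pr(1) by (simp add: prime_gt_0_nat)
    \<comment> \<open>The summand 1 of the packing bound is absorbed here; this is why
      \<open>root_primes\<close> is cut off at \<open>(heightC * B) ^ n\<close>.\<close>
    have "1 \<le> heightC ^ n * (real B ^ n / real p)" using pr(2) p0 by (simp add: field_simps power_mult_distrib)
    then have "1 + real B ^ n / real p \<le> (heightC ^ n + 1) * (real B ^ n / real p)" by (simp add: algebra_simps)
    then have "2 ^ n * packC * (1 + real B ^ n / real p) \<le> 2 ^ n * packC * ((heightC ^ n + 1) * (real B ^ n / real p))"
      using packC_ge_1 by (intro mult_left_mono) auto
    then show "real (card {r \<in> good. p dvd least_const (large_elem r)}) \<le> 2 ^ n * packC * ((heightC ^ n + 1) * (real B ^ n / real p))"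
      using card_good_divisible[OF pr(1)] by linarith
    show "0 \<le> ln (real p)" using prime_ge_1_nat[OF pr(1)] by simp
  qed
  also have "\<dots> = (real B ^ n / 2) * (2 ^ Suc n * packC * (heightC ^ n + 1)) * (\<Sum>p\<in>root_primes. ln (real p) / real p)"
    by (simp add: sum_distrib_left mult_ac)
  finally have "(real B ^ n / 2) * ln (real B) \<le> (real B ^ n / 2) * ((2 ^ Suc n * packC * (heightC ^ n + 1)) * (\<Sum>p\<in>root_primes. ln (real p) / real p))"
    by (simp only: mult.assoc)
  then have "ln (real B) \<le> (2 ^ Suc n * packC * (heightC ^ n + 1)) * (\<Sum>p\<in>root_primes. ln (real p) / real p)"
    using B_pos by (simp add: mult_le_cancel_left_pos)
  moreover have "2 ^ Suc n * packC * (heightC ^ n + 1) > 0" using packC_ge_1 heightC_ge_1 by (intro mult_pos_pos add_pos_pos) auto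
  ultimately show ?thesis by (simp add: field_simps)
qed

end

context monic_irreducible
begin

theorem root_primes_density:
  "\<exists>c>0. \<exists>\<kappa>\<ge>1. \<forall>\<^sub>F B in sequentially. c * ln (real B) \<le>
     (\<Sum>p | prime p \<and> real p \<le> (\<kappa> * real B) ^ n \<and> (\<exists>x. int p dvd poly g x). ln (real p) / real p)"
proof -
  obtain \<Delta> :: nat where \<Delta>: "\<Delta> > 0"
    "\<And>p x. prime p \<Longrightarrow> \<not> p dvd \<Delta> \<Longrightarrow> int p dvd poly g x \<Longrightarrow> \<not> int p dvd poly (pderiv g) x"
    using simple_roots_mod by blast
  \<comment> \<open>Primes beyond \<open>T\<close> cannot divide \<open>\<Delta>\<close>, and the
    second summand meets the tail condition of \<open>card_good\<close>. As \<open>T\<close> does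
    not depend on \<open>B\<close>, neither does \<open>\<kappa>\<close>.\<close>
  define T where "T = \<Delta> + nat \<lceil>4 * (2 ^ Suc n * packC)\<rceil>"
  have T0: "T > 0" using \<Delta> by (simp add: T_def)
  have simple: "\<not> int p dvd poly (pderiv g) x" if "prime p" "p > T" "int p dvd poly g x" for p x
  proof (rule \<Delta>(2))
    show "\<not> p dvd \<Delta>" using that(2) \<Delta>(1) by (auto simp: T_def dest!: dvd_imp_le)
  qed (use that in auto)
  have "4 * (2 ^ Suc n * packC) \<le> real T" unfolding T_def by linarith
  then have T: "2 ^ Suc n * packC / real T \<le> 1 / 4" using T0 by (simp add: field_simps)
  define \<kappa> where "\<kappa> = 3 * mulC * real (fact T * (nat \<lceil>2 * mulC\<rceil> + 2))"
  have ds: "density_setup g n T B" if "B > 0" for B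
    by unfold_locales (use T0 that simple in auto)
  have hC: "density_setup.heightC g n T = \<kappa>"
    using density_setup.heightC_def[OF ds[of 1]] density_setup.Q_def[OF ds[of 1]] density_setup.K_def[OF ds[of 1]]
    by (simp add: \<kappa>_def)
  have \<kappa>1: "\<kappa> \<ge> 1" using density_setup.heightC_ge_1[OF ds[of 1]] hC by simp
  define d where "d = 2 ^ Suc n * packC * sqrt (\<kappa> ^ n)"
  define c where "c = 1 / (2 ^ Suc n * packC * (\<kappa> ^ n + 1))"
  have c0: "c > 0" unfolding c_def using packC_ge_1 \<kappa>1 by (intro divide_pos_pos mult_pos_pos add_pos_pos) auto
  \<comment> \<open>Since n > 0, this also holds with the n-th power of sqrt B, which pushes the
    square-root term below a quarter of B^n.\<close>
  have "\<forall>\<^sub>F B::nat in sequentially. d * 4 \<le> sqrt (real B)" by real_asymp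
  then have "\<forall>\<^sub>F B in sequentially. c * ln (real B) \<le>
     (\<Sum>p | prime p \<and> real p \<le> (\<kappa> * real B) ^ n \<and> (\<exists>x. int p dvd poly g x). ln (real p) / real p)"
    using eventually_gt_at_top[of 0]
  proof eventually_elim
    case (elim B)
    interpret D: density_setup g n T B by (rule ds) (use elim in simp)
    have kB: "D.heightC = \<kappa>" by (rule hC)
    have "sqrt (real B) ^ n \<ge> sqrt (real B) ^ 1"
      using elim n_pos by (intro power_increasing) (auto simp: Suc_leI)
    then have dB: "d * 4 \<le> sqrt (real B) ^ n" using elim by simp
    have "2 ^ Suc n * packC * sqrt ((D.heightC * real B) ^ n) = d * sqrt (real B) ^ n"
      by (simp add: kB d_def power_mult_distrib real_sqrt_mult real_sqrt_power)
    also have "\<dots> \<le> (sqrt (real B) ^ n / 4) * sqrt (real B) ^ n"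
      using dB by (intro mult_right_mono) auto
    also have "\<dots> = real B ^ n / 4" by (simp flip: power_mult_distrib)
    finally have B: "2 ^ Suc n * packC * sqrt ((D.heightC * real B) ^ n) \<le> real B ^ n / 4" .
    show ?case using D.root_primes_sum_ge[OF T B] by (simp add: kB c_def D.root_primes_def)
  qed
  with c0 \<kappa>1 show ?thesis by blast
qed

end

section \<open>Sums over primes\<close>

lemma sum_ln_prime_factors_le:
  fixes k :: nat
  assumes "k > 0"
  shows "(\<Sum>p\<in>prime_factors k. ln (real p)) \<le> ln (real k)"
proof -
  have "k = (\<Prod>p\<in>prime_factors k. p ^ multiplicity p k)" by (rule prime_factorization_nat[OF assms])
  then have "real k = real (\<Prod>p\<in>prime_factors k. p ^ multiplicity p k)" by (rule arg_cong)
  also have "\<dots> = (\<Prod>p\<in>prime_factors k. real p ^ multiplicity p k)" by simp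
  also have "ln \<dots> = (\<Sum>p\<in>prime_factors k. ln (real p ^ multiplicity p k))"
    by (rule ln_prod) (auto intro: prime_gt_0_nat)
  also have "\<dots> = (\<Sum>p\<in>prime_factors k. real (multiplicity p k) * ln (real p))"
    by (intro sum.cong refl) (auto simp: ln_realpow prime_gt_0_nat)
  finally have "ln (real k) = (\<Sum>p\<in>prime_factors k. real (multiplicity p k) * ln (real p))" .
  moreover have "(\<Sum>p\<in>prime_factors k. ln (real p)) \<le> (\<Sum>p\<in>prime_factors k. real (multiplicity p k) * ln (real p))"
  proof (rule sum_mono)
    fix p assume p: "p \<in> prime_factors k"
    then have "prime p" "p dvd k" by auto
    then have "multiplicity p k \<ge> 1" using assms by (simp add: Suc_leI prime_multiplicity_gt_zero_iff)
    moreover have "ln (real p) \<ge> 0" using prime_ge_1_nat[OF \<open>prime p\<close>] by simp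
    ultimately show "ln (real p) \<le> real (multiplicity p k) * ln (real p)"
      using mult_right_mono[of 1 "real (multiplicity p k)" "ln (real p)"] by simp
  qed
  ultimately show ?thesis by linarith
qed

text \<open>The easy half of a theorem of Mertens: the logarithms of the prime factors of all k
  \<le> N add up to at most N ln N, and \<open>p\<close> divides at least N / (2 p) of these
  k.\<close>

lemma sum_ln_over_primes_le:
  assumes "N > 0"
  shows "(\<Sum>p | prime p \<and> p \<le> N. ln (real p) / real p) \<le> 2 * ln (real N)"
proof -
  let ?P = "{p. prime p \<and> p \<le> N}"
  have fin: "finite ?P" by (rule finite_subset[of _ "{..N}"]) auto
  have cnt: "real N / (2 * real p) \<le> real (card {k \<in> {1..N}. p dvd k})" if p: "p \<in> ?P" for p
  proof -
    have p0: "p > 0" "p \<le> N" using p by (auto simp: prime_gt_0_nat)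
    have "(\<lambda>i. p * i) ` {1..N div p} \<subseteq> {k \<in> {1..N}. p dvd k}"
    proof (rule image_subsetI)
      fix i assume "i \<in> {1..N div p}"
      then have i: "1 \<le> i" "i \<le> N div p" by auto
      have "p * i \<le> p * (N div p)" using i by simp
      also have "\<dots> \<le> N" by simp
      finally have "p * i \<le> N" .
      then show "p * i \<in> {k \<in> {1..N}. p dvd k}" using i p0 by simp
    qed
    moreover have "inj_on (\<lambda>i. p * i) {1..N div p}" using p0 by (auto simp: inj_on_def)
    ultimately have "card {1..N div p} \<le> card {k \<in> {1..N}. p dvd k}" by (intro card_inj_on_le) auto
    then have c: "N div p \<le> card {k \<in> {1..N}. p dvd k}" by simp
    have d: "N div p \<ge> 1" using p0 by (simp add: Suc_leI div_greater_zero_iff)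
    have "N mod p < p" using p0 by simp
    then have "N < p * (N div p) + p * 1" using mult_div_mod_eq[of p N] by linarith
    also have "p * (N div p) + p * 1 \<le> p * (N div p) + p * (N div p)" using d by (intro add_left_mono mult_left_mono) auto
    finally have "N \<le> 2 * p * (N div p)" by simp
    also have "\<dots> \<le> 2 * p * card {k \<in> {1..N}. p dvd k}" using c by (intro mult_left_mono) auto
    finally have "real N \<le> real (2 * p * card {k \<in> {1..N}. p dvd k})" by (simp only: of_nat_le_iff)
    then show ?thesis using p0 by (simp add: field_simps)
  qed
  have "real N / 2 * (\<Sum>p\<in>?P. ln (real p) / real p) = (\<Sum>p\<in>?P. real N / (2 * real p) * ln (real p))"
    by (simp add: sum_distrib_left)
  also have "\<dots> \<le> (\<Sum>p\<in>?P. real (card {k \<in> {1..N}. p dvd k}) * ln (real p))"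
  proof (intro sum_mono mult_right_mono cnt)
    fix p assume "p \<in> ?P"
    then show "0 \<le> ln (real p)" using prime_ge_1_nat[of p] by simp
  qed
  also have "\<dots> = (\<Sum>p\<in>?P. \<Sum>k | k \<in> {1..N} \<and> p dvd k. ln (real p))" by simp
  also have "\<dots> = (\<Sum>k\<in>{1..N}. \<Sum>p | p \<in> ?P \<and> p dvd k. ln (real p))"
    by (rule sum.swap_restrict[OF fin]) simp
  also have "\<dots> \<le> (\<Sum>k\<in>{1..N}. ln (real N))"
  proof (rule sum_mono)
    fix k assume k: "k \<in> {1..N}"
    then have "{p. p \<in> ?P \<and> p dvd k} = prime_factors k"
    proof -
      have "p \<le> N" if "p dvd k" for p using dvd_imp_le[OF that] k by simp
      then show ?thesis using k by (auto simp: prime_factors_dvd)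
    qed
    then have "(\<Sum>p | p \<in> ?P \<and> p dvd k. ln (real p)) \<le> ln (real k)"
      using sum_ln_prime_factors_le[of k] k by simp
    also have "\<dots> \<le> ln (real N)" using k by simp
    finally show "(\<Sum>p | p \<in> ?P \<and> p dvd k. ln (real p)) \<le> ln (real N)" .
  qed
  also have "\<dots> = real N * ln (real N)" by simp
  finally show ?thesis using assms by (simp add: field_simps)
qed

section \<open>Partial summation with the weight ln p / p\<close>

definition ln_ratio :: "nat \<Rightarrow> real" where "ln_ratio k = ln (real k) / real k"

lemma ln_ratio_nonneg: "ln_ratio k \<ge> 0"
  by (cases "k = 0") (auto simp: ln_ratio_def)

text \<open>The function ln x / x decreases beyond e < 3. For this reason the summation by parts
  starts at 3 and the prime 2 is treated by hand.\<close>

lemma ln_ratio_decreasing: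
  assumes "k \<ge> 3"
  shows "ln_ratio (Suc k) \<le> ln_ratio k"
proof -
  have k: "real k > 0" using assms by simp
  have "exp 1 \<le> (3::real)" by (rule exp_le)
  then have "ln (exp 1) \<le> ln (3::real)" by (intro ln_mono) auto
  then have "1 \<le> ln (3::real)" by simp
  also have "\<dots> \<le> ln (real k)" using assms by simp
  finally have l: "1 \<le> ln (real k)" .
  have eq: "real (Suc k) = real k * (1 + 1 / real k)" using k by (simp add: field_simps)
  have pos: "1 + 1 / real k > 0" using k by (intro add_pos_pos) auto
  have "ln (real (Suc k)) = ln (real k) + ln (1 + 1 / real k)"
    by (subst eq) (rule ln_mult_pos[OF k pos])
  moreover have "ln (1 + 1 / real k) \<le> 1 / real k" by (rule ln_add_one_self_le_self) simp
  ultimately have "real k * ln (real (Suc k)) \<le> real k * (ln (real k) + 1 / real k)"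
    by (intro mult_left_mono) auto
  also have "\<dots> = real k * ln (real k) + 1" using k by (simp add: distrib_left)
  also have "\<dots> \<le> real (Suc k) * ln (real k)" using l by (simp add: algebra_simps)
  finally show ?thesis unfolding ln_ratio_def using k by (simp add: field_simps)
qed

lemma abel_ln_ratio:
  assumes "N \<ge> 3"
  shows "(\<Sum>p\<in>A \<inter> {3..N}. ln_ratio p) = real (card (A \<inter> {3..N})) * ln_ratio N + (\<Sum>k\<in>{3..<N}. real (card (A \<inter> {3..k})) * (ln_ratio k - ln_ratio (Suc k)))"
  using assms
proof (induction N rule: dec_induct)
  case base
  have "A \<inter> {3..3} = (if 3 \<in> A then {3} else {})" by auto
  then show ?case by simp
next
  case (step N)
  have split: "A \<inter> {3..Suc N} = (if Suc N \<in> A then insert (Suc N) (A \<inter> {3..N}) else A \<inter> {3..N})"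
    using step(1) by (auto simp: le_Suc_eq)
  have fin: "finite (A \<inter> {3..N})" "Suc N \<notin> A \<inter> {3..N}" by auto
  have s: "(\<Sum>k\<in>{3..<Suc N}. real (card (A \<inter> {3..k})) * (ln_ratio k - ln_ratio (Suc k))) =
     (\<Sum>k\<in>{3..<N}. real (card (A \<inter> {3..k})) * (ln_ratio k - ln_ratio (Suc k))) + real (card (A \<inter> {3..N})) * (ln_ratio N - ln_ratio (Suc N))"
    using step(1) by simp
  show ?case
  proof (cases "Suc N \<in> A")
    case True
    then have eq: "A \<inter> {3..Suc N} = insert (Suc N) (A \<inter> {3..N})" using split by simp
    show ?thesis unfolding eq s sum.insert[OF fin] card_insert_disjoint[OF fin] step.IH
      by (simp add: algebra_simps)
  next
    case False
    then have eq: "A \<inter> {3..Suc N} = A \<inter> {3..N}" using split by simp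
    show ?thesis unfolding eq s step.IH by (simp add: algebra_simps)
  qed
qed

text \<open>In the Abel sum all weights are nonnegative, so a bound between counting functions
  passes to the weighted sums; the additive constant telescopes to
  \<open>K * ln_ratio 3\<close>.\<close>

lemma sum_ln_ratio_compare:
  assumes "\<And>k. real (card (A \<inter> {3..k})) \<le> \<epsilon> * real (card (A' \<inter> {3..k})) + K" "N \<ge> 3"
  shows "(\<Sum>p\<in>A \<inter> {3..N}. ln_ratio p) \<le> \<epsilon> * (\<Sum>p\<in>A' \<inter> {3..N}. ln_ratio p) + K * ln_ratio 3"
proof -
  have tele: "ln_ratio N + (\<Sum>k\<in>{3..<N}. ln_ratio k - ln_ratio (Suc k)) = ln_ratio 3"
    using assms(2) by (induction N rule: dec_induct) auto
  have "(\<Sum>p\<in>A \<inter> {3..N}. ln_ratio p) \<le> (\<epsilon> * real (card (A' \<inter> {3..N})) + K) * ln_ratio N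
     + (\<Sum>k\<in>{3..<N}. (\<epsilon> * real (card (A' \<inter> {3..k})) + K) * (ln_ratio k - ln_ratio (Suc k)))"
    unfolding abel_ln_ratio[OF assms(2)]
    by (intro add_mono sum_mono mult_right_mono assms(1)) (auto simp: ln_ratio_nonneg ln_ratio_decreasing)
  also have "\<dots> = \<epsilon> * (real (card (A' \<inter> {3..N})) * ln_ratio N + (\<Sum>k\<in>{3..<N}. real (card (A' \<inter> {3..k})) * (ln_ratio k - ln_ratio (Suc k))))
      + K * (ln_ratio N + (\<Sum>k\<in>{3..<N}. ln_ratio k - ln_ratio (Suc k)))"
    by (simp add: distrib_right distrib_left sum.distrib sum_distrib_left mult.assoc)
  finally show ?thesis unfolding abel_ln_ratio[OF assms(2)] tele .
qed

lemma sparse_primes_sum: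
  fixes W :: "nat set"
  assumes W: "\<And>p. p \<in> W \<Longrightarrow> prime p" and \<epsilon>: "\<epsilon> > 0"
    and ev: "\<And>t. t \<ge> t0 \<Longrightarrow> real (card {p \<in> W. p \<le> t}) \<le> \<epsilon> * real (card {p. prime p \<and> p \<le> t})"
  shows "\<exists>K. \<forall>N>0. (\<Sum>p | p \<in> W \<and> p \<le> N. ln (real p) / real p) \<le> 2 * \<epsilon> * ln (real N) + K"
proof -
  let ?P = "{p::nat. prime p}"
  \<comment> \<open>The summand \<open>t0\<close> pays for the range below \<open>t0\<close>, the
    summand \<open>\<epsilon>\<close> for the prime 2, which the intervals starting at 3
    omit.\<close>
  define K where "K = \<epsilon> + real t0"
  have K0: "K \<ge> 0" using \<epsilon> by (simp add: K_def)
  have cmp: "real (card (W \<inter> {3..k})) \<le> \<epsilon> * real (card (?P \<inter> {3..k})) + K" for k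
  proof (cases "k \<ge> t0")
    case True
    have "card (W \<inter> {3..k}) \<le> card {p \<in> W. p \<le> k}" by (intro card_mono) auto
    then have "real (card (W \<inter> {3..k})) \<le> \<epsilon> * real (card {p. prime p \<and> p \<le> k})" using ev[OF True] by linarith
    also have "card {p. prime p \<and> p \<le> k} \<le> card (insert 2 (?P \<inter> {3..k}))"
    proof (rule card_mono)
      show "{p. prime p \<and> p \<le> k} \<subseteq> insert 2 (?P \<inter> {3..k})"
        by (auto dest: prime_ge_2_nat)
    qed simp
    also have "\<dots> \<le> card (?P \<inter> {3..k}) + 1" by (simp add: card_insert_if)
    finally have "real (card (W \<inter> {3..k})) \<le> \<epsilon> * real (card (?P \<inter> {3..k}) + 1)" using \<epsilon> by (simp add: mult_left_mono)
    then show ?thesis by (simp add: K_def algebra_simps)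
  next
    case False
    have "card (W \<inter> {3..k}) \<le> card {1..k}" by (intro card_mono) auto
    then have "card (W \<inter> {3..k}) \<le> t0" using False by simp
    then have "real (card (W \<inter> {3..k})) \<le> real t0" by simp
    also have "\<dots> \<le> \<epsilon> * real (card (?P \<inter> {3..k})) + K" using \<epsilon> by (simp add: K_def)
    finally show ?thesis .
  qed
  show ?thesis
  proof (intro exI allI impI)
    fix N :: nat assume N: "N > 0"
    have fin: "finite (W \<inter> {3..N})" by simp
    have "(\<Sum>p | p \<in> W \<and> p \<le> N. ln (real p) / real p) \<le> (\<Sum>p\<in>insert 2 (W \<inter> {3..N}). ln_ratio p)"
      unfolding ln_ratio_def[symmetric]
    proof (rule sum_mono2)
      show "{p. p \<in> W \<and> p \<le> N} \<subseteq> insert 2 (W \<inter> {3..N})"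
      proof
        fix p assume p: "p \<in> {p \<in> W. p \<le> N}"
        then have "p \<ge> 2" using W prime_ge_2_nat by auto
        then show "p \<in> insert 2 (W \<inter> {3..N})" using p by auto
      qed
    qed (auto simp: ln_ratio_nonneg)
    also have "\<dots> \<le> ln_ratio 2 + (\<Sum>p\<in>W \<inter> {3..N}. ln_ratio p)" by simp
    also have "(\<Sum>p\<in>W \<inter> {3..N}. ln_ratio p) \<le> \<epsilon> * (2 * ln (real N)) + K * ln_ratio 3"
    proof (cases "N \<ge> 3")
      case True
      have "(\<Sum>p\<in>?P \<inter> {3..N}. ln_ratio p) \<le> (\<Sum>p | prime p \<and> p \<le> N. ln_ratio p)"
        by (rule sum_mono2) (auto simp: ln_ratio_nonneg intro: finite_subset[of _ "{..N}"])
      also have "\<dots> \<le> 2 * ln (real N)" using sum_ln_over_primes_le[OF N] by (simp add: ln_ratio_def)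
      finally have "\<epsilon> * (\<Sum>p\<in>?P \<inter> {3..N}. ln_ratio p) \<le> \<epsilon> * (2 * ln (real N))" using \<epsilon> by (intro mult_left_mono) auto
      then show ?thesis using sum_ln_ratio_compare[of W \<epsilon> ?P K, OF cmp True] by linarith
    next
      case False
      then have "W \<inter> {3..N} = {}" by auto
      then have "(\<Sum>p\<in>W \<inter> {3..N}. ln_ratio p) = 0" by (simp only: sum.empty)
      also have "0 \<le> \<epsilon> * (2 * ln (real N)) + K * ln_ratio 3" using \<epsilon> N K0 ln_ratio_nonneg by auto
      finally show ?thesis .
    qed
    finally show "(\<Sum>p | p \<in> W \<and> p \<le> N. ln (real p) / real p) \<le> 2 * \<epsilon> * ln (real N) + (ln_ratio 2 + K * ln_ratio 3)"
      by simp
  qed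
qed

lemma card_prime_factors_le_log:
  fixes m :: nat
  assumes "m > 0"
  shows "real (card (prime_factors m)) \<le> log 2 (real m)"
proof -
  have "real (card (prime_factors m)) * ln 2 = (\<Sum>p\<in>prime_factors m. ln 2)" by simp
  also have "\<dots> \<le> (\<Sum>p\<in>prime_factors m. ln (real p))"
  proof (rule sum_mono)
    fix p assume "p \<in> prime_factors m"
    then have "p \<ge> 2" using prime_ge_2_nat by auto
    then show "ln 2 \<le> ln (real p)" by simp
  qed
  also have "\<dots> \<le> ln (real m)" by (rule sum_ln_prime_factors_le[OF assms])
  finally show ?thesis by (simp add: log_def field_simps)
qed

section \<open>Primes dividing a number of a sparse sequence\<close>

lemma summable_inverse_squares: "summable (\<lambda>m::nat. 1 / real m ^ 2)"
proof (rule summableI_nonneg_bounded)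
  fix n :: nat
  have "(\<Sum>m<n. 1 / real m ^ 2) \<le> (\<Sum>m\<in>insert 0 (insert 1 {1<..n}). 1 / real m ^ 2)"
    by (rule sum_mono2) auto
  also have "\<dots> = 1 + (\<Sum>m\<in>{1<..n}. 1 / real m ^ 2)" by simp
  also have "\<dots> \<le> 2" using sum_inverse_squares_tail[of 1 n] by simp
  finally show "(\<Sum>m<n. 1 / real m ^ 2) \<le> 2" .
qed simp

lemma sum_UN_nonneg_le:
  fixes f :: "'a \<Rightarrow> real"
  assumes "finite I" "\<And>i. i \<in> I \<Longrightarrow> finite (F i)" "\<And>x. f x \<ge> 0"
  shows "sum f (\<Union>i\<in>I. F i) \<le> (\<Sum>i\<in>I. sum f (F i))"
  using assms(1,2)
proof (induction I rule: finite_induct)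
  case (insert i I)
  have fin: "finite (F i)" "finite (\<Union>i\<in>I. F i)" using insert by auto
  have "sum f (F i \<union> (\<Union>i\<in>I. F i)) \<le> sum f (F i) + sum f (\<Union>i\<in>I. F i)"
    using sum_Un[OF fin, of f] sum_nonneg[of "F i \<inter> (\<Union>i\<in>I. F i)" f] assms(3) by simp
  then show ?case using insert by force
qed simp

text \<open>\<open>R m\<close> has at most \<open>c * m\<close> prime factors, and the relevant ones
  exceed 2^(sqrt m) because m < (log p)^2. For these, ln p / p \<le> 2 / sqrt p is at most 2 times
  2^(- sqrt m / 2), and \<open>m\<close> times this is summable.\<close>

lemma exceptional_primes_sum:
  fixes R :: "nat \<Rightarrow> nat" and c :: real
  assumes R: "\<And>m. m > 0 \<Longrightarrow> R m > 0" "\<And>m. m > 0 \<Longrightarrow> log 2 (real (R m)) \<le> c * real m"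
  shows "\<exists>K. \<forall>N. (\<Sum>p | prime p \<and> p \<le> N \<and> (\<exists>m>0. real m < (log 2 (real p))\<^sup>2 \<and> p dvd R m). ln (real p) / real p) \<le> K"
proof -
  define f where "f m = c * real m * (2 * 2 powr (- sqrt (real m) / 2))" for m :: nat
  have c0: "c \<ge> 0"
  proof -
    have "0 \<le> log 2 (real (R 1))" using R(1)[of 1] by simp
    then show ?thesis using R(2)[of 1] by simp
  qed
  have f0: "f m \<ge> 0" for m using c0 by (simp add: f_def)
  have a: "(\<lambda>m::nat. real m * (2 * 2 powr (- sqrt (real m) / 2))) \<in> O(\<lambda>m. 1 / real m ^ 2)" by real_asymp
  have b: "summable (\<lambda>m::nat. norm (1 / real m ^ 2))"
    using summable_inverse_squares by simp
  have "summable (\<lambda>m::nat. real m * (2 * 2 powr (- sqrt (real m) / 2)))"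
    by (rule summable_comparison_test_bigo[OF b a])
  then have "summable (\<lambda>m. c * (real m * (2 * 2 powr (- sqrt (real m) / 2))))" by (rule summable_mult)
  then have sf: "summable f" by (simp add: f_def[abs_def] mult.assoc)
  show ?thesis
  proof (intro exI allI)
    fix N :: nat
    define E where "E = {p. prime p \<and> p \<le> N \<and> (\<exists>m>0. real m < (log 2 (real p))\<^sup>2 \<and> p dvd R m)}"
    define M where "M = nat \<lceil>(log 2 (real N))\<^sup>2\<rceil>"
    define F where "F m = {p \<in> prime_factors (R m). 2 powr sqrt (real m) \<le> real p}" for m
    have sub: "E \<subseteq> (\<Union>m\<in>{0<..<Suc M}. F m)"
    proof
      fix p assume "p \<in> E"
      then obtain m where p: "prime p" "p \<le> N" and m: "m > 0" "real m < (log 2 (real p))\<^sup>2" "p dvd R m"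
        by (auto simp: E_def)
      have p1: "real p \<ge> 1" using prime_ge_1_nat[OF p(1)] by simp
      have l0: "log 2 (real p) \<ge> 0" using p1 by simp
      have "(log 2 (real p))\<^sup>2 \<le> (log 2 (real N))\<^sup>2" using p(2) p1 l0 by (intro power_mono) auto
      then have "m < Suc M" using m(2) unfolding M_def by linarith
      moreover have "sqrt (real m) \<le> log 2 (real p)" using m(2) l0 by (intro real_le_lsqrt) auto
      then have "2 powr sqrt (real m) \<le> real p" using p1 by (subst (asm) le_log_iff) auto
      moreover have "p \<in> prime_factors (R m)" using p m R(1)[OF m(1)] by (auto simp: prime_factors_dvd)
      ultimately show "p \<in> (\<Union>m\<in>{0<..<Suc M}. F m)" using m(1) by (auto simp: F_def)
    qed
    have nn: "0 \<le> ln (real p) / real p" for p :: nat using ln_ratio_nonneg[of p] by (simp add: ln_ratio_def)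
    have finF: "finite (F m)" for m by (simp add: F_def)
    have "(\<Sum>p\<in>E. ln (real p) / real p) \<le> (\<Sum>p\<in>(\<Union>m\<in>{0<..<Suc M}. F m). ln (real p) / real p)"
      using sub nn finF by (intro sum_mono2) auto
    also have "\<dots> \<le> (\<Sum>m\<in>{0<..<Suc M}. \<Sum>p\<in>F m. ln (real p) / real p)"
      using nn finF by (intro sum_UN_nonneg_le) auto
    also have "\<dots> \<le> (\<Sum>m\<in>{0<..<Suc M}. f m)"
    proof (rule sum_mono)
      fix m assume "m \<in> {0<..<Suc M}"
      then have m: "m > 0" by simp
      have "(\<Sum>p\<in>F m. ln (real p) / real p) \<le> (\<Sum>p\<in>F m. 2 * 2 powr (- sqrt (real m) / 2))"
      proof (rule sum_mono)
        fix p assume p: "p \<in> F m"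
        then have "prime p" by (auto simp: F_def)
        then have p1: "real p > 0" by (simp add: prime_gt_0_nat)
        have "ln (real p) = 2 * ln (sqrt (real p))" using p1 by (simp add: ln_sqrt)
        also have "ln (sqrt (real p)) \<le> sqrt (real p)" using ln_le_minus_one[of "sqrt (real p)"] p1 by simp
        finally have "ln (real p) / real p \<le> 2 * sqrt (real p) / real p" using p1 by (intro divide_right_mono) auto
        also have "\<dots> = 2 * (1 / sqrt (real p))" using p1 by (simp add: real_div_sqrt field_simps)
        also have "1 / sqrt (real p) \<le> 1 / sqrt (2 powr sqrt (real m))"
          using p p1 by (intro divide_left_mono real_sqrt_le_mono mult_pos_pos) (auto simp: F_def)
        also have "\<dots> = 2 powr (- sqrt (real m) / 2)"
          by (simp add: powr_half_sqrt[symmetric] powr_powr powr_minus_divide)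
        finally show "ln (real p) / real p \<le> 2 * 2 powr (- sqrt (real m) / 2)" by simp
      qed
      also have "\<dots> = real (card (F m)) * (2 * 2 powr (- sqrt (real m) / 2))" by simp
      also have "\<dots> \<le> c * real m * (2 * 2 powr (- sqrt (real m) / 2))"
      proof (rule mult_right_mono)
        have "card (F m) \<le> card (prime_factors (R m))" by (intro card_mono) (auto simp: F_def)
        then show "real (card (F m)) \<le> c * real m"
          using card_prime_factors_le_log[OF R(1)[OF m]] R(2)[OF m] by linarith
      qed simp
      finally show "(\<Sum>p\<in>F m. ln (real p) / real p) \<le> f m" by (simp add: f_def)
    qed
    also have "\<dots> \<le> suminf f" by (rule sum_le_suminf[OF sf]) (auto simp: f0)
    finally show "(\<Sum>p | prime p \<and> p \<le> N \<and> (\<exists>m>0. real m < (log 2 (real p))\<^sup>2 \<and> p dvd R m). ln (real p) / real p) \<le> suminf f"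
      unfolding E_def .
  qed
qed

section \<open>Conjugates\<close>

abbreviation cpoly :: "int poly \<Rightarrow> complex \<Rightarrow> complex" where
  "cpoly f z \<equiv> poly (of_int_poly f) z"

text \<open>The point is the uniformity: one \<open>\<Lambda>\<close>, depending only on the nodes,
  bounds the coefficients for all prescribed values.\<close>

lemma lagrange_interpolation:
  fixes E :: "complex set"
  assumes fin: "finite E"
  shows "\<exists>\<Lambda>>0. \<forall>w B. B \<ge> 0 \<longrightarrow> (\<forall>e\<in>E. norm (w e) \<le> B) \<longrightarrow>
     (\<exists>c::complex poly. (\<forall>i\<ge>card E. coeff c i = 0) \<and> (\<forall>e\<in>E. poly c e = w e) \<and> (\<forall>i. norm (coeff c i) \<le> \<Lambda> * B))"
proof -
  define l where "l e = (\<Prod>x\<in>E - {e}. smult (1 / (e - x)) [:- x, 1:])" for e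
  have le: "poly (l e) e' = (if e' = e then 1 else 0)" if "e \<in> E" "e' \<in> E" for e e'
  proof (cases "e' = e")
    case True
    have "poly (l e) e = (\<Prod>x\<in>E - {e}. 1)" unfolding l_def poly_prod
      by (intro prod.cong) (auto simp: field_simps)
    then show ?thesis using True by simp
  next
    case False
    then have "e' \<in> E - {e}" using that by simp
    then have "poly (l e) e' = 0" unfolding l_def poly_prod using fin by (intro prod_zero) auto
    then show ?thesis using False by simp
  qed
  have deg: "coeff (l e) i = 0" if "e \<in> E" "i \<ge> card E" for e i
  proof -
    have "degree (l e) \<le> (\<Sum>x\<in>E - {e}. degree (smult (1 / (e - x)) [:- x, 1:]))"
      unfolding l_def using degree_prod_sum_le[of "E - {e}" "\<lambda>x. smult (1 / (e - x)) [:- x, 1:]"] fin by (simp add: comp_def)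
    also have "\<dots> \<le> (\<Sum>x\<in>E - {e}. 1)" by (intro sum_mono) auto
    also have "\<dots> = card E - 1" using that fin by simp
    finally have "degree (l e) \<le> card E - 1" .
    moreover have "card E > 0" using that fin card_gt_0_iff by auto
    ultimately show ?thesis using that(2) by (intro coeff_eq_0) linarith
  qed
  define \<Lambda> where "\<Lambda> = 1 + (\<Sum>e\<in>E. \<Sum>i<card E. norm (coeff (l e) i))"
  have \<Lambda>0: "\<Lambda> > 0" unfolding \<Lambda>_def by (intro add_pos_nonneg sum_nonneg) auto
  show ?thesis
  proof (intro exI conjI allI impI)
    show "\<Lambda> > 0" by (rule \<Lambda>0)
    fix w :: "complex \<Rightarrow> complex" and B :: real
    assume B0: "B \<ge> 0" and w: "\<forall>e\<in>E. norm (w e) \<le> B"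
    define c where "c = (\<Sum>e\<in>E. smult (w e) (l e))"
    show z: "coeff c i = 0" if "i \<ge> card E" for i
      unfolding c_def coeff_sum using deg that by (intro sum.neutral) auto
    show "\<forall>e\<in>E. poly c e = w e"
    proof
      fix e assume e: "e \<in> E"
      have "poly c e = (\<Sum>x\<in>E. w x * (if e = x then 1 else 0))"
        unfolding c_def poly_sum using le e by (intro sum.cong) auto
      also have "\<dots> = (\<Sum>x\<in>E. if e = x then w x else 0)" by (intro sum.cong) auto
      also have "\<dots> = w e" using fin e by (subst sum.delta') auto
      finally show "poly c e = w e" .
    qed
    fix i
    show "norm (coeff c i) \<le> \<Lambda> * B"
      proof (cases "i < card E")
        case True
        have "norm (coeff c i) \<le> (\<Sum>e\<in>E. norm (w e * coeff (l e) i))"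
          unfolding c_def coeff_sum by (rule order_trans[OF norm_sum]) simp
        also have "\<dots> \<le> (\<Sum>e\<in>E. B * norm (coeff (l e) i))"
          unfolding norm_mult using w by (intro sum_mono mult_right_mono) auto
        also have "\<dots> \<le> (\<Sum>e\<in>E. B * (\<Sum>i<card E. norm (coeff (l e) i)))"
          using True B0 by (intro sum_mono mult_left_mono member_le_sum) auto
        also have "\<dots> = B * (\<Lambda> - 1)" by (simp add: \<Lambda>_def sum_distrib_left)
        also have "\<dots> \<le> \<Lambda> * B" using B0 by (simp add: algebra_simps)
        finally show ?thesis .
      next
        case False
        then show ?thesis using z[of i] \<Lambda>0 B0 by simp
      qed
  qed
qed

lemma cpoly_simps [simp]: "cpoly (f + h) z = cpoly f z + cpoly h z" "cpoly (f - h) z = cpoly f z - cpoly h z"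
  "cpoly (f * h) z = cpoly f z * cpoly h z" "cpoly (f ^ k) z = cpoly f z ^ k" "cpoly 0 z = 0" "cpoly 1 z = 1"
  "cpoly (monom 1 k) z = z ^ k"
  by (simp_all add: hom_distribs poly_monom)

lemma cpoly_const [simp]: "cpoly [:c:] z = of_int c"
  by (simp add: hom_distribs)

context monic_irreducible
begin

definition roots :: "complex set" where "roots = {z. cpoly g z = 0}"

lemma finite_roots: "finite roots"
  unfolding roots_def using g_nonzero by (intro poly_roots_finite) simp

lemma rsquarefree_g: "rsquarefree (of_int_poly g :: complex poly)"
  unfolding rsquarefree_roots
proof (intro allI notI)
  fix z :: complex
  assume z: "cpoly g z = 0 \<and> poly (pderiv (of_int_poly g)) z = 0"
  have "\<not> g dvd pderiv g"
  proof
    assume "g dvd pderiv g"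
    then have "pderiv g = 0" by (rule dvd_small_zero) (use deg n_pos in \<open>auto simp: coeff_pderiv coeff_eq_0\<close>)
    then show False using n_pos deg by (simp add: pderiv_eq_0_iff)
  qed
  then obtain N b where N: "N > 0" "g dvd pderiv g * b - [:N:]" using coprime_const by blast
  obtain k where "pderiv g * b - [:N:] = g * k" using N(2) by (elim dvdE)
  then have "pderiv g * b = g * k + [:N:]" by (simp add: algebra_simps)
  then have "cpoly (pderiv g * b) z = cpoly (g * k + [:N:]) z" by (simp only:)
  moreover have "cpoly (pderiv g) z = 0" using z by (simp add: of_int_hom.map_poly_pderiv)
  ultimately have "of_int N = (0::complex)" using z by simp
  then show False using N by simp
qed

lemma card_roots: "card roots = n"
proof -
  have "of_int_poly g \<noteq> (0 :: complex poly)" using g_nonzero by simp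
  then show ?thesis using rsquarefree_g rsquarefree_card_degree[of "of_int_poly g :: complex poly"] deg
    by (simp add: roots_def)
qed

lemma mahler_g: "mahler_measure g = (\<Prod>z\<in>roots. max 1 (norm z))"
proof -
  let ?G = "of_int_poly g :: complex poly"
  have lc: "lead_coeff ?G = 1" using monic by simp
  have "(\<Prod>a\<leftarrow>complex_roots_complex ?G. [:- a, 1:]) = ?G"
    using complex_roots(1)[of ?G] lc by simp
  moreover have "(\<Prod>z\<in>roots. [:- z, 1:]) = ?G"
    using complex_poly_decompose_rsquarefree[OF rsquarefree_g] lc by (simp add: roots_def)
  moreover obtain rs where rs: "set rs = roots" "distinct rs" using finite_distinct_list[OF finite_roots] by blast
  ultimately have "(\<Prod>a\<leftarrow>complex_roots_complex ?G. [:- a, 1:]) = (\<Prod>a\<leftarrow>rs. [:- a, 1:])"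
    by (simp add: prod.distinct_set_conv_list[symmetric])
  then have "mset (complex_roots_complex ?G) = mset rs" by (rule reconstruct_poly_monic_defines_mset)
  then have "prod_mset (mset (map (\<lambda>a. max 1 (norm a)) (complex_roots_complex ?G))) = prod_mset (mset (map (\<lambda>a. max 1 (norm a)) rs))"
    by simp
  then have "(\<Prod>a\<leftarrow>complex_roots_complex ?G. max 1 (norm a)) = (\<Prod>a\<leftarrow>rs. max 1 (norm a))"
    unfolding prod_mset_prod_list .
  then show ?thesis using rs lc
    by (simp add: mahler_measure_def mahler_measure_poly_def prod.distinct_set_conv_list[symmetric])
qed

lemma dvd_imp_roots: "g dvd f \<Longrightarrow> z \<in> roots \<Longrightarrow> cpoly f z = 0"
  by (elim dvdE) (simp add: roots_def)

lemma root_imp_dvd: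
  assumes "z \<in> roots" "cpoly f z = 0"
  shows "g dvd f"
proof (rule ccontr)
  assume "\<not> g dvd f"
  then obtain N b where N: "N > 0" "g dvd f * b - [:N:]" using coprime_const by blast
  have "cpoly (f * b - [:N:]) z = 0" by (rule dvd_imp_roots[OF N(2) assms(1)])
  then show False using assms(2) N by simp
qed

lemma cpoly_red: "z \<in> roots \<Longrightarrow> cpoly (red f) z = cpoly f z"
  using dvd_imp_roots[OF red(2), of z f] by simp

text \<open>
  If \<open>g\<close> does not divide \<open>s\<close>, the remainders of the powers of \<open>s\<close> are nonzero integer polynomials,
  but Lagrange interpolation at the conjugates forces their coefficients to tend to 0.
\<close>

lemma small_conjugates_dvd:
  assumes "\<And>z. z \<in> roots \<Longrightarrow> norm (cpoly s z) < 1"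
  shows "g dvd s"
proof -
  define \<theta> where "\<theta> = Max (insert 0 ((\<lambda>z. norm (cpoly s z)) ` roots))"
  have th: "norm (cpoly s z) \<le> \<theta>" if "z \<in> roots" for z
    unfolding \<theta>_def using finite_roots that by (intro Max_ge) auto
  have "\<theta> \<in> insert 0 ((\<lambda>z. norm (cpoly s z)) ` roots)" unfolding \<theta>_def using finite_roots by (intro Max_in) auto
  then have t1: "0 \<le> \<theta>" "\<theta> < 1" using assms by auto
  obtain \<Lambda> where \<Lambda>: "\<Lambda> > 0" and lag: "\<And>w B. B \<ge> 0 \<Longrightarrow> (\<forall>e\<in>roots. norm (w e) \<le> B) \<Longrightarrow>
     (\<exists>c::complex poly. (\<forall>i\<ge>card roots. coeff c i = 0) \<and> (\<forall>e\<in>roots. poly c e = w e) \<and> (\<forall>i. norm (coeff c i) \<le> \<Lambda> * B))"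
    using lagrange_interpolation[OF finite_roots] by blast
  have "(\<lambda>k. \<theta> ^ k) \<longlonglongrightarrow> 0" using t1 by (intro LIMSEQ_power_zero) auto
  then have "\<forall>\<^sub>F k in sequentially. \<theta> ^ k < 1 / \<Lambda>" using \<Lambda> by (intro order_tendstoD(2)) auto
  then obtain k where k: "\<theta> ^ k < 1 / \<Lambda>" by (auto simp: eventually_sequentially)
  define t where "t = red (s ^ k)"
  have tz: "norm (cpoly t z) \<le> \<theta> ^ k" if "z \<in> roots" for z
    using th[OF that] cpoly_red[OF that] by (simp add: t_def norm_power power_mono)
  obtain c :: "complex poly" where c: "\<forall>i\<ge>card roots. coeff c i = 0" "\<forall>e\<in>roots. poly c e = cpoly t e" "\<forall>i. norm (coeff c i) \<le> \<Lambda> * \<theta> ^ k"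
    using lag[of "\<theta> ^ k" "cpoly t"] tz t1 by auto
  have "c = of_int_poly t"
  proof (rule ccontr)
    assume ne: "c \<noteq> of_int_poly t"
    define d where "d = c - of_int_poly t"
    have d0: "d \<noteq> 0" using ne by (simp add: d_def)
    have "degree d < n"
      by (rule degree_lessI) (use d0 c(1) red(1)[of _ "s ^ k"] in \<open>auto simp: d_def t_def card_roots\<close>)
    moreover have "roots \<subseteq> {z. poly d z = 0}" using c(2) by (auto simp: d_def)
    then have "card roots \<le> card {z. poly d z = 0}" using d0 poly_roots_finite by (intro card_mono) auto
    then have "n \<le> degree d" using card_poly_roots_bound[OF d0] card_roots by simp
    ultimately show False by simp
  qed
  have "coeff t i = 0" for i
  proof -
    have "norm (complex_of_int (coeff t i)) \<le> \<Lambda> * \<theta> ^ k" using c(3) \<open>c = of_int_poly t\<close> by simp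
    also have "\<dots> < 1" using k \<Lambda> by (simp add: field_simps)
    finally show ?thesis by simp
  qed
  then have "t = 0" by (simp add: poly_eq_iff)
  then have "g dvd s ^ k" using red(2)[of "s ^ k"] by (simp add: t_def)
  then show ?thesis using prime_g by (rule prime_elem_dvd_power[rotated])
qed

text \<open>By \<open>mahler_g\<close> this is the Mahler measure of \<open>g\<close>; a product
  over the set of roots suffices because they are simple.\<close>

definition msr :: real where "msr = (\<Prod>z\<in>roots. max 1 (norm z))"

text \<open>The values at the conjugates are sorted into squares of side 1/2. Two elements in the
  same squares differ by less than 1 at every conjugate, so \<open>small_conjugates_dvd\<close>
  makes them congruent modulo \<open>g\<close>. Real and imaginary parts are counted separately,
  whence the doubled exponents.\<close>

lemma card_bounded_classes:
  fixes A :: "int poly set"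
  assumes b: "\<And>f z. f \<in> A \<Longrightarrow> z \<in> roots \<Longrightarrow> norm (cpoly f z) \<le> K * max 1 (norm z) ^ L" and K: "K \<ge> 1"
  shows "finite (red ` A)" "real (card (red ` A)) \<le> (7 * K) ^ (2 * n) * msr ^ (2 * L)"
proof -
  define Rz where "Rz z = K * max 1 (norm z) ^ L" for z :: complex
  have R1: "Rz z \<ge> 1" for z
  proof -
    have "1 * 1 \<le> K * max 1 (norm z) ^ L" using K by (intro mult_mono one_le_power) auto
    then show ?thesis by (simp add: Rz_def)
  qed
  define I where "I z = {- \<lceil>2 * Rz z\<rceil> .. \<lceil>2 * Rz z\<rceil>}" for z
  have cI: "real (card (I z)) \<le> 7 * Rz z" for z
  proof -
    have "real (card (I z)) = real_of_int (2 * \<lceil>2 * Rz z\<rceil> + 1)"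
      using R1[of z] by (simp add: I_def)
    also have "\<dots> \<le> 7 * Rz z" using R1[of z] by simp linarith
    finally show ?thesis .
  qed
  have Iin: "\<lfloor>2 * x\<rfloor> \<in> I z" if "\<bar>x\<bar> \<le> Rz z" for x z
  proof -
    have "- (2 * Rz z) \<le> 2 * x" "2 * x \<le> 2 * Rz z" using that by auto
    then show ?thesis unfolding I_def atLeastAtMost_iff by (intro conjI) linarith+
  qed
  define \<Phi> where "\<Phi> r = (\<lambda>z\<in>roots. (\<lfloor>2 * Re (cpoly r z)\<rfloor>, \<lfloor>2 * Im (cpoly r z)\<rfloor>))" for r
  define T where "T = PiE roots (\<lambda>z. I z \<times> I z)"
  have finT: "finite T" unfolding T_def by (intro finite_PiE finite_roots) (auto simp: I_def)
  have sub: "\<Phi> ` red ` A \<subseteq> T"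
  proof
    fix t assume "t \<in> \<Phi> ` red ` A"
    then obtain f where f: "f \<in> A" and t: "t = \<Phi> (red f)" by blast
    have "(\<lfloor>2 * Re (cpoly (red f) z)\<rfloor>, \<lfloor>2 * Im (cpoly (red f) z)\<rfloor>) \<in> I z \<times> I z" if z: "z \<in> roots" for z
    proof -
      have "norm (cpoly (red f) z) \<le> Rz z" unfolding Rz_def cpoly_red[OF z] by (rule b[OF f z])
      then show ?thesis using abs_Re_le_cmod[of "cpoly (red f) z"] abs_Im_le_cmod[of "cpoly (red f) z"]
        by (intro SigmaI Iin) linarith+
    qed
    then show "t \<in> T" unfolding t \<Phi>_def T_def by (simp add: restrict_PiE_iff)
  qed
  have inj: "inj_on \<Phi> (red ` A)"
  proof (rule inj_onI)
    fix r r' assume r: "r \<in> red ` A" "r' \<in> red ` A" and eq: "\<Phi> r = \<Phi> r'"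
    have "norm (cpoly (r - r') z) < 1" if z: "z \<in> roots" for z
    proof -
      have "\<Phi> r z = \<Phi> r' z" using eq by simp
      then have "\<lfloor>2 * Re (cpoly r z)\<rfloor> = \<lfloor>2 * Re (cpoly r' z)\<rfloor>" "\<lfloor>2 * Im (cpoly r z)\<rfloor> = \<lfloor>2 * Im (cpoly r' z)\<rfloor>"
        using z by (auto simp: \<Phi>_def)
      then have "\<bar>Re (cpoly r z) - Re (cpoly r' z)\<bar> < 1 / 2" "\<bar>Im (cpoly r z) - Im (cpoly r' z)\<bar> < 1 / 2"
        by linarith+
      then show ?thesis using cmod_le[of "cpoly (r - r') z"] by simp
    qed
    then have "g dvd r - r'" by (rule small_conjugates_dvd)
    then have "r - r' = 0" using r red(1) by (intro dvd_small_zero) auto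
    then show "r = r'" by simp
  qed
  show "finite (red ` A)" by (rule inj_on_finite[OF inj sub finT])
  have "card (red ` A) \<le> card T" by (rule card_inj_on_le[OF inj sub finT])
  also have "card T = (\<Prod>z\<in>roots. card (I z) * card (I z))"
    unfolding T_def by (simp add: card_PiE[OF finite_roots] card_cartesian_product)
  finally have "real (card (red ` A)) \<le> real (\<Prod>z\<in>roots. card (I z) * card (I z))" by (simp only: of_nat_le_iff)
  also have "\<dots> = (\<Prod>z\<in>roots. real (card (I z)) * real (card (I z)))" by simp
  also have "\<dots> \<le> (\<Prod>z\<in>roots. (7 * Rz z) * (7 * Rz z))"
  proof (rule prod_mono)
    fix z
    show "0 \<le> real (card (I z)) * real (card (I z)) \<and> real (card (I z)) * real (card (I z)) \<le> (7 * Rz z) * (7 * Rz z)"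
      using R1[of z] by (intro conjI mult_mono cI) auto
  qed
  also have "\<dots> = (\<Prod>z\<in>roots. (7 * K) ^ 2 * (max 1 (norm z) ^ (2 * L)))"
    by (intro prod.cong refl) (simp add: Rz_def power2_eq_square mult_2 power_add)
  also have "\<dots> = (7 * K) ^ (2 * n) * msr ^ (2 * L)"
    by (simp add: prod.distrib card_roots msr_def prod_power_distrib power_mult)
  finally show "real (card (red ` A)) \<le> (7 * K) ^ (2 * n) * msr ^ (2 * L)" .
qed

end

section \<open>From sparse wild primes to the Lehmer conjecture\<close>

lemma log_power_less_sqrt:
  fixes C :: real
  assumes "C > 0"
  shows "\<forall>\<^sub>F x::real in at_top. (7 * log 2 x powr C) ^ (2 * n) < sqrt x"
  using assms by real_asymp

context monic_irreducible
begin

lemma cpoly_monom_sum: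
  assumes "set is \<subseteq> {..L}"
  shows "norm (cpoly (sum_list (map (monom 1) is)) z) \<le> real (length is) * max 1 (norm z) ^ L"
  using assms
proof (induction "is")
  case (Cons i xs)
  have "norm (z ^ i) \<le> max 1 (norm z) ^ i" unfolding norm_power by (intro power_mono) auto
  also have "\<dots> \<le> max 1 (norm z) ^ L" using Cons.prems by (intro power_increasing) auto
  finally have "norm (z ^ i) \<le> max 1 (norm z) ^ L" .
  moreover have "norm (cpoly (sum_list (map (monom 1) xs)) z) \<le> real (length xs) * max 1 (norm z) ^ L"
    using Cons by simp
  ultimately show ?case using norm_triangle_ineq[of "z ^ i" "cpoly (sum_list (map (monom 1) xs)) z"]
    by (simp add: algebra_simps poly_monom)
qed simp

text \<open>A sum of powers of \<open>x\<close> is the value at \<open>x\<close> of a sum of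
  monomials, and modulo \<open>p\<close> this value depends only on the class modulo
  \<open>g\<close>, since \<open>x\<close> is a root. With fewer than \<open>p\<close> classes some
  residue is missed.\<close>

lemma wild_if_few_classes:
  assumes p: "prime p" and x: "x \<in> {1..<p}" "int p dvd poly g (int x)" "real (ord p x) \<ge> (log 2 (real p))\<^sup>2"
    and K: "K \<ge> 1" "log 2 (real p) powr C \<le> K" and L: "L = nat \<lfloor>C * log 2 (real p)\<rfloor>"
    and few: "(7 * K) ^ (2 * n) * msr ^ (2 * L) < real p"
  shows "wild C p"
proof (rule ccontr)
  assume "\<not> wild C p"
  then have all: "sum_of_at_most (log 2 (real p) powr C) p (geom_prog C p x) y" if "y \<in> {0..<p}" for y
    using that p x unfolding wild_def by blast
  define A where "A = {sum_list (map (monom (1::int)) is) | is. set is \<subseteq> {..L} \<and> real (length is) \<le> K}"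
  have b: "norm (cpoly f z) \<le> K * max 1 (norm z) ^ L" if f: "f \<in> A" for f z
  proof -
    obtain "is" where i: "f = sum_list (map (monom 1) is)" "set is \<subseteq> {..L}" "real (length is) \<le> K"
      using f by (auto simp: A_def)
    have "norm (cpoly f z) \<le> real (length is) * max 1 (norm z) ^ L" unfolding i(1) by (rule cpoly_monom_sum[OF i(2)])
    also have "\<dots> \<le> K * max 1 (norm z) ^ L" using i(3) by (intro mult_right_mono) auto
    finally show ?thesis .
  qed
  have fin: "finite (red ` A)" and cardA: "real (card (red ` A)) < real p"
    using card_bounded_classes[of A K L, OF b K(1)] few by auto
  have "{0..<int p} \<subseteq> (\<lambda>r. poly r (int x) mod int p) ` red ` A"
  proof
    fix y assume y: "y \<in> {0..<int p}"
    then have "nat y \<in> {0..<p}" by auto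
    from all[OF this] obtain hs where hs: "set hs \<subseteq> geom_prog C p x" "real (length hs) \<le> log 2 (real p) powr C"
      "[sum_list hs = nat y] (mod p)" by (auto simp: sum_of_at_most_def)
    have "\<exists>is. set is \<subseteq> {..L} \<and> length is = length hs \<and> int (sum_list hs) mod int p = poly (sum_list (map (monom 1) is)) (int x) mod int p"
      using hs(1)
    proof (induction hs)
      case (Cons h hs)
      then obtain "is" where IH: "set is \<subseteq> {..L}" "length is = length hs"
        "int (sum_list hs) mod int p = poly (sum_list (map (monom 1) is)) (int x) mod int p" by auto
      obtain i where i: "h = x ^ i mod p" "int i \<le> \<lfloor>C * log 2 (real p)\<rfloor>"
        using Cons.prems by (auto simp: geom_prog_def)
      have iL: "i \<le> L" using i(2) L by linarith
      have "int (sum_list (h # hs)) mod int p = (int h + int (sum_list hs)) mod int p" by simp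
      also have "\<dots> = (int h mod int p + int (sum_list hs) mod int p) mod int p" by (simp add: mod_add_eq)
      also have "\<dots> = (int x ^ i mod int p + poly (sum_list (map (monom 1) is)) (int x) mod int p) mod int p"
        unfolding IH(3) i(1) by (simp add: zmod_int)
      also have "\<dots> = poly (sum_list (map (monom 1) (i # is))) (int x) mod int p"
        by (simp add: mod_add_eq poly_monom)
      finally show ?case using IH iL by (intro exI[of _ "i # is"]) auto
    qed (intro exI[of _ "[]"], simp)
    then obtain "is" where i: "set is \<subseteq> {..L}" "length is = length hs"
      "int (sum_list hs) mod int p = poly (sum_list (map (monom 1) is)) (int x) mod int p" by blast
    define f where "f = sum_list (map (monom (1::int)) is)"
    have fA: "f \<in> A" unfolding A_def f_def using i hs(2) K(2) by auto
    have "sum_list hs mod p = nat y mod p" using hs(3) unfolding unique_euclidean_semiring_class.cong_def .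
    then have "int (sum_list hs mod p) = int (nat y mod p)" by (rule arg_cong)
    then have "int (sum_list hs) mod int p = int (nat y) mod int p" by (simp only: zmod_int)
    then have "y = poly f (int x) mod int p" using i(3) y by (simp add: f_def)
    also have "\<dots> = poly (red f) (int x) mod int p"
    proof -
      obtain k where "f - red f = g * k" using red(2)[of f] by (elim dvdE)
      then have "poly f (int x) - poly (red f) (int x) = poly g (int x) * poly k (int x)" by (metis poly_diff poly_mult)
      then have "int p dvd poly f (int x) - poly (red f) (int x)" using x(2) by simp
      then show ?thesis by (simp only: mod_eq_dvd_iff)
    qed
    finally show "y \<in> (\<lambda>r. poly r (int x) mod int p) ` red ` A" using fA by blast
  qed
  then have "card {0..<int p} \<le> card (red ` A)" using fin by (meson surj_card_le)
  then show False using cardA by simp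
qed

text \<open>The exponent is at most 2 C log p, so the hypothesis on \<open>msr\<close> bounds that
  power by sqrt p; the power of log p is eventually below the other factor sqrt p.\<close>

lemma eventually_few_classes:
  assumes C: "C > 1" and M: "msr powr (4 * C) \<le> 2"
  shows "\<exists>p0. \<forall>p\<ge>p0. 1 \<le> log 2 (real p) powr C \<and> (7 * (log 2 (real p) powr C)) ^ (2 * n) * msr ^ (2 * nat \<lfloor>C * log 2 (real p)\<rfloor>) < real p"
proof -
  have m1: "msr \<ge> 1" unfolding msr_def by (intro prod_ge_1) auto
  have "\<forall>\<^sub>F x::real in at_top. (7 * log 2 x powr C) ^ (2 * n) < sqrt x" using C by (intro log_power_less_sqrt) auto
  then have "\<forall>\<^sub>F p::nat in sequentially. (7 * log 2 (real p) powr C) ^ (2 * n) < sqrt (real p)"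
    using filterlim_real_sequentially unfolding filterlim_iff by blast
  then obtain p1 where p1: "\<And>p::nat. p \<ge> p1 \<Longrightarrow> (7 * log 2 (real p) powr C) ^ (2 * n) < sqrt (real p)"
    by (auto simp: eventually_sequentially)
  show ?thesis
  proof (intro exI allI impI conjI)
    fix p assume p: "p \<ge> max p1 2"
    have lp: "log 2 (real p) \<ge> 1" using p by simp
    show "1 \<le> log 2 (real p) powr C" using lp C by (simp add: ge_one_powr_ge_zero)
    define L where "L = nat \<lfloor>C * log 2 (real p)\<rfloor>"
    have "real L \<le> C * log 2 (real p)" unfolding L_def using C lp by (intro of_nat_floor) auto
    then have "msr ^ (2 * L) \<le> msr powr (2 * C * log 2 (real p))"
      using m1 by (simp add: powr_realpow[symmetric] powr_mono)
    also have "\<dots> = (msr powr (4 * C)) powr (log 2 (real p) / 2)" by (simp add: powr_powr mult.assoc)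
    also have "\<dots> \<le> 2 powr (log 2 (real p) / 2)" using M lp by (intro powr_mono2) auto
    also have "2 powr (log 2 (real p) / 2) = (2 powr log 2 (real p)) powr (1 / 2)" unfolding powr_powr by simp
    also have "\<dots> = sqrt (real p)" using p by (simp add: powr_half_sqrt)
    finally have "msr ^ (2 * L) \<le> sqrt (real p)" .
    then have "(7 * (log 2 (real p) powr C)) ^ (2 * n) * msr ^ (2 * L) \<le> (7 * (log 2 (real p) powr C)) ^ (2 * n) * sqrt (real p)"
      by (intro mult_left_mono) auto
    also have "\<dots> < sqrt (real p) * sqrt (real p)" using p1[of p] p by (intro mult_strict_right_mono) auto
    also have "\<dots> = real p" by simp
    finally show "(7 * (log 2 (real p) powr C)) ^ (2 * n) * msr ^ (2 * nat \<lfloor>C * log 2 (real p)\<rfloor>) < real p" by (simp add: L_def)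
  qed
qed

text \<open>Each multiplication by X modulo \<open>g\<close> increases the height at most by the
  factor \<open>q\<close>, so X^m - 1 is congruent to an element \<open>s\<close> of height at most
  2 q^m. The integers below its least constant are incongruent modulo an ideal containing
  \<open>s\<close>, and \<open>ideal_index_le\<close> bounds their number.\<close>

lemma least_const_power_minus_one_bound:
  assumes nr: "\<And>m. m > 0 \<Longrightarrow> \<not> g dvd monom 1 m - 1"
  shows "\<exists>c. \<forall>m>0. log 2 (real (least_const (monom 1 m - 1))) \<le> c * real m"
proof -
  define X where "X m = (monom 1 m :: int poly)" for m
  define a where "a = 1 + (\<Sum>i<n. \<bar>real_of_int (coeff (red (X 1)) i)\<bar>)"
  have a1: "a \<ge> 1" unfolding a_def by (auto intro: sum_nonneg)
  have xb: "red (X 1) \<in> box n a"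
  proof (rule boxI)
    fix i
    show "\<bar>real_of_int (coeff (red (X 1)) i)\<bar> \<le> a"
    proof (cases "i < n")
      case True
      then have "\<bar>real_of_int (coeff (red (X 1)) i)\<bar> \<le> (\<Sum>i<n. \<bar>real_of_int (coeff (red (X 1)) i)\<bar>)" by (intro member_le_sum) auto
      then show ?thesis by (simp add: a_def)
    next
      case False
      then show ?thesis using a1 red(1) by simp
    qed
  qed (use red(1) in auto)
  define q where "q = mulC * a"
  have q1: "q \<ge> 1" unfolding q_def using mult_mono[OF mulC_ge_1 a1] a1 mulC_ge_1 by simp
  have pw: "red (X m) \<in> box n (q ^ m)" for m
  proof (induction m)
    case 0
    have "red (X 0) = 1" using n_pos by (intro red_unique) (auto simp: X_def)
    then show ?case using n_pos by (auto simp: box_def)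
  next
    case (Suc m)
    have "red (X (Suc m)) = red (red (X m) * red (X 1))"
    proof -
      have "X (Suc m) - red (X m) * red (X 1) = X m * (X 1 - red (X 1)) + (X m - red (X m)) * red (X 1)"
        by (simp add: X_def algebra_simps mult_monom)
      also have "g dvd \<dots>" by (rule dvd_add[OF dvd_mult[OF red(2)] dvd_mult2[OF red(2)]])
      finally show ?thesis by (simp only: red_eq_iff)
    qed
    then have "red (X (Suc m)) \<in> box n (mulC * q ^ m * a)" using red_mult_box[OF Suc xb] by simp
    then show ?case by (simp add: q_def mult_ac)
  qed
  show ?thesis
  proof (intro exI allI impI)
    fix m :: nat assume m: "m > 0"
    define r where "r = X m - 1"
    have nd: "\<not> g dvd r" using nr[OF m] by (simp add: r_def X_def)
    define s where "s = red (X m) - 1"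
    have gr: "g dvd r - s" using red(2)[of "X m"] by (simp add: r_def s_def)
    have s0: "s \<noteq> 0" using gr nd by auto
    have sb: "s \<in> box n (2 * q ^ m)"
    proof (rule boxI)
      show "coeff s i = 0" if "i \<ge> n" for i using that red(1)[OF that] n_pos by (auto simp: s_def)
      fix i
      have "\<bar>real_of_int (coeff (red (X m)) i)\<bar> \<le> q ^ m" using pw[of m] by (auto simp: box_def)
      moreover have "q ^ m \<ge> 1" using q1 by simp
      moreover have "\<bar>real_of_int (coeff s i)\<bar> \<le> \<bar>real_of_int (coeff (red (X m)) i)\<bar> + 1"
        by (cases i) (auto simp: s_def)
      ultimately show "\<bar>real_of_int (coeff s i)\<bar> \<le> 2 * q ^ m" by linarith
    qed
    have sJ: "s \<in> gen_ideal (least_const r) r"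
    proof -
      have "r - s \<in> gen_ideal (least_const r) r" by (rule ideal_dvd[OF gen_ideal(1) gen_ideal(3) gr])
      then have "r - (r - s) \<in> gen_ideal (least_const r) r" by (rule ideal_diff[OF gen_ideal(1) gen_ideal(4)])
      then show ?thesis by simp
    qed
    note inc = incongruent_consts[of "gen_ideal (least_const r) r" "least_const r", OF const_in_gen_ideal[OF nd dvd_refl]]
    have "real (least_const r) \<le> (3 * mulC * (2 * q ^ m)) ^ n"
      using ideal_index_le[OF gen_ideal(1,3) sJ sb s0 _ inc(1)] inc(2) by simp
    moreover have "real (least_const r) > 0" using least_const(1)[OF nd] by simp
    ultimately have "log 2 (real (least_const r)) \<le> log 2 ((3 * mulC * (2 * q ^ m)) ^ n)" by simp
    also have "\<dots> = real n * (log 2 (6 * mulC) + real m * log 2 q)"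
      using mulC_ge_1 q1 by (simp add: log_nat_power log_mult algebra_simps)
    also have "\<dots> \<le> real n * (log 2 (6 * mulC) * real m + real m * log 2 q)"
    proof -
      have "log 2 (6 * mulC) \<ge> 0" using mulC_ge_1 by simp
      then have "log 2 (6 * mulC) * 1 \<le> log 2 (6 * mulC) * real m" using m by (intro mult_left_mono) auto
      then show ?thesis by (intro mult_left_mono add_right_mono) auto
    qed
    also have "\<dots> = (real n * (log 2 (6 * mulC) + log 2 q)) * real m" by (simp add: algebra_simps)
    finally show "log 2 (real (least_const (monom 1 m - 1))) \<le> (real n * (log 2 (6 * mulC) + log 2 q)) * real m"
      by (simp add: r_def X_def)
  qed
qed

text \<open>Evaluation at \<open>x\<close> modulo \<open>p\<close> kills both \<open>g\<close> and
  X^m - 1, hence every integer in the ideal that they generate.\<close>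

lemma small_order_root_dvd_least_const:
  assumes "\<not> g dvd monom 1 m - 1" "int p dvd poly g (int x)" "[x ^ m = 1] (mod p)"
  shows "p dvd least_const (monom 1 m - 1)"
proof -
  obtain b where "g dvd (monom 1 m - 1) * b - [:int (least_const (monom 1 m - 1)):]" using least_const(2)[OF assms(1)] by blast
  then obtain k where "(monom 1 m - 1) * b - [:int (least_const (monom 1 m - 1)):] = g * k" by (elim dvdE)
  then have "poly ((monom 1 m - 1) * b - [:int (least_const (monom 1 m - 1)):]) (int x) = poly (g * k) (int x)" by simp
  then have eq: "int (least_const (monom 1 m - 1)) = (int x ^ m - 1) * poly b (int x) - poly g (int x) * poly k (int x)"
    by (simp add: poly_monom algebra_simps)
  have "[int (x ^ m) = int 1] (mod int p)" using assms(3) by (simp only: cong_int_iff)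
  then have "int p dvd int x ^ m - 1" by (simp add: cong_iff_dvd_diff)
  then have "int p dvd int (least_const (monom 1 m - 1))" unfolding eq using assms(2) by simp
  then show ?thesis by simp
qed

end

lemma int_min_poly:
  assumes "algebraic \<alpha>"
  shows "irreducible (int_min_poly \<alpha>)" "lead_coeff (int_min_poly \<alpha>) > 0" "cpoly (int_min_poly \<alpha>) \<alpha> = 0"
proof -
  have "is_int_min_poly \<alpha> (int_min_poly \<alpha>)"
    unfolding int_min_poly_def by (rule theI'[OF ex1_int_min_poly[OF assms]])
  then show "irreducible (int_min_poly \<alpha>)" "lead_coeff (int_min_poly \<alpha>) > 0" "cpoly (int_min_poly \<alpha>) \<alpha> = 0"
    by (auto simp: is_int_min_poly_def)
qed

text \<open>The Mahler measure is at least the leading coefficient, so below 2 the latter must be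
  1.\<close>

lemma monic_int_min_poly:
  assumes "algebraic \<alpha>" "algebraic_mahler_measure \<alpha> < 2"
  shows "monic_irreducible (int_min_poly \<alpha>) (degree (int_min_poly \<alpha>))"
proof
  let ?g = "int_min_poly \<alpha>"
  have "1 \<le> (\<Prod>a\<leftarrow>as. max 1 (norm a))" for as :: "complex list"
  proof (induction as)
    case (Cons a as)
    then have "1 * 1 \<le> max 1 (norm a) * (\<Prod>a\<leftarrow>as. max 1 (norm a))" by (intro mult_mono) auto
    then show ?case by simp
  qed simp
  then have "norm (lead_coeff (of_int_poly ?g :: complex poly)) * 1 \<le> mahler_measure ?g"
    unfolding mahler_measure_def mahler_measure_poly_def by (intro mult_left_mono) auto
  then have "real_of_int (lead_coeff ?g) < 2"
    using assms(2) int_min_poly(2)[OF assms(1)] by (simp add: algebraic_mahler_measure_def)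
  then show "monic ?g" using int_min_poly(2)[OF assms(1)] by simp
  show "irreducible ?g" by (rule int_min_poly(1)[OF assms(1)])
qed simp

context monic_irreducible
begin

lemma root_primes_wild_or_exceptional:
  assumes C: "C > 1" and M: "msr powr (4 * C) \<le> 2" and g0: "poly g 0 \<noteq> 0"
    and nr: "\<And>m. m > 0 \<Longrightarrow> \<not> g dvd monom 1 m - 1"
  shows "\<exists>p0. \<forall>p x. prime p \<longrightarrow> p \<ge> p0 \<longrightarrow> int p dvd poly g x \<longrightarrow>
    wild C p \<or> (\<exists>m>0. real m < (log 2 (real p))\<^sup>2 \<and> p dvd least_const (monom 1 m - 1))"
proof -
  obtain p1 where p1: "\<And>p. p \<ge> p1 \<Longrightarrow> 1 \<le> log 2 (real p) powr C \<and> (7 * (log 2 (real p) powr C)) ^ (2 * n) * msr ^ (2 * nat \<lfloor>C * log 2 (real p)\<rfloor>) < real p"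
    using eventually_few_classes[OF C M] by blast
  \<comment> \<open>Beyond the absolute value of \<open>poly g 0\<close>, a prime cannot have 0 as a
    root of \<open>g\<close>, so the root is invertible and has an order.\<close>
  define p0 where "p0 = max p1 (nat \<bar>poly g 0\<bar> + 1)"
  have "wild C p \<or> (\<exists>m>0. real m < (log 2 (real p))\<^sup>2 \<and> p dvd least_const (monom 1 m - 1))"
    if p: "prime p" "p \<ge> p0" "int p dvd poly g x" for p x
  proof -
    define y where "y = nat (x mod int p)"
    have pp: "p > 0" using p(1) by (simp add: prime_gt_0_nat)
    have y: "int y = x mod int p" "y < p" using pp by (auto simp: y_def nat_less_iff)
    obtain w where w: "g = [:- x, 1:] * w + [:poly g x:]" using synthetic_div_int by blast
    have "poly g (int y) = (int y - x) * poly w (int y) + poly g x" by (subst w) (simp add: algebra_simps)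
    moreover have "int y mod int p = x mod int p" unfolding y(1) by (simp only: mod_mod_trivial)
    then have "int p dvd int y - x" by (simp only: mod_eq_dvd_iff)
    ultimately have gy: "int p dvd poly g (int y)" using p(3) by simp
    have "y \<noteq> 0"
    proof
      assume "y = 0"
      then have "int p dvd poly g 0" using gy by simp
      then have "int p \<le> \<bar>poly g 0\<bar>" using g0 by (intro zdvd_imp_le) auto
      then show False using p(2) unfolding p0_def by linarith
    qed
    then have yr: "y \<in> {1..<p}" using y by auto
    show ?thesis
    proof (cases "real (ord p y) \<ge> (log 2 (real p))\<^sup>2")
      case True
      have "p \<ge> p1" using p(2) by (simp add: p0_def)
      from wild_if_few_classes[OF p(1) yr gy True _ order_refl refl] p1[OF this] show ?thesis by blast
    next
      case False
      have nd: "\<not> p dvd y" using yr nat_dvd_not_less[of y p] by auto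
      note cop = prime_imp_coprime[OF p(1) nd]
      have "ord p y \<noteq> 0" using cop unfolding ord_eq_0 by blast
      then have "ord p y > 0" by (simp only: neq0_conv)
      moreover have "[y ^ ord p y = 1] (mod p)" by (rule ord)
      moreover have "real (ord p y) < (log 2 (real p))\<^sup>2" using False by simp
      ultimately show ?thesis using small_order_root_dvd_least_const[OF nr gy, of "ord p y"] by blast
    qed
  qed
  then show ?thesis by (intro exI[of _ p0] allI impI)
qed

end

theorem sparse_wild_imp_lehmer:
  assumes C: "C > 1" and sparse: "(\<lambda>X::real. real (card {p::nat. real p \<le> X \<and> prime p \<and> wild C p}))
       \<in> o[at_top](\<lambda>X. real (card {p::nat. real p \<le> X \<and> prime p}))"
  shows lehmer_conjecture
proof (rule ccontr)
  assume neg: "\<not> lehmer_conjecture"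
  \<comment> \<open>With this choice a Mahler measure of at most \<open>1 + c0\<close> has (4 C)-th
    power at most 2, as \<open>eventually_few_classes\<close> requires.\<close>
  define c0 :: real where "c0 = 2 powr (1 / (4 * C)) - 1"
  have "2 powr 0 < (2::real) powr (1 / (4 * C))" using C by (intro powr_less_mono) auto
  then have c0: "c0 > 0" by (simp add: c0_def)
  have "(2::real) powr (1 / (4 * C)) < 2 powr 1" using C by (intro powr_less_mono) (auto simp: field_simps)
  then have c1: "1 + c0 < 2" by (simp add: c0_def)
  obtain \<alpha> where \<alpha>: "algebraic \<alpha>" "\<alpha> \<noteq> 0" "\<not> (\<exists>n>0. \<alpha> ^ n = 1)" "\<not> algebraic_mahler_measure \<alpha> > 1 + c0"
    using neg c0 unfolding lehmer_conjecture_def by blast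
  define g where "g = int_min_poly \<alpha>"
  define n where "n = degree g"
  interpret monic_irreducible g n unfolding g_def n_def
    by (rule monic_int_min_poly) (use \<alpha> c1 in auto)
  have "cpoly g \<alpha> = 0" unfolding g_def by (rule int_min_poly(3)[OF \<alpha>(1)])
  then have \<alpha>r: "\<alpha> \<in> roots" by (simp add: roots_def)
  have "msr \<le> 1 + c0" using \<alpha>(4) mahler_g by (simp add: algebraic_mahler_measure_def g_def[symmetric] msr_def)
  moreover have "msr \<ge> 1" unfolding msr_def by (intro prod_ge_1) auto
  ultimately have "msr powr (4 * C) \<le> (1 + c0) powr (4 * C)" using C by (intro powr_mono2) auto
  also have "\<dots> = 2" using C by (simp add: c0_def powr_powr)
  finally have M: "msr powr (4 * C) \<le> 2" .
  have g0: "poly g 0 \<noteq> 0"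
  proof
    assume "poly g 0 = 0"
    then have "[:0, 1:] dvd g" using poly_eq_0_iff_dvd[of g 0] by simp
    then obtain k where k: "g = [:0, 1:] * k" by (elim dvdE)
    have "cpoly g \<alpha> = 0" using \<alpha>r by (simp add: roots_def)
    then have "cpoly k \<alpha> = 0" using \<alpha>(2) unfolding k by (simp add: hom_distribs)
    then have "g dvd k" by (rule root_imp_dvd[OF \<alpha>r])
    moreover have "k \<noteq> 0" using k g_nonzero by auto
    ultimately have "degree g \<le> degree k" by (rule dvd_imp_degree_le)
    moreover have "degree g = Suc (degree k)" using k \<open>k \<noteq> 0\<close> by (simp add: degree_mult_eq)
    ultimately show False by simp
  qed
  have nr: "\<not> g dvd monom 1 m - 1" if "m > 0" for m
  proof
    assume "g dvd monom 1 m - 1"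
    then have "cpoly (monom 1 m - 1) \<alpha> = 0" by (rule dvd_imp_roots[OF _ \<alpha>r])
    then have "\<alpha> ^ m = 1" by (simp add: poly_monom)
    then show False using \<alpha>(3) that by blast
  qed
  define R where "R m = least_const (monom 1 m - 1)" for m
  obtain cR where cR: "\<And>m. m > 0 \<Longrightarrow> log 2 (real (R m)) \<le> cR * real m"
    using least_const_power_minus_one_bound[OF nr] unfolding R_def by blast
  have R0: "R m > 0" if "m > 0" for m unfolding R_def by (rule least_const(1)[OF nr[OF that]])
  define Ex where "Ex p \<longleftrightarrow> (\<exists>m>0. real m < (log 2 (real p))\<^sup>2 \<and> p dvd R m)" for p
  obtain K1 where K1: "\<And>N. (\<Sum>p | prime p \<and> p \<le> N \<and> Ex p. ln (real p) / real p) \<le> K1"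
    using exceptional_primes_sum[of R cR, OF R0 cR] unfolding Ex_def by blast
  obtain p0 where p0: "\<And>p x. prime p \<Longrightarrow> p \<ge> p0 \<Longrightarrow> int p dvd poly g x \<Longrightarrow> wild C p \<or> Ex p"
    using root_primes_wild_or_exceptional[OF C M g0 nr] unfolding Ex_def R_def by blast
  obtain c \<kappa> where c: "c > 0" and \<kappa>: "\<kappa> \<ge> 1" and dens: "\<forall>\<^sub>F B in sequentially. c * ln (real B) \<le>
     (\<Sum>p | prime p \<and> real p \<le> (\<kappa> * real B) ^ n \<and> (\<exists>x. int p dvd poly g x). ln (real p) / real p)"
    using root_primes_density by blast
  \<comment> \<open>Since 2 \<epsilon> n = c / 2, the wild primes up to (\<kappa> B)^n account for
    only half of c ln B, up to a constant.\<close>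
  define \<epsilon> where "\<epsilon> = c / (4 * real n)"
  have \<epsilon>: "\<epsilon> > 0" using c n_pos by (simp add: \<epsilon>_def)
  define W where "W = {p. prime p \<and> wild C p}"
  have "\<forall>\<^sub>F X in at_top. norm (real (card {p::nat. real p \<le> X \<and> prime p \<and> wild C p})) \<le> \<epsilon> * norm (real (card {p::nat. real p \<le> X \<and> prime p}))"
    by (rule landau_o.smallD[OF sparse \<epsilon>])
  then have "\<forall>\<^sub>F t::nat in sequentially. norm (real (card {p::nat. real p \<le> real t \<and> prime p \<and> wild C p})) \<le> \<epsilon> * norm (real (card {p::nat. real p \<le> real t \<and> prime p}))"
    using filterlim_real_sequentially unfolding filterlim_iff by blast
  then obtain t0 where t0: "\<And>t::nat. t \<ge> t0 \<Longrightarrow> norm (real (card {p::nat. real p \<le> real t \<and> prime p \<and> wild C p})) \<le> \<epsilon> * norm (real (card {p::nat. real p \<le> real t \<and> prime p}))"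
    unfolding eventually_sequentially by blast
  have "real (card {p \<in> W. p \<le> t}) \<le> \<epsilon> * real (card {p. prime p \<and> p \<le> t})" if "t \<ge> t0" for t
  proof -
    have "{p::nat. real p \<le> real t \<and> prime p \<and> wild C p} = {p \<in> W. p \<le> t}" "{p::nat. real p \<le> real t \<and> prime p} = {p. prime p \<and> p \<le> t}"
      by (auto simp: W_def)
    then show ?thesis using t0[OF that] by simp
  qed
  from sparse_primes_sum[of W \<epsilon> t0, OF _ \<epsilon> this]
  obtain K2 where K2: "\<And>N. N > 0 \<Longrightarrow> (\<Sum>p | p \<in> W \<and> p \<le> N. ln (real p) / real p) \<le> 2 * \<epsilon> * ln (real N) + K2"
    by (auto simp: W_def)
  define K0 where "K0 = (\<Sum>p\<in>{..<p0}. ln (real p) / real p)"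
  have nn: "0 \<le> ln (real p) / real p" for p :: nat using ln_ratio_nonneg[of p] by (simp add: ln_ratio_def)
  have upper: "(\<Sum>p | prime p \<and> real p \<le> (\<kappa> * real B) ^ n \<and> (\<exists>x. int p dvd poly g x). ln (real p) / real p)
     \<le> K0 + K1 + K2 + 2 * \<epsilon> * (real n * ln (\<kappa> * real B))" if B: "B > 0" for B
  proof -
    define N where "N = nat \<lfloor>(\<kappa> * real B) ^ n\<rfloor>"
    have kB: "\<kappa> * real B \<ge> 1" using \<kappa> B mult_mono[of 1 \<kappa> 1 "real B"] by simp
    have N0: "N > 0" using one_le_power[OF kB, of n] unfolding N_def by linarith
    have "real N \<le> (\<kappa> * real B) ^ n" unfolding N_def using kB by (intro of_nat_floor) auto
    then have "ln (real N) \<le> ln ((\<kappa> * real B) ^ n)" using N0 by (intro ln_mono) auto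
    then have lnN: "ln (real N) \<le> real n * ln (\<kappa> * real B)" using kB by (simp add: ln_realpow)
    let ?S1 = "{..<p0}" and ?S2 = "{p. prime p \<and> p \<le> N \<and> Ex p}" and ?S3 = "{p. p \<in> W \<and> p \<le> N}"
    have fin: "finite ?S2" "finite ?S3" by (auto intro: finite_subset[of _ "{..N}"])
    have "(\<Sum>p | prime p \<and> real p \<le> (\<kappa> * real B) ^ n \<and> (\<exists>x. int p dvd poly g x). ln (real p) / real p)
      \<le> (\<Sum>p\<in>?S1 \<union> (?S2 \<union> ?S3). ln (real p) / real p)"
    proof (rule sum_mono2)
      show "{p. prime p \<and> real p \<le> (\<kappa> * real B) ^ n \<and> (\<exists>x. int p dvd poly g x)} \<subseteq> ?S1 \<union> (?S2 \<union> ?S3)"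
      proof
        fix p assume "p \<in> {p. prime p \<and> real p \<le> (\<kappa> * real B) ^ n \<and> (\<exists>x. int p dvd poly g x)}"
        then obtain x where p: "prime p" "real p \<le> (\<kappa> * real B) ^ n" "int p dvd poly g x" by auto
        have "p \<le> N" unfolding N_def using p(2) by (simp add: le_nat_floor)
        then show "p \<in> ?S1 \<union> (?S2 \<union> ?S3)" using p0[OF p(1) _ p(3)] p(1) by (cases "p < p0") (auto simp: W_def)
      qed
    qed (use fin nn in auto)
    also have "\<dots> \<le> K0 + ((\<Sum>p\<in>?S2. ln (real p) / real p) + (\<Sum>p\<in>?S3. ln (real p) / real p))"
    proof -
      have sU: "sum f (A \<union> B) \<le> sum f A + sum f B" if "finite A" "finite B" "\<And>x. f x \<ge> (0::real)" for f :: "nat \<Rightarrow> real" and A B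
        using sum_Un[OF that(1,2), of f] sum_nonneg[of "A \<inter> B" f] that(3) by simp
      show ?thesis unfolding K0_def
        using sU[of ?S1 "?S2 \<union> ?S3" "\<lambda>p. ln (real p) / real p"] sU[of ?S2 ?S3 "\<lambda>p. ln (real p) / real p"] fin nn by force
    qed
    also have "\<dots> \<le> K0 + (K1 + (2 * \<epsilon> * ln (real N) + K2))"
      by (intro add_mono K1 K2 N0) simp
    also have "2 * \<epsilon> * ln (real N) \<le> 2 * \<epsilon> * (real n * ln (\<kappa> * real B))" using lnN \<epsilon> by (intro mult_left_mono) auto
    finally show ?thesis by simp
  qed
  have "\<forall>\<^sub>F B::nat in sequentially. c / 2 * ln (real B) > K0 + K1 + K2 + c / 2 * ln \<kappa>"
    using c by real_asymp
  then have "\<forall>\<^sub>F B::nat in sequentially. False"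
    using dens eventually_gt_at_top[of 0]
  proof eventually_elim
    case (elim B)
    have "c * ln (real B) \<le> K0 + K1 + K2 + 2 * \<epsilon> * (real n * ln (\<kappa> * real B))" using elim(2) upper[OF elim(3)] by linarith
    also have "2 * \<epsilon> * (real n * ln (\<kappa> * real B)) = c / 2 * (ln \<kappa> + ln (real B))"
      using n_pos \<kappa> elim(3) by (simp add: \<epsilon>_def ln_mult_pos)
    finally show False using elim(1) by (simp add: algebra_simps)
  qed
  then show False by simp
qed

section \<open>Growth of the number of values\<close>

abbreviation rpoly :: "int poly \<Rightarrow> real poly" where "rpoly \<equiv> of_int_poly"

lemma map_poly_of_real_mult:
  "map_poly complex_of_real (f * h) = map_poly of_real f * map_poly of_real h"
  by (intro poly_eqI) (simp add: coeff_map_poly coeff_mult)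

text \<open>Long division by \<open>P\<close> that removes only a fractional part of each top
  coefficient. As \<open>P\<close> has leading coefficient 1 or -1, a multiple with factor
  \<open>c\<close> in [0, 1) of a shifted \<open>P\<close> leaves an integer there, which is set
  aside as \<open>monom b l\<close>.\<close>

lemma round_high_coeffs:
  fixes P :: "int poly" and t :: "real poly"
  assumes lc: "lead_coeff P = 1 \<or> lead_coeff P = -1" and t: "\<And>i. i \<ge> l \<Longrightarrow> coeff t i = 0"
  shows "\<exists>q. (\<forall>i. 0 \<le> coeff q i \<and> coeff q i < 1) \<and> (\<forall>i. i + degree P \<ge> l \<longrightarrow> coeff q i = 0)
     \<and> (\<forall>i\<ge>degree P. coeff (t - q * rpoly P) i \<in> \<int>)"
  using t
proof (induction l arbitrary: t)
  case 0
  then show ?case by (intro exI[of _ 0]) auto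
next
  case (Suc l)
  let ?d = "degree P"
  show ?case
  proof (cases "l \<ge> ?d")
    case False
    have "coeff t i = 0" if "i \<ge> ?d" for i using Suc.prems[of i] that False by simp
    then show ?thesis by (intro exI[of _ 0]) auto
  next
    case True
    define \<epsilon> where "\<epsilon> = real_of_int (lead_coeff P)"
    have \<epsilon>: "\<epsilon> * \<epsilon> = 1" "\<epsilon> \<in> \<int>" using lc by (auto simp: \<epsilon>_def)
    define a where "a = coeff t l"
    define c where "c = frac (a * \<epsilon>)"
    define b where "b = a - c * \<epsilon>"
    have b: "b = real_of_int \<lfloor>a * \<epsilon>\<rfloor> * \<epsilon>"
    proof -
      have "b = (a * \<epsilon> - c) * \<epsilon>" using \<epsilon>(1) by (simp add: b_def algebra_simps)
      then show ?thesis by (simp add: c_def frac_def)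
    qed
    have bZ: "b \<in> \<int>" unfolding b by (intro Ints_mult \<epsilon>) auto
    have c01: "0 \<le> c" "c < 1" by (auto simp: c_def frac_ge_0 frac_lt_1)
    define m where "m = monom c (l - ?d)"
    have cm: "coeff (m * rpoly P) i = (if i < l - ?d then 0 else c * real_of_int (coeff P (i - (l - ?d))))" for i
      by (simp add: m_def coeff_monom_mult)
    define t1 where "t1 = t - m * rpoly P - monom b l"
    have "coeff t1 i = 0" if i: "i \<ge> l" for i
    proof (cases "i = l")
      case True
      have "coeff (m * rpoly P) l = c * \<epsilon>" using cm[of l] \<open>l \<ge> ?d\<close> by (simp add: \<epsilon>_def)
      then show ?thesis using True by (simp add: t1_def a_def b_def)
    next
      case False
      then have "coeff P (i - (l - ?d)) = 0" using i \<open>l \<ge> ?d\<close> by (intro coeff_eq_0) auto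
      then show ?thesis using Suc.prems[of i] i False cm[of i] by (simp add: t1_def)
    qed
    from Suc.IH[OF this] obtain q1 where q1: "\<And>i. 0 \<le> coeff q1 i \<and> coeff q1 i < 1"
      "\<And>i. i + ?d \<ge> l \<Longrightarrow> coeff q1 i = 0" "\<And>i. i \<ge> ?d \<Longrightarrow> coeff (t1 - q1 * rpoly P) i \<in> \<int>" by blast
    have cq: "coeff (q1 + m) i = (if i = l - ?d then c else coeff q1 i)" for i
      using q1(2)[of "l - ?d"] True by (simp add: m_def)
    show ?thesis
    proof (intro exI[of _ "q1 + m"] conjI allI impI)
      fix i
      show "0 \<le> coeff (q1 + m) i" "coeff (q1 + m) i < 1" using q1(1)[of i] c01 unfolding cq by auto
      show "coeff (q1 + m) i = 0" if "Suc l \<le> i + ?d"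
        using q1(2)[of i] that True unfolding cq by auto
      show "coeff (t - (q1 + m) * rpoly P) i \<in> \<int>" if "i \<ge> ?d"
      proof -
        have "t - (q1 + m) * rpoly P = (t1 - q1 * rpoly P) + monom b l" by (simp add: t1_def algebra_simps)
        then have "coeff (t - (q1 + m) * rpoly P) i = coeff (t1 - q1 * rpoly P) i + (if i = l then b else 0)" by simp
        then show ?thesis using q1(3)[OF that] bZ by auto
      qed
    qed
  qed
qed

text \<open>Up to a real multiple of \<open>P\<close>, which is invisible at the roots of
  \<open>P\<close>, the polynomial \<open>t\<close> is integral apart from a fractional part
  \<open>s\<close> of bounded length. Each coefficient of the multiple is a sum of at most
  \<open>degree P + 1\<close> terms of absolute value at most 1, and that of \<open>t\<close> adds
  another 1; hence the bound \<open>degree P + 2\<close>.\<close>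

lemma round_poly:
  fixes P :: "int poly" and t :: "real poly"
  assumes lc: "lead_coeff P = 1 \<or> lead_coeff P = -1" and P1: "\<And>i. \<bar>coeff P i\<bar> \<le> 1"
    and t0: "\<And>i. i \<ge> l \<Longrightarrow> coeff t i = 0" and t1: "\<And>i. \<bar>coeff t i\<bar> \<le> 1" and l: "l \<ge> degree P"
  shows "\<exists>G s. G \<in> box l (real (degree P + 2)) \<and> (\<forall>i\<ge>degree P. coeff s i = 0) \<and> (\<forall>i. 0 \<le> coeff s i \<and> coeff s i \<le> 1)
     \<and> (\<exists>q. t = q * rpoly P + rpoly G + s)"
proof -
  let ?d = "degree P"
  obtain q where q: "\<And>i. 0 \<le> coeff q i \<and> coeff q i < 1" "\<And>i. i + ?d \<ge> l \<Longrightarrow> coeff q i = 0"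
    "\<And>i. i \<ge> ?d \<Longrightarrow> coeff (t - q * rpoly P) i \<in> \<int>"
    using round_high_coeffs[OF lc t0] by blast
  define u where "u = t - q * rpoly P"
  define G where "G = map_poly floor u"
  define s where "s = map_poly frac u"
  have cG: "coeff G i = \<lfloor>coeff u i\<rfloor>" and cs: "coeff s i = frac (coeff u i)" for i
    by (simp_all add: G_def s_def coeff_map_poly)
  have qP: "coeff (q * rpoly P) i = (\<Sum>j\<le>i. real_of_int (coeff P j) * coeff q (i - j))" for i
    by (subst mult.commute) (simp add: coeff_mult)
  have qb: "\<bar>coeff (q * rpoly P) i\<bar> \<le> real (?d + 1)" for i
  proof -
    have "\<bar>coeff (q * rpoly P) i\<bar> \<le> (\<Sum>j\<le>i. \<bar>real_of_int (coeff P j) * coeff q (i - j)\<bar>)"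
      unfolding qP by (rule sum_abs)
    also have "\<dots> \<le> (\<Sum>j\<le>i. if j \<le> ?d then 1 else 0)"
    proof (rule sum_mono)
      fix j
      have "\<bar>real_of_int (coeff P j)\<bar> \<le> 1" using P1[of j] by linarith
      moreover have "\<bar>coeff q (i - j)\<bar> \<le> 1" using q(1)[of "i - j"] by simp
      ultimately have "\<bar>real_of_int (coeff P j) * coeff q (i - j)\<bar> \<le> 1 * 1" unfolding abs_mult by (intro mult_mono) auto
      then show "\<bar>real_of_int (coeff P j) * coeff q (i - j)\<bar> \<le> (if j \<le> ?d then 1 else 0)"
        by (auto simp: coeff_eq_0)
    qed
    also have "\<dots> = real (card {j \<in> {..i}. j \<le> ?d})" by (simp add: sum.If_cases Int_def)
    also have "card {j \<in> {..i}. j \<le> ?d} \<le> card {..?d}" by (intro card_mono) auto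
    finally show ?thesis by simp
  qed
  have ub: "\<bar>coeff u i\<bar> \<le> real (?d + 2)" for i
  proof -
    have "coeff u i = coeff t i - coeff (q * rpoly P) i" by (simp only: u_def coeff_diff)
    then have "\<bar>coeff u i\<bar> \<le> \<bar>coeff t i\<bar> + \<bar>coeff (q * rpoly P) i\<bar>" by linarith
    then show ?thesis using t1[of i] qb[of i] by simp
  qed
  have u0: "coeff u i = 0" if "i \<ge> l" for i
  proof -
    have "coeff (q * rpoly P) i = 0" unfolding qP
    proof (rule sum.neutral, rule ballI)
      fix j assume "j \<in> {..i}"
      show "real_of_int (coeff P j) * coeff q (i - j) = 0"
      proof (cases "j \<le> ?d")
        case True
        then have "(i - j) + ?d \<ge> l" using that by simp
        then show ?thesis using q(2) by simp
      qed (simp add: coeff_eq_0)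
    qed
    then show ?thesis using t0[OF that] by (simp add: u_def)
  qed
  have "G \<in> box l (real (?d + 2))"
  proof (rule boxI)
    fix i
    have "- real_of_int (int (?d + 2)) \<le> coeff u i" "coeff u i \<le> real_of_int (int (?d + 2))" using ub[of i] by auto
    then have "- int (?d + 2) \<le> \<lfloor>coeff u i\<rfloor>" "\<lfloor>coeff u i\<rfloor> \<le> int (?d + 2)" by linarith+
    then have "\<bar>coeff G i\<bar> \<le> int (?d + 2)" unfolding cG by linarith
    then have "real_of_int \<bar>coeff G i\<bar> \<le> real_of_int (int (?d + 2))" by (simp only: of_int_le_iff)
    then show "\<bar>real_of_int (coeff G i)\<bar> \<le> real (?d + 2)" by simp
  qed (simp add: cG u0)
  moreover have "\<forall>i\<ge>?d. coeff s i = 0" using q(3) by (simp add: cs u_def)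
  moreover have "\<forall>i. 0 \<le> coeff s i \<and> coeff s i \<le> 1" by (auto simp: cs frac_ge_0 less_imp_le[OF frac_lt_1])
  moreover have "t = q * rpoly P + rpoly G + s"
  proof -
    have "u = rpoly G + s" by (intro poly_eqI) (simp add: cG cs frac_def)
    then show ?thesis by (simp add: u_def algebra_simps)
  qed
  ultimately show ?thesis by blast
qed

context monic_irreducible
begin

text \<open>Cutting a polynomial at degree \<open>D\<close> shows that its class is determined by
  the classes of the two pieces.\<close>

lemma card_red_box_add:
  assumes k: "k \<ge> 0"
  shows "card (red ` box (D + D') k) \<le> card (red ` box D k) * card (red ` box D' k)"
proof -
  define h where "h = (\<lambda>(a, b). red (a + monom 1 D * b))"
  have fin: "finite (box D k)" "finite (box D' k)" using card_box[OF k] by auto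
  have "red ` box (D + D') k \<subseteq> h ` (red ` box D k \<times> red ` box D' k)"
  proof (rule image_subsetI)
    fix f assume f: "f \<in> box (D + D') k"
    define f1 where "f1 = poly_cutoff D f"
    define f2 where "f2 = poly_shift D f"
    have eq: "f = f1 + monom 1 D * f2"
      by (intro poly_eqI) (auto simp: f1_def f2_def coeff_poly_cutoff coeff_poly_shift coeff_monom_mult)
    have f12: "f1 \<in> box D k" "f2 \<in> box D' k"
      using f k by (auto simp: f1_def f2_def box_def coeff_poly_cutoff coeff_poly_shift)
    have "g dvd (f1 - red f1) + monom 1 D * (f2 - red f2)"
      by (rule dvd_add[OF red(2) dvd_mult[OF red(2)]])
    also have "(f1 - red f1) + monom 1 D * (f2 - red f2) = f - (red f1 + monom 1 D * red f2)"
      by (subst eq) (simp add: algebra_simps)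
    finally have "red f = h (red f1, red f2)" unfolding h_def by (simp add: red_eq_iff)
    then show "red f \<in> h ` (red ` box D k \<times> red ` box D' k)" using f12 by blast
  qed
  then have "card (red ` box (D + D') k) \<le> card (h ` (red ` box D k \<times> red ` box D' k))"
    using fin by (intro card_mono) auto
  also have "\<dots> \<le> card (red ` box D k \<times> red ` box D' k)" using fin by (intro card_image_le) auto
  finally show ?thesis by (simp add: card_cartesian_product)
qed

lemma card_red_box_mult:
  assumes k: "k \<ge> 0"
  shows "card (red ` box (j * D) k) \<le> card (red ` box D k) ^ j"
proof (induction j)
  case 0
  have "box 0 k \<subseteq> {0}" by (auto simp: box_def poly_eq_iff)
  then have "card (red ` box 0 k) \<le> card {red 0}" by (intro card_mono) auto
  then show ?case by simp
next
  case (Suc j)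
  have "card (red ` box (D + j * D) k) \<le> card (red ` box D k) * card (red ` box (j * D) k)"
    by (rule card_red_box_add[OF k])
  also have "\<dots> \<le> card (red ` box D k) * card (red ` box D k) ^ j" using Suc by (intro mult_left_mono) auto
  finally show ?case by simp
qed

text \<open>At the conjugates z outside the unit circle, prescribe values 3 \<beta> a(z) with
  integers a(z). Interpolation realizes them by a polynomial of length \<open>l\<close> with complex
  coefficients of modulus at most 1. Its real and imaginary parts are rounded by
  \<open>round_poly\<close>; the total error at each z is at most \<beta>, because \<open>P\<close>
  vanishes there. Values 3 \<beta> apart are still distinguished by the pair of rounded classes,
  whence the square, and the number of choices is at least a constant times
  \<open>msr ^ l\<close>.\<close>

lemma expansion_asymptotic:
  assumes P: "g dvd P" and lc: "lead_coeff P = 1 \<or> lead_coeff P = -1" and P1: "\<And>i. \<bar>coeff P i\<bar> \<le> 1"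
  shows "\<exists>c>0. \<exists>l0. \<forall>l\<ge>l0. c * msr ^ l \<le> real (card (red ` box l (real (degree P + 2)))) ^ 2"
proof -
  let ?d = "degree P"
  let ?k = "real (?d + 2)"
  define E where "E = {z \<in> roots. norm z > 1}"
  define e where "e = card E"
  have finE: "finite E" using finite_roots by (simp add: E_def)
  have msrE: "msr = (\<Prod>z\<in>E. norm z)"
  proof -
    have "(\<Prod>z\<in>E. norm z) = (\<Prod>z\<in>E. max 1 (norm z))" by (intro prod.cong) (auto simp: E_def)
    also have "\<dots> = msr" unfolding msr_def by (rule prod.mono_neutral_left) (use finite_roots in \<open>auto simp: E_def\<close>)
    finally show ?thesis by simp
  qed
  have msr1: "msr \<ge> 1" unfolding msr_def by (intro prod_ge_1) auto
  obtain \<Lambda> where \<Lambda>: "\<Lambda> > 0" and lag: "\<And>w B. B \<ge> 0 \<Longrightarrow> (\<forall>e\<in>E. norm (w e) \<le> B) \<Longrightarrow>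
     (\<exists>c::complex poly. (\<forall>i\<ge>card E. coeff c i = 0) \<and> (\<forall>e\<in>E. poly c e = w e) \<and> (\<forall>i. norm (coeff c i) \<le> \<Lambda> * B))"
    using lagrange_interpolation[OF finE] by blast
  define \<tau> where "\<tau> = 1 / \<Lambda>"
  have \<tau>: "\<tau> > 0" "\<Lambda> * \<tau> = 1" using \<Lambda> by (auto simp: \<tau>_def)
  define \<beta> where "\<beta> = 1 + 2 * (\<Sum>z\<in>E. \<Sum>i<?d. norm z ^ i)"
  have \<beta>: "\<beta> > 0" unfolding \<beta>_def by (intro add_pos_nonneg mult_nonneg_nonneg sum_nonneg) auto
  have \<beta>z: "2 * (\<Sum>i<?d. norm z ^ i) \<le> \<beta>" if "z \<in> E" for z
  proof -
    have "(\<Sum>i<?d. norm z ^ i) \<le> (\<Sum>z\<in>E. \<Sum>i<?d. norm z ^ i)"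
      by (rule member_le_sum[of z E "\<lambda>z. \<Sum>i<?d. norm z ^ i"]) (use that finE in \<open>auto intro: sum_nonneg\<close>)
    then show ?thesis by (simp add: \<beta>_def)
  qed
  define c where "c = (\<tau> / (3 * \<beta>)) ^ e / msr ^ e"
  have c0: "c > 0" using \<tau> \<beta> msr1 by (simp add: c_def)
  have main: "c * msr ^ l \<le> real (card (red ` box l ?k)) ^ 2" if l: "l \<ge> max e ?d" for l
  proof -
    \<comment> \<open>For a(z) below this bound, the prescribed value divided by z^(l - e) has
      modulus at most \<tau>, so the interpolation coefficients are at most
      \<open>\<Lambda> * \<tau> = 1\<close>.\<close>
    define A where "A z = nat \<lfloor>\<tau> * norm z ^ (l - e) / (3 * \<beta>)\<rfloor> + 1" for z :: complex
    define S where "S = PiE E (\<lambda>z. {..<A z})"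
    have finS: "finite S" unfolding S_def using finE by (intro finite_PiE) auto
    have ex: "\<exists>G1 G2. G1 \<in> box l ?k \<and> G2 \<in> box l ?k \<and>
       (\<forall>z\<in>E. norm (of_real (3 * \<beta> * real (a z)) - (cpoly G1 z + \<i> * cpoly G2 z)) \<le> \<beta>)" if a: "a \<in> S" for a
    proof -
      define w where "w z = of_real (3 * \<beta> * real (a z)) / z ^ (l - e)" for z :: complex
      have "norm (w z) \<le> \<tau>" if z: "z \<in> E" for z
      proof -
        have y0: "0 \<le> \<tau> * norm z ^ (l - e) / (3 * \<beta>)" using \<tau> \<beta> by simp
        have "a z \<in> {..<A z}" using a z unfolding S_def by (rule PiE_mem)
        then have "real (a z) \<le> real (nat \<lfloor>\<tau> * norm z ^ (l - e) / (3 * \<beta>)\<rfloor>)" by (simp add: A_def)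
        also have "\<dots> \<le> \<tau> * norm z ^ (l - e) / (3 * \<beta>)" by (rule of_nat_floor[OF y0])
        finally have "real (a z) \<le> \<tau> * norm z ^ (l - e) / (3 * \<beta>)" .
        then have "3 * \<beta> * real (a z) \<le> \<tau> * norm z ^ (l - e)" using \<beta> by (simp add: field_simps)
        moreover have "norm z > 0" using z by (auto simp: E_def)
        ultimately show ?thesis using \<beta> by (simp add: w_def norm_divide norm_mult norm_power field_simps)
      qed
      then obtain cc :: "complex poly" where cc: "\<forall>i\<ge>card E. coeff cc i = 0" "\<forall>z\<in>E. poly cc z = w z" "\<forall>i. norm (coeff cc i) \<le> \<Lambda> * \<tau>"
        using lag[of \<tau> w] \<tau> by auto
      \<comment> \<open>Only the top \<open>e\<close> coefficients of the length \<open>l\<close>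
        are used; the factor z^(l - e) then supplies the large values.\<close>
      define t where "t = monom 1 (l - e) * cc"
      have tc: "coeff t i = (if i < l - e then 0 else coeff cc (i - (l - e)))" for i
        by (simp add: t_def coeff_monom_mult)
      have t1: "norm (coeff t i) \<le> 1" for i using cc(3) \<tau> by (simp add: tc)
      have t0: "coeff t i = 0" if "i \<ge> l" for i using cc(1) that l by (simp add: tc e_def)
      define tr where "tr = map_poly Re t"
      define ti where "ti = map_poly Im t"
      have ctr: "coeff tr i = Re (coeff t i)" and cti: "coeff ti i = Im (coeff t i)" for i
        by (simp_all add: tr_def ti_def coeff_map_poly)
      have split: "t = map_poly of_real tr + smult \<i> (map_poly of_real ti)"
        by (intro poly_eqI) (simp add: ctr cti coeff_map_poly complex_eq_iff)
      have bound: "\<exists>G. G \<in> box l ?k \<and> (\<forall>z\<in>E. norm (poly (map_poly of_real r) z - cpoly G z) \<le> (\<Sum>i<?d. norm z ^ i))"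
        if r: "\<And>i. i \<ge> l \<Longrightarrow> coeff r i = 0" "\<And>i. \<bar>coeff r i\<bar> \<le> 1" for r :: "real poly"
      proof -
        obtain G s q where G: "G \<in> box l ?k" and s: "\<And>i. i \<ge> ?d \<Longrightarrow> coeff s i = 0" "\<And>i. 0 \<le> coeff s i \<and> coeff s i \<le> 1"
          and eq: "r = q * rpoly P + rpoly G + s"
          using round_poly[OF lc P1 r] l by (metis max.bounded_iff)
        have "norm (poly (map_poly of_real r) z - cpoly G z) \<le> (\<Sum>i<?d. norm z ^ i)" if z: "z \<in> E" for z
        proof -
          have zr: "z \<in> roots" using z by (simp add: E_def)
          have comp: "map_poly complex_of_real (rpoly f) = of_int_poly f" for f
            by (intro poly_eqI) (simp add: coeff_map_poly)
          have "map_poly complex_of_real r = map_poly of_real q * of_int_poly P + of_int_poly G + map_poly of_real s"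
            unfolding eq by (simp add: comp hom_distribs map_poly_of_real_mult)
          then have "poly (map_poly of_real r) z - cpoly G z = poly (map_poly of_real s) z"
            using dvd_imp_roots[OF P zr] by simp
          also have "poly (map_poly complex_of_real s) z = (\<Sum>i\<le>degree (map_poly complex_of_real s). coeff (map_poly complex_of_real s) i * z ^ i)"
            by (rule poly_altdef)
          also have "\<dots> = (\<Sum>i<?d. of_real (coeff s i) * z ^ i)"
          proof -
            have "(\<Sum>i\<le>degree (map_poly complex_of_real s). coeff (map_poly complex_of_real s) i * z ^ i)
               = (\<Sum>i\<in>{..degree (map_poly complex_of_real s)} \<union> {..<?d}. coeff (map_poly complex_of_real s) i * z ^ i)"
              by (rule sum.mono_neutral_left) (auto simp: coeff_eq_0)
            also have "\<dots> = (\<Sum>i<?d. coeff (map_poly complex_of_real s) i * z ^ i)"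
              by (rule sum.mono_neutral_right) (use s(1) in \<open>auto simp: coeff_map_poly\<close>)
            finally show ?thesis by (simp add: coeff_map_poly)
          qed
          finally have "norm (poly (map_poly of_real r) z - cpoly G z) \<le> (\<Sum>i<?d. norm (of_real (coeff s i) * z ^ i))"
            by (simp only: norm_sum)
          also have "\<dots> \<le> (\<Sum>i<?d. 1 * norm z ^ i)"
            unfolding norm_mult norm_power using s(2) by (intro sum_mono mult_right_mono) auto
          finally show ?thesis by simp
        qed
        then show ?thesis using G by blast
      qed
      have r1: "\<bar>coeff tr i\<bar> \<le> 1" "\<bar>coeff ti i\<bar> \<le> 1" for i
        using t1[of i] abs_Re_le_cmod[of "coeff t i"] abs_Im_le_cmod[of "coeff t i"] unfolding ctr cti by linarith+
      have r0: "coeff tr i = 0" "coeff ti i = 0" if "i \<ge> l" for i using t0[OF that] by (simp_all add: ctr cti)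
      obtain G1 where G1: "G1 \<in> box l ?k" "\<And>z. z \<in> E \<Longrightarrow> norm (poly (map_poly of_real tr) z - cpoly G1 z) \<le> (\<Sum>i<?d. norm z ^ i)"
        using bound[OF r0(1) r1(1)] by blast
      obtain G2 where G2: "G2 \<in> box l ?k" "\<And>z. z \<in> E \<Longrightarrow> norm (poly (map_poly of_real ti) z - cpoly G2 z) \<le> (\<Sum>i<?d. norm z ^ i)"
        using bound[OF r0(2) r1(2)] by blast
      have "norm (of_real (3 * \<beta> * real (a z)) - (cpoly G1 z + \<i> * cpoly G2 z)) \<le> \<beta>" if z: "z \<in> E" for z
      proof -
        have z0: "z \<noteq> 0" using z by (auto simp: E_def)
        have "poly t z = z ^ (l - e) * w z" using cc(2) z by (simp add: t_def poly_monom)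
        also have "\<dots> = of_real (3 * \<beta> * real (a z))" using z0 by (simp add: w_def)
        finally have tz0: "poly t z = of_real (3 * \<beta> * real (a z))" .
        have "poly t z = poly (map_poly of_real tr + smult \<i> (map_poly of_real ti)) z" using split by (rule arg_cong)
        then have tz: "of_real (3 * \<beta> * real (a z)) = poly (map_poly of_real tr) z + \<i> * poly (map_poly of_real ti) z"
          unfolding tz0 by simp
        have "of_real (3 * \<beta> * real (a z)) - (cpoly G1 z + \<i> * cpoly G2 z)
           = (poly (map_poly of_real tr) z - cpoly G1 z) + \<i> * (poly (map_poly of_real ti) z - cpoly G2 z)"
          unfolding tz by (simp add: algebra_simps)
        also have "norm \<dots> \<le> norm (poly (map_poly of_real tr) z - cpoly G1 z) + norm (\<i> * (poly (map_poly of_real ti) z - cpoly G2 z))"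
          by (rule norm_triangle_ineq)
        also have "\<dots> \<le> (\<Sum>i<?d. norm z ^ i) + (\<Sum>i<?d. norm z ^ i)"
          using G1(2)[OF z] G2(2)[OF z] by (simp add: norm_mult)
        also have "\<dots> \<le> \<beta>" using \<beta>z[OF z] by simp
        finally show ?thesis .
      qed
      then show ?thesis using G1(1) G2(1) by blast
    qed
    then obtain G1 G2 where G: "\<And>a. a \<in> S \<Longrightarrow> G1 a \<in> box l ?k" "\<And>a. a \<in> S \<Longrightarrow> G2 a \<in> box l ?k"
      and near: "\<And>a z. a \<in> S \<Longrightarrow> z \<in> E \<Longrightarrow> norm (of_real (3 * \<beta> * real (a z)) - (cpoly (G1 a) z + \<i> * cpoly (G2 a) z)) \<le> \<beta>"
      by metis
    define \<Phi> where "\<Phi> a = (red (G1 a), red (G2 a))" for a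
    have inj: "inj_on \<Phi> S"
    proof (rule inj_onI)
      fix a a' assume a: "a \<in> S" "a' \<in> S" and eq: "\<Phi> a = \<Phi> a'"
      have "a z = a' z" if z: "z \<in> E" for z
      proof -
        have zr: "z \<in> roots" using z by (simp add: E_def)
        have "cpoly (G1 a) z = cpoly (G1 a') z" "cpoly (G2 a) z = cpoly (G2 a') z"
          using eq cpoly_red[OF zr] unfolding \<Phi>_def by (metis prod.inject)+
        then have "norm (complex_of_real (3 * \<beta> * real (a z)) - of_real (3 * \<beta> * real (a' z))) \<le> \<beta> + \<beta>"
          using norm_triangle_le_diff[OF add_mono[OF near[OF a(1) z] near[OF a(2) z]]] by simp
        then have "\<bar>3 * \<beta> * real (a z) - 3 * \<beta> * real (a' z)\<bar> \<le> 2 * \<beta>"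
          by (metis mult_2 norm_of_real of_real_diff)
        also have "3 * \<beta> * real (a z) - 3 * \<beta> * real (a' z) = (3 * \<beta>) * (real (a z) - real (a' z))" by (simp add: algebra_simps)
        finally have "(3 * \<beta>) * \<bar>real (a z) - real (a' z)\<bar> \<le> 2 * \<beta>" using \<beta> by (simp add: abs_mult)
        then have "\<bar>real (a z) - real (a' z)\<bar> < 1" using \<beta> by (simp add: field_simps) 
        then show ?thesis by linarith
      qed
      then show "a = a'" using a unfolding S_def by (intro PiE_ext) auto
    qed
    have finb: "finite (red ` box l ?k)" using card_box[of ?k l] by simp
    have "card S \<le> card (red ` box l ?k \<times> red ` box l ?k)"
      by (rule card_inj_on_le[OF inj]) (use G finb in \<open>auto simp: \<Phi>_def\<close>)
    then have "card S \<le> card (red ` box l ?k) ^ 2" by (simp add: card_cartesian_product power2_eq_square)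
    then have "real (card S) \<le> real (card (red ` box l ?k) ^ 2)" by (simp only: of_nat_le_iff)
    then have cS: "real (card S) \<le> real (card (red ` box l ?k)) ^ 2" by simp
    have "c * msr ^ l = (\<tau> / (3 * \<beta>)) ^ e * msr ^ (l - e)"
      using msr1 l by (simp add: c_def power_diff)
    also have "\<dots> = (\<Prod>z\<in>E. \<tau> / (3 * \<beta>) * norm z ^ (l - e))"
      by (simp only: prod.distrib prod_constant msrE e_def prod_power_distrib)
    also have "\<dots> \<le> (\<Prod>z\<in>E. real (A z))"
    proof (rule prod_mono)
      fix z
      have "\<tau> / (3 * \<beta>) * norm z ^ (l - e) \<le> real (A z)"
        using \<tau> \<beta> unfolding A_def by simp linarith
      moreover have "0 \<le> \<tau> / (3 * \<beta>) * norm z ^ (l - e)" using \<tau> \<beta> by simp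
      ultimately show "0 \<le> \<tau> / (3 * \<beta>) * norm z ^ (l - e) \<and> \<tau> / (3 * \<beta>) * norm z ^ (l - e) \<le> real (A z)" by simp
    qed
    also have "\<dots> = real (card S)" unfolding S_def by (simp add: card_PiE[OF finE])
    finally show ?thesis using cS by linarith
  qed
  show ?thesis using c0 main by blast
qed

text \<open>
  The constant of \<open>expansion_asymptotic\<close> disappears because the number of classes for length \<open>j D\<close> is
  at most the \<open>j\<close>-th power of the one for length \<open>D\<close>.
\<close>

theorem msr_power_le:
  assumes P: "g dvd P" and lc: "lead_coeff P = 1 \<or> lead_coeff P = -1" and P1: "\<And>i. \<bar>coeff P i\<bar> \<le> 1" and D: "D > 0"
  shows "msr ^ D \<le> real (card (red ` box D (real (degree P + 2)))) ^ 2"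
proof (rule ccontr)
  let ?N = "\<lambda>l. real (card (red ` box l (real (degree P + 2))))"
  assume "\<not> msr ^ D \<le> ?N D ^ 2"
  then have lt: "?N D ^ 2 < msr ^ D" by simp
  obtain c l0 where c: "c > 0" "\<And>l. l \<ge> l0 \<Longrightarrow> c * msr ^ l \<le> ?N l ^ 2" using expansion_asymptotic[OF P lc P1] by blast
  have "0 \<in> box D (real (degree P + 2))" by (simp add: box_def)
  moreover have "finite (box D (real (degree P + 2)))" using card_box[of "real (degree P + 2)" D] by simp
  ultimately have "card (red ` box D (real (degree P + 2))) > 0" by (auto simp: card_gt_0_iff)
  then have N0: "?N D ^ 2 > 0" by simp
  define x where "x = msr ^ D / ?N D ^ 2"
  have x: "x > 1" using lt N0 by (simp add: x_def)
  obtain j0 where j0: "1 / c < x ^ j0" using real_arch_pow[OF x] by blast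
  define j where "j = max j0 l0"
  have "x ^ j0 \<le> x ^ j" using x by (intro power_increasing) (auto simp: j_def)
  then have "1 / c < x ^ j" using j0 by linarith
  moreover have "c * x ^ j \<le> 1"
  proof -
    have "j * D \<ge> l0" using D by (simp add: j_def) (metis le_trans max.cobounded2 mult_le_mono2 nat_mult_1_right Suc_leI One_nat_def)
    then have "c * msr ^ (j * D) \<le> ?N (j * D) ^ 2" by (rule c(2))
    also have "real (card (red ` box (j * D) (real (degree P + 2)))) \<le> real (card (red ` box D (real (degree P + 2))) ^ j)"
      unfolding of_nat_le_iff by (rule card_red_box_mult) simp
    then have "?N (j * D) \<le> ?N D ^ j" by simp
    then have "?N (j * D) ^ 2 \<le> (?N D ^ j) ^ 2" by (intro power_mono) auto
    finally have "c * (msr ^ D) ^ j \<le> (?N D ^ 2) ^ j" by (simp add: mult.commute[of j] power_mult[symmetric])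
    then show ?thesis using N0 by (simp add: x_def power_divide field_simps)
  qed
  ultimately show False using c(1) by (simp add: field_simps)
qed

end

section \<open>Orders of roots of unity\<close>

lemma prime_power_sum_mod:
  fixes u v :: "int poly"
  assumes q: "prime (q::nat)"
  shows "\<exists>w. (u + v) ^ q = u ^ q + v ^ q + smult (int q) w"
proof -
  have q0: "q > 0" using q by (simp add: prime_gt_0_nat)
  have "\<forall>k\<in>{1..<q}. \<exists>w. of_nat (q choose k) * u ^ k * v ^ (q - k) = smult (int q) w"
  proof
    fix k assume k: "k \<in> {1..<q}"
    have "q dvd q choose k" using q k by (intro dvd_choose_prime) auto
    then obtain c where "q choose k = q * c" by (elim dvdE)
    then have "of_nat (q choose k) * u ^ k * v ^ (q - k) = smult (int q) (of_nat c * u ^ k * v ^ (q - k))"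
      by (simp add: of_nat_poly)
    then show "\<exists>w. of_nat (q choose k) * u ^ k * v ^ (q - k) = smult (int q) w" by blast
  qed
  then obtain w where w: "\<And>k. k \<in> {1..<q} \<Longrightarrow> of_nat (q choose k) * u ^ k * v ^ (q - k) = smult (int q) (w k)" by metis
  have "{..q} = insert 0 (insert q {1..<q})" using q0 by auto
  then have "(u + v) ^ q = v ^ q + (u ^ q + (\<Sum>k\<in>{1..<q}. of_nat (q choose k) * u ^ k * v ^ (q - k)))"
    using q0 by (simp add: binomial_ring)
  also have "(\<Sum>k\<in>{1..<q}. of_nat (q choose k) * u ^ k * v ^ (q - k)) = (\<Sum>k\<in>{1..<q}. smult (int q) (w k))"
    by (intro sum.cong refl w)
  also have "\<dots> = smult (int q) (\<Sum>k\<in>{1..<q}. w k)" by (induction "{1..<q}" rule: infinite_finite_induct) (simp_all add: smult_sum2)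
  finally show ?thesis by (intro exI[of _ "\<Sum>k\<in>{1..<q}. w k"]) (simp add: algebra_simps)
qed

lemma fermat_int:
  assumes q: "prime (q::nat)"
  shows "a ^ q mod int q = a mod int q"
proof -
  have q0: "q > 0" using q by (simp add: prime_gt_0_nat)
  define b where "b = nat (a mod int q)"
  have b: "int b = a mod int q" using q0 by (simp add: b_def)
  have "b ^ q mod q = b mod q"
  proof (cases "q dvd b")
    case True
    then have "q dvd b ^ q" using q0 by (simp add: dvd_power_same dvd_trans dvd_power)
    then show ?thesis using True by (simp add: mod_eq_0_iff_dvd)
  next
    case False
    then have "b ^ (q - 1) mod q = 1 mod q"
      using fermat_theorem[OF q] unfolding unique_euclidean_semiring_class.cong_def by blast
    then have "b * b ^ (q - 1) mod q = b * 1 mod q" by (metis mod_mult_right_eq)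
    then show ?thesis using q0 by (metis Suc_diff_1 mult_1_right power_Suc)
  qed
  then have "int (b ^ q mod q) = int (b mod q)" by (rule arg_cong)
  then have "int b ^ q mod int q = int b mod int q" by (simp add: zmod_int)
  then show ?thesis unfolding b by (simp add: power_mod)
qed

lemma frobenius_int_poly:
  fixes f :: "int poly"
  assumes q: "prime (q::nat)"
  shows "\<exists>w. pcompose f (monom 1 q) = f ^ q + smult (int q) w"
proof (induction f)
  case 0
  then show ?case using q by (intro exI[of _ 0]) (simp add: prime_gt_0_nat power_0_left)
next
  case (pCons a f)
  then obtain w where w: "pcompose f (monom 1 q) = f ^ q + smult (int q) w" by blast
  obtain v where v: "([:a:] + [:0, 1:] * f) ^ q = [:a:] ^ q + ([:0, 1:] * f) ^ q + smult (int q) v"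
    using prime_power_sum_mod[OF q] by blast
  have "int q dvd a - a ^ q" using fermat_int[OF q, of a] by (metis mod_eq_dvd_iff)
  then obtain c where c: "a - a ^ q = int q * c" by (elim dvdE)
  have X: "[:0, 1:] ^ q = (monom 1 q :: int poly)" by (simp add: monom_altdef)
  have "pCons a f = [:a:] + [:0, 1:] * f" by simp
  then have "pCons a f ^ q = [:a:] ^ q + ([:0, 1:] * f) ^ q + smult (int q) v" using v by simp
  also have "[:a:] ^ q = [:a ^ q:]" by (simp add: poly_const_pow)
  also have "([:0, 1:] * f) ^ q = monom 1 q * f ^ q" by (simp only: power_mult_distrib X)
  finally have p: "pCons a f ^ q = [:a ^ q:] + monom 1 q * f ^ q + smult (int q) v" .
  have "pcompose (pCons a f) (monom 1 q) = [:a:] + monom 1 q * (f ^ q + smult (int q) w)"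
    by (simp add: pcompose_pCons w)
  also have "[:a:] = [:a ^ q:] + smult (int q) [:c:]" using c by simp
  finally have "pcompose (pCons a f) (monom 1 q) = pCons a f ^ q + smult (int q) ([:c:] + monom 1 q * w - v)"
    unfolding p by (simp add: algebra_simps smult_diff_right smult_add_right)
  then show ?case by blast
qed

lemma cpoly_pcompose: "cpoly (pcompose f h) z = cpoly f (cpoly h z)"
  by (induction f) (simp_all add: pcompose_pCons hom_distribs)

text \<open>Compared prime by prime: for odd p, p \<le> (p - 1)^2 shows that p^a is at most the
  square of its totient, and only p = 2 loses a factor 2.\<close>

lemma totient_square_ge:
  assumes "m > 0"
  shows "m \<le> 2 * (totient m)\<^sup>2"
proof -
  have key: "p ^ a \<le> (if p = 2 then 2 else 1) * (p ^ (a - 1) * (p - 1))\<^sup>2" if p: "prime p" and a: "a \<ge> 1" for p a :: nat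
  proof -
    have e: "p ^ (a - 1) * p ^ (a - 1) \<ge> p ^ (a - 1)" using prime_ge_1_nat[OF p] by simp
    have pa: "p ^ a = p * p ^ (a - 1)" using a by (metis One_nat_def Suc_diff_le diff_Suc_Suc minus_nat.diff_0 power_Suc)
    show ?thesis
    proof (cases "p = 2")
      case True
      then show ?thesis using e pa by (simp add: power2_eq_square)
    next
      case False
      then have p3: "p \<ge> 3" using prime_ge_2_nat[OF p] by linarith
      then obtain r where r: "p = r + 3" by (metis add.commute le_Suc_ex)
      have "p \<le> (p - 1) * (p - 1)" unfolding r by simp
      then have "p * p ^ (a - 1) \<le> ((p - 1) * (p - 1)) * (p ^ (a - 1) * p ^ (a - 1))" using e by (intro mult_mono) auto
      then show ?thesis using False pa by (simp add: power2_eq_square mult_ac)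
    qed
  qed
  have "m = (\<Prod>p\<in>prime_factors m. p ^ multiplicity p m)" by (rule prime_factorization_nat[OF assms])
  also have "\<dots> \<le> (\<Prod>p\<in>prime_factors m. (if p = 2 then 2 else 1) * (p ^ (multiplicity p m - 1) * (p - 1))\<^sup>2)"
  proof (rule prod_mono, intro conjI)
    fix p assume "p \<in> prime_factors m"
    then have "prime p" "multiplicity p m \<ge> 1" using assms by (auto simp: prime_factors_multiplicity Suc_le_eq)
    then show "p ^ multiplicity p m \<le> (if p = 2 then 2 else 1) * (p ^ (multiplicity p m - 1) * (p - 1))\<^sup>2" by (rule key)
  qed simp
  also have "\<dots> = (\<Prod>p\<in>prime_factors m. (if p = 2 then 2 else 1)) * (\<Prod>p\<in>prime_factors m. p ^ (multiplicity p m - 1) * (p - 1))\<^sup>2"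
    by (subst prod.distrib) (simp only: prod_power_distrib)
  also have "(\<Prod>p\<in>prime_factors m. p ^ (multiplicity p m - 1) * (p - 1)) = totient m"
    using totient_formula1[OF assms] by simp
  finally have "m \<le> (\<Prod>p\<in>prime_factors m. if p = 2 then 2 else 1) * (totient m)\<^sup>2" .
  also have "(\<Prod>p\<in>prime_factors m. if p = 2 then 2 else (1::nat)) \<le> 2"
    by (subst prod.delta) auto
  then have "(\<Prod>p\<in>prime_factors m. if p = 2 then 2 else (1::nat)) * (totient m)\<^sup>2 \<le> 2 * (totient m)\<^sup>2"
    by (rule mult_right_mono) simp
  finally show ?thesis .
qed

context monic_irreducible
begin

text \<open>The classical argument for the irreducibility of cyclotomic polynomials. If
  \<open>?\<beta>\<close> were not a conjugate, it would be a root of the cofactor \<open>h\<close>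
  of \<open>g\<close> in X^m - 1, and differentiation would give m times the (m - 1)-th power of
  \<open>?\<beta>\<close> as the product of \<open>g\<close> and the derivative of \<open>h\<close>
  at \<open>?\<beta>\<close>. By Frobenius the value of \<open>g\<close> there is divisible by
  \<open>q\<close>, so \<open>q\<close> divides m modulo \<open>g\<close>, hence in the
  integers.\<close>

lemma root_of_unity_prime_power:
  assumes \<alpha>: "\<alpha> \<in> roots" "\<alpha> ^ m = 1" "m > 0" and q: "prime q" "\<not> q dvd m"
  shows "\<alpha> ^ q \<in> roots"
proof (rule ccontr)
  assume nr: "\<alpha> ^ q \<notin> roots"
  let ?\<beta> = "\<alpha> ^ q"
  have gb: "cpoly g ?\<beta> \<noteq> 0" using nr by (simp add: roots_def)
  have "?\<beta> ^ m = (\<alpha> ^ m) ^ q" by (simp only: power_mult[symmetric] mult.commute)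
  then have bm: "?\<beta> ^ m = 1" using \<alpha>(2) by simp
  have "g dvd monom 1 m - 1" by (rule root_imp_dvd[OF \<alpha>(1)]) (use \<alpha>(2) in \<open>simp add: poly_monom\<close>)
  then obtain h where h: "monom 1 m - 1 = g * h" by (elim dvdE)
  have "cpoly (monom 1 m - 1) ?\<beta> = cpoly (g * h) ?\<beta>" by (simp only: h)
  then have hb: "cpoly h ?\<beta> = 0" using bm gb by (simp add: poly_monom)
  have "pderiv (monom 1 m - 1 :: int poly) = pderiv (g * h)" by (simp only: h)
  then have "monom (int m) (m - 1) = g * pderiv h + h * pderiv g"
    by (simp add: pderiv_diff pderiv_monom pderiv_mult)
  then have "cpoly (monom (int m) (m - 1)) ?\<beta> = cpoly (g * pderiv h + h * pderiv g) ?\<beta>" by (simp only:)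
  then have d: "of_nat m * ?\<beta> ^ (m - 1) = cpoly g ?\<beta> * cpoly (pderiv h) ?\<beta>"
    using hb by (simp add: poly_monom hom_distribs)
  obtain w where w: "pcompose g (monom 1 q) = g ^ q + smult (int q) w" using frobenius_int_poly[OF q(1)] by blast
  have "cpoly g ?\<beta> = cpoly (pcompose g (monom 1 q)) \<alpha>" by (simp add: cpoly_pcompose poly_monom)
  also have "\<dots> = of_nat q * cpoly w \<alpha>" unfolding w
    using \<alpha>(1) q(1) by (simp add: roots_def hom_distribs prime_gt_0_nat)
  finally have gw: "cpoly g ?\<beta> = of_nat q * cpoly w \<alpha>" .
  define W where "W = monom 1 q * (w * pcompose (pderiv h) (monom 1 q))"
  have "of_nat m = ?\<beta> * (of_nat m * ?\<beta> ^ (m - 1))"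
  proof -
    have "?\<beta> * ?\<beta> ^ (m - 1) = 1" using bm \<alpha>(3) by (metis Suc_diff_1 power_Suc)
    then show ?thesis by (simp add: mult.left_commute)
  qed
  also have "\<dots> = of_nat q * cpoly W \<alpha>" unfolding d gw W_def by (simp add: cpoly_pcompose poly_monom)
  finally have "cpoly ([:int m:] - smult (int q) W) \<alpha> = 0" by (simp add: hom_distribs)
  then have "g dvd [:int m:] - smult (int q) W" by (rule root_imp_dvd[OF \<alpha>(1)])
  then have "red [:int m:] = smult (int q) (red W)" by (simp only: red_eq_iff red_smult[symmetric])
  moreover have "red [:int m:] = [:int m:]" by (rule red_small) (use n_pos in \<open>auto simp: coeff_pCons split: nat.splits\<close>)
  ultimately have "coeff [:int m:] 0 = int q * coeff (red W) 0" by simp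
  then have "int q dvd int m" by simp
  then show False using q(2) by simp
qed

lemma root_of_unity_coprime_power:
  assumes \<alpha>: "\<alpha> \<in> roots" "\<alpha> ^ m = 1" "m > 0" and t: "t > 0" "gcd t m = 1"
  shows "\<alpha> ^ t \<in> roots"
  using t
proof (induction t rule: less_induct)
  case (less t)
  show ?case
  proof (cases "t = 1")
    case False
    then obtain q where q: "prime q" "q dvd t" using prime_factor_nat by blast
    obtain t' where t': "t = q * t'" using q(2) by (elim dvdE)
    have t'0: "t' > 0" using t' less.prems by (cases t') auto
    have "q \<ge> 2" using prime_ge_2_nat[OF q(1)] .
    then have lt: "t' < t" using t' t'0 by simp
    have "gcd t' m dvd gcd t m" using t' by (intro gcd_greatest) (auto intro: dvd_trans[OF gcd_dvd1])
    then have g1: "gcd t' m = 1" using less.prems by simp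
    have nq: "\<not> q dvd m"
    proof
      assume "q dvd m"
      then have "q dvd gcd t m" using q(2) by (intro gcd_greatest)
      then show False using less.prems q(1) by simp
    qed
    have "\<alpha> ^ t' \<in> roots" by (rule less.IH[OF lt t'0 g1])
    moreover have "(\<alpha> ^ t') ^ m = (\<alpha> ^ m) ^ t'" by (simp only: power_mult[symmetric] mult.commute)
    then have "(\<alpha> ^ t') ^ m = 1" using \<alpha>(2) by simp
    ultimately have "(\<alpha> ^ t') ^ q \<in> roots" using \<alpha>(3) q(1) nq by (rule root_of_unity_prime_power)
    then show ?thesis using t' by (simp add: power_mult[symmetric] mult.commute)
  qed (use \<alpha> in simp)
qed

text \<open>For the exact order m, the powers with exponents prime to m are distinct conjugates, so
  the totient of m is at most \<open>n\<close>; then \<open>totient_square_ge\<close>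
  applies.\<close>

lemma root_of_unity_order_le:
  assumes \<alpha>: "\<alpha> \<in> roots" "\<alpha> ^ k = 1" "k > 0"
  shows "\<exists>m>0. \<alpha> ^ m = 1 \<and> m \<le> 2 * n\<^sup>2"
proof -
  define m where "m = (LEAST m. m > 0 \<and> \<alpha> ^ m = 1)"
  have m: "m > 0" "\<alpha> ^ m = 1" using LeastI[of "\<lambda>m. m > 0 \<and> \<alpha> ^ m = 1" k] \<alpha> by (auto simp: m_def)
  have min: "m \<le> j" if "j > 0" "\<alpha> ^ j = 1" for j unfolding m_def by (rule Least_le) (use that in simp)
  have \<alpha>0: "\<alpha> \<noteq> 0" using m by (auto simp: power_0_left)
  have lt: False if "s < t" "t \<in> totatives m" "s \<in> totatives m" "\<alpha> ^ s = \<alpha> ^ t" for s t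
  proof -
    have "\<alpha> ^ t = \<alpha> ^ s * \<alpha> ^ (t - s)" using that(1) by (simp flip: power_add)
    then have "\<alpha> ^ (t - s) = 1" using that(4) \<alpha>0 by simp
    then have "m \<le> t - s" using that(1) by (intro min) auto
    moreover have "t \<le> m" "s > 0" using that(2,3) by (auto simp: totatives_def)
    ultimately show False using that(1) by arith
  qed
  have "inj_on (\<lambda>t. \<alpha> ^ t) (totatives m)"
  proof (rule inj_onI)
    fix s t assume "s \<in> totatives m" "t \<in> totatives m" "\<alpha> ^ s = \<alpha> ^ t"
    then show "s = t" using lt[of s t] lt[of t s] by (metis linorder_neqE_nat)
  qed
  moreover have "(\<lambda>t. \<alpha> ^ t) ` totatives m \<subseteq> roots"
  proof (rule image_subsetI)
    fix t assume t: "t \<in> totatives m"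
    then have tm: "t \<in> {0<..m} \<and> gcd t m = 1" unfolding totatives_def coprime_iff_gcd_eq_1 by blast
    then have "t > 0" "gcd t m = 1" unfolding greaterThanAtMost_iff by blast+
    then show "\<alpha> ^ t \<in> roots" by (rule root_of_unity_coprime_power[OF \<alpha>(1) m(2,1)])
  qed
  ultimately have "totient m \<le> card roots" unfolding totient_def by (rule card_inj_on_le[OF _ _ finite_roots])
  then have "(totient m)\<^sup>2 \<le> n\<^sup>2" using card_roots by (intro power_mono) auto
  then have "m \<le> 2 * n\<^sup>2" using totient_square_ge[OF m(1)] by linarith
  then show ?thesis using m by blast
qed

end

section \<open>Small multiples of a geometric progression\<close>

definition addchar :: "nat \<Rightarrow> int \<Rightarrow> complex" where "addchar p a = cis (2 * pi * real_of_int a / real p)"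

lemma addchar_add: "addchar p (a + b) = addchar p a * addchar p b"
  by (simp add: addchar_def cis_mult add_divide_distrib distrib_left)

lemma addchar_0 [simp]: "addchar p 0 = 1" by (simp add: addchar_def)

lemma norm_addchar [simp]: "norm (addchar p a) = 1" by (simp add: addchar_def)

lemma addchar_multiple:
  assumes "p > 0" "int p dvd a"
  shows "addchar p a = 1"
proof -
  obtain k where "a = int p * k" using assms(2) by (elim dvdE)
  then have "2 * pi * real_of_int a / real p = 2 * pi * real_of_int k" using assms(1) by simp
  then have "addchar p a = cis (2 * pi * real_of_int k)" by (simp only: addchar_def)
  then show ?thesis by (simp add: cis_multiple_2pi)
qed

lemma addchar_cong:
  assumes "p > 0" "a mod int p = b mod int p"
  shows "addchar p a = addchar p b"
proof -
  have "int p dvd a - b" using assms(2) by (simp only: mod_eq_dvd_iff)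
  then have "addchar p ((a - b) + b) = 1 * addchar p b" unfolding addchar_add using addchar_multiple[OF assms(1)] by simp
  then show ?thesis by simp
qed

lemma addchar_eq_1_imp:
  assumes "p > 0" "addchar p a = 1"
  shows "int p dvd a"
proof -
  have "cos (2 * pi * real_of_int a / real p) = 1" using assms(2) by (simp add: addchar_def complex_eq_iff)
  then obtain k :: int where "2 * pi * real_of_int a / real p = real_of_int k * 2 * pi"
    using cos_one_2pi_int by blast
  then have "2 * pi * real_of_int a = 2 * pi * (real_of_int k * real p)" using assms(1) by (simp add: field_simps)
  then have "real_of_int a = real_of_int (k * int p)" by simp
  then have "a = k * int p" by (simp only: of_int_eq_iff)
  then show ?thesis by simp
qed

lemma sum_addchar:
  assumes p: "p > 0"
  shows "(\<Sum>\<xi><p. addchar p (int \<xi> * a)) = (if int p dvd a then of_nat p else 0)"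
proof (cases "int p dvd a")
  case True
  then have "addchar p (int \<xi> * a) = 1" for \<xi> using p by (intro addchar_multiple) auto
  then show ?thesis using True by simp
next
  case False
  define z where "z = addchar p a"
  have pw: "addchar p (int \<xi> * a) = z ^ \<xi>" for \<xi>
    by (induction \<xi>) (simp_all add: z_def algebra_simps addchar_add)
  have "z \<noteq> 1" using addchar_eq_1_imp[OF p] False by (auto simp: z_def)
  moreover have "z ^ p = 1" using pw[of p] addchar_multiple[OF p, of "int p * a"] by simp
  ultimately have "(\<Sum>\<xi><p. z ^ \<xi>) = 0" using geometric_sum[of z p] by simp
  then show ?thesis using False by (simp add: pw)
qed

text \<open>The number of ways to write \<open>y\<close> modulo \<open>p\<close> as an ordered sum
  of exactly \<open>k\<close> entries of \<open>hs\<close>.\<close>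

fun reps :: "nat \<Rightarrow> int list \<Rightarrow> nat \<Rightarrow> int \<Rightarrow> nat" where
  "reps p hs 0 y = (if int p dvd y then 1 else 0)"
| "reps p hs (Suc k) y = (\<Sum>h\<leftarrow>hs. reps p hs k (y - h))"

lemma sum_list_sum_commute: "(\<Sum>h\<leftarrow>hs. \<Sum>x\<in>A. f h x) = (\<Sum>x\<in>A. \<Sum>h\<leftarrow>hs. (f h x :: complex))"
  by (induction hs) (simp_all add: sum.distrib)

lemma sum_list_pos_imp: "0 < (\<Sum>h\<leftarrow>hs. (f h :: nat)) \<Longrightarrow> \<exists>h\<in>set hs. 0 < f h"
  by (induction hs) auto

lemma reps_fourier:
  assumes p: "p > 0"
  shows "of_nat p * of_nat (reps p hs k y) = (\<Sum>\<xi><p. addchar p (- int \<xi> * y) * (\<Sum>h\<leftarrow>hs. addchar p (int \<xi> * h)) ^ k)"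
proof (induction k arbitrary: y)
  case 0
  have "(\<Sum>\<xi><p. addchar p (- int \<xi> * y)) = (\<Sum>\<xi><p. addchar p (int \<xi> * (- y)))" by simp
  also have "\<dots> = (if int p dvd y then of_nat p else 0)" using sum_addchar[OF p, of "- y"] by simp
  finally show ?case by simp
next
  case (Suc k)
  have "complex_of_nat p * of_nat (\<Sum>h\<leftarrow>ys. f h) = (\<Sum>h\<leftarrow>ys. of_nat p * of_nat (f h))" for f and ys :: "int list"
    by (induction ys) (simp_all add: algebra_simps)
  then have "complex_of_nat p * of_nat (reps p hs (Suc k) y) = (\<Sum>h\<leftarrow>hs. of_nat p * of_nat (reps p hs k (y - h)))"
    by simp
  also have "\<dots> = (\<Sum>h\<leftarrow>hs. \<Sum>\<xi><p. addchar p (- int \<xi> * (y - h)) * (\<Sum>h\<leftarrow>hs. addchar p (int \<xi> * h)) ^ k)"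
    using Suc by simp
  also have "\<dots> = (\<Sum>\<xi><p. \<Sum>h\<leftarrow>hs. addchar p (- int \<xi> * (y - h)) * (\<Sum>h\<leftarrow>hs. addchar p (int \<xi> * h)) ^ k)"
    by (rule sum_list_sum_commute)
  also have "\<dots> = (\<Sum>\<xi><p. addchar p (- int \<xi> * y) * (\<Sum>h\<leftarrow>hs. addchar p (int \<xi> * h)) ^ Suc k)"
  proof (rule sum.cong[OF refl])
    fix \<xi>
    define F where "F = (\<Sum>h\<leftarrow>hs. addchar p (int \<xi> * h)) ^ k"
    have "addchar p (- int \<xi> * (y - h)) = addchar p (- int \<xi> * y) * addchar p (int \<xi> * h)" for h
      by (simp add: addchar_add[symmetric] algebra_simps)
    then have "(\<Sum>h\<leftarrow>hs. addchar p (- int \<xi> * (y - h)) * F) = (\<Sum>h\<leftarrow>hs. (addchar p (- int \<xi> * y) * F) * addchar p (int \<xi> * h))"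
      by (simp add: mult_ac)
    also have "\<dots> = (addchar p (- int \<xi> * y) * F) * (\<Sum>h\<leftarrow>hs. addchar p (int \<xi> * h))" by (rule sum_list_const_mult)
    finally show "(\<Sum>h\<leftarrow>hs. addchar p (- int \<xi> * (y - h)) * (\<Sum>h\<leftarrow>hs. addchar p (int \<xi> * h)) ^ k) = addchar p (- int \<xi> * y) * (\<Sum>h\<leftarrow>hs. addchar p (int \<xi> * h)) ^ Suc k"
      by (simp add: F_def mult_ac)
  qed
  finally show ?case .
qed

lemma reps_pos_imp:
  assumes "reps p hs k y > 0"
  shows "\<exists>xs. set xs \<subseteq> set hs \<and> length xs = k \<and> int p dvd y - sum_list xs"
  using assms
proof (induction k arbitrary: y)
  case 0
  then show ?case by (auto split: if_splits)
next
  case (Suc k)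
  then obtain h where h: "h \<in> set hs" "reps p hs k (y - h) > 0"
    using sum_list_pos_imp[of "\<lambda>h. reps p hs k (y - h)" hs] by auto
  from Suc.IH[OF h(2)] obtain xs where "set xs \<subseteq> set hs" "length xs = k" "int p dvd y - h - sum_list xs" by blast
  then show ?case using h(1) by (intro exI[of _ "h # xs"]) (simp add: algebra_simps)
qed

text \<open>The constant is crude: a Taylor bound for the sine gives z^2 / 8 on [0, 1]; beyond 1,
  monotonicity of the cosine gives 1/8, which is enough since \<pi> < 4.\<close>

lemma one_minus_cos_ge:
  fixes x :: real
  assumes "\<bar>x\<bar> \<le> pi"
  shows "x\<^sup>2 / 128 \<le> 1 - cos x"
proof -
  have small: "z\<^sup>2 / 8 \<le> 1 - cos z" if z: "0 \<le> z" "z \<le> 1" for z :: real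
  proof -
    define y where "y = z / 2"
    have y: "0 \<le> y" "y \<le> 1 / 2" using z by (auto simp: y_def)
    have "\<bar>sin y - (\<Sum>m<3. sin_coeff m * y ^ m)\<bar> \<le> inverse (fact 3) * \<bar>y\<bar> ^ 3"
      by (rule Maclaurin_sin_bound)
    then have "\<bar>sin y - y\<bar> \<le> y ^ 3 / 6" using y
      by (simp add: eval_nat_numeral sin_coeff_def field_simps)
    moreover have "y ^ 3 \<le> y / 4"
    proof -
      have "y * y \<le> 1 / 2 * (1 / 2)" using y by (intro mult_mono) auto
      then have "y * (y * y) \<le> y * (1 / 2 * (1 / 2))" using y by (intro mult_left_mono) auto
      then show ?thesis by (simp add: power3_eq_cube mult.assoc)
    qed
    ultimately have s: "y / 2 \<le> sin y" using y by linarith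
    have "(y / 2)\<^sup>2 \<le> (sin y)\<^sup>2" using s y by (intro power_mono) auto
    moreover have "1 - cos z = 2 * (sin y)\<^sup>2" using cos_double_sin[of y] by (simp add: y_def)
    ultimately show ?thesis by (simp add: y_def power_divide)
  qed
  have pos: "z\<^sup>2 / 128 \<le> 1 - cos z" if z: "0 \<le> z" "z \<le> pi" for z :: real
  proof (cases "z \<le> 1")
    case True
    then show ?thesis using small[of z] z zero_le_power2[of z] by linarith
  next
    case False
    have "cos z \<le> cos 1" using False z by (intro cos_monotone_0_pi_le) auto
    moreover have "1 / 8 \<le> 1 - cos (1::real)" using small[of 1] by simp
    moreover have "z\<^sup>2 \<le> 4\<^sup>2" using z pi_less_4 by (intro power_mono) auto
    ultimately show ?thesis by simp
  qed
  show ?thesis using pos[of "\<bar>x\<bar>"] assms by simp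
qed

lemma norm_one_plus_addchar:
  assumes p: "p > 0" and u: "u mod int p = a mod int p" "2 * \<bar>u\<bar> \<le> int p" and big: "\<bar>real_of_int u\<bar> \<ge> \<eta> * real p" and \<eta>: "\<eta> \<ge> 0"
  shows "norm (1 + addchar p a) \<le> 2 - \<eta>\<^sup>2 / 16"
proof -
  define x where "x = 2 * pi * real_of_int u / real p"
  have "addchar p a = cis x" using addchar_cong[OF p u(1)] by (simp add: addchar_def x_def)
  then have "(norm (1 + addchar p a))\<^sup>2 = (1 + cos x)\<^sup>2 + (sin x)\<^sup>2" by (simp add: cmod_power2)
  also have "\<dots> = 2 + 2 * cos x" using sin_cos_squared_add[of x] by (simp add: power2_eq_square algebra_simps)
  finally have nsq: "(norm (1 + addchar p a))\<^sup>2 = 2 + 2 * cos x" .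
  have "2 * \<bar>real_of_int u\<bar> \<le> real p" using u(2) by linarith
  then have "\<bar>x\<bar> \<le> pi" using p by (simp add: x_def abs_mult field_simps)
  then have c: "x\<^sup>2 / 128 \<le> 1 - cos x" by (rule one_minus_cos_ge)
  have "\<bar>x\<bar> \<ge> 2 * 2 * \<eta>"
  proof -
    have "\<eta> \<le> \<bar>real_of_int u\<bar> / real p" using big p by (simp add: field_simps)
    then have "2 * 2 * \<eta> \<le> 2 * pi * (\<bar>real_of_int u\<bar> / real p)" using pi_ge_two \<eta> by (intro mult_mono) auto
    then show ?thesis using p by (simp add: x_def abs_mult)
  qed
  then have "(2 * 2 * \<eta>)\<^sup>2 \<le> \<bar>x\<bar>\<^sup>2" using \<eta> by (intro power_mono) auto
  then have "16 * \<eta>\<^sup>2 \<le> x\<^sup>2" by (simp add: power_mult_distrib)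
  then have c': "\<eta>\<^sup>2 / 8 \<le> 1 - cos x" using c by linarith
  then have "(norm (1 + addchar p a))\<^sup>2 \<le> 4 - \<eta>\<^sup>2 / 4" using nsq by linarith
  also have "\<dots> \<le> 4 - \<eta>\<^sup>2 / 4 + (\<eta>\<^sup>2 / 16)\<^sup>2" by simp
  also have "\<dots> = (2 - \<eta>\<^sup>2 / 16)\<^sup>2" by (simp add: power2_diff)
  finally have "(norm (1 + addchar p a))\<^sup>2 \<le> (2 - \<eta>\<^sup>2 / 16)\<^sup>2" .
  moreover have "2 - \<eta>\<^sup>2 / 16 \<ge> 0" using c' cos_ge_minus_one[of x] by linarith
  ultimately show ?thesis by (rule power2_le_imp_le)
qed

text \<open>The prepended 0 contributes the term 1; paired with a single term away from 1, it
  already saves \<delta> over the trivial bound.\<close>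

lemma norm_exp_sum_le:
  assumes "x \<in> set hs" "norm (1 + addchar p (\<xi> * x)) \<le> 2 - \<delta>"
  shows "norm (\<Sum>h\<leftarrow>0 # hs. addchar p (\<xi> * h)) \<le> real (length hs) + 1 - \<delta>"
proof -
  have nb: "norm (\<Sum>h\<leftarrow>ys. addchar p (\<xi> * h)) \<le> real (length ys)" for ys
  proof (induction ys)
    case (Cons y ys)
    then show ?case using norm_triangle_ineq[of "addchar p (\<xi> * y)" "\<Sum>h\<leftarrow>ys. addchar p (\<xi> * h)"] by simp
  qed simp
  obtain as bs where hs: "hs = as @ x # bs" using split_list[OF assms(1)] by blast
  have "(\<Sum>h\<leftarrow>0 # hs. addchar p (\<xi> * h)) = (1 + addchar p (\<xi> * x)) + ((\<Sum>h\<leftarrow>as. addchar p (\<xi> * h)) + (\<Sum>h\<leftarrow>bs. addchar p (\<xi> * h)))"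
    unfolding hs by simp
  also have "norm \<dots> \<le> norm (1 + addchar p (\<xi> * x)) + norm ((\<Sum>h\<leftarrow>as. addchar p (\<xi> * h)) + (\<Sum>h\<leftarrow>bs. addchar p (\<xi> * h)))"
    by (rule norm_triangle_ineq)
  also have "norm ((\<Sum>h\<leftarrow>as. addchar p (\<xi> * h)) + (\<Sum>h\<leftarrow>bs. addchar p (\<xi> * h))) \<le> real (length as) + real (length bs)"
    by (rule norm_triangle_le[OF add_mono[OF nb nb]])
  finally show ?thesis using assms(2) unfolding hs by simp
qed

text \<open>Prepending 0 to \<open>hs\<close> turns sums of at most \<open>K\<close> entries into
  sums of exactly \<open>K\<close>. If every nonzero frequency moved some entry far from 0, every
  nontrivial exponential sum would be at most l - \<eta>^2 / 16. By the hypothesis on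
  \<open>K\<close>, the K-th power of this relative saving is at most 1/p, so the main term l^K
  could not be cancelled and \<open>y\<close> would be represented.\<close>

lemma small_multiplier_exists:
  fixes hs :: "int list"
  assumes p: "p > 1" and norep: "\<not> (\<exists>xs. set xs \<subseteq> set hs \<and> length xs \<le> K \<and> int p dvd y - sum_list xs)"
    and \<eta>: "\<eta> > 0" and K: "real K * \<eta>\<^sup>2 \<ge> 16 * (real (length hs) + 1) * ln (real p)"
  shows "\<exists>\<xi>\<in>{1..<p}. \<forall>h\<in>set hs. \<exists>u. u mod int p = (int \<xi> * h) mod int p \<and> \<bar>real_of_int u\<bar> < \<eta> * real p"
proof (rule ccontr)
  assume neg: "\<not> ?thesis"
  define l where "l = real (length hs) + 1"
  define F where "F \<xi> = (\<Sum>h\<leftarrow>0 # hs. addchar p (int \<xi> * h))" for \<xi> :: nat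
  have p0: "p > 0" using p by simp
  have "reps p (0 # hs) K y = 0"
  proof (rule ccontr)
    assume "reps p (0 # hs) K y \<noteq> 0"
    then obtain xs where xs: "set xs \<subseteq> set (0 # hs)" "length xs = K" "int p dvd y - sum_list xs"
      using reps_pos_imp[of p "0 # hs" K y] by auto
    define ys where "ys = filter (\<lambda>x. x \<noteq> 0) xs"
    have "set ys \<subseteq> set hs" using xs(1) by (auto simp: ys_def)
    moreover have "length ys \<le> K" using xs(2) by (auto simp: ys_def)
    moreover have "sum_list ys = sum_list xs" unfolding ys_def by (induction xs) auto
    ultimately show False using norep xs(3) by metis
  qed
  then have zero: "(\<Sum>\<xi><p. addchar p (- int \<xi> * y) * F \<xi> ^ K) = 0"
    using reps_fourier[OF p0, of "0 # hs" K y] by (simp add: F_def)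
  have F0: "F 0 = of_real l" unfolding F_def l_def by (simp add: sum_list_triv)
  have bnd: "norm (F \<xi>) \<le> l - \<eta>\<^sup>2 / 16" if x: "\<xi> \<in> {1..<p}" for \<xi>
  proof -
    obtain h where h: "h \<in> set hs" "\<And>u. u mod int p = (int \<xi> * h) mod int p \<Longrightarrow> \<bar>real_of_int u\<bar> \<ge> \<eta> * real p"
      using neg x by (metis linorder_not_le)
    have "\<exists>u. u mod int p = (int \<xi> * h) mod int p \<and> 2 * \<bar>u\<bar> \<le> int p"
    proof -
      define r where "r = (int \<xi> * h) mod int p"
      have r: "0 \<le> r" "r < int p" using p by (auto simp: r_def)
      show ?thesis
      proof (cases "2 * r \<le> int p")
        case True
        then show ?thesis using r by (intro exI[of _ r]) (auto simp: r_def)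
      next
        case False
        have "(r - int p) mod int p = (int \<xi> * h) mod int p" by (simp add: r_def)
        then show ?thesis using False r by (intro exI[of _ "r - int p"]) auto
      qed
    qed
    then obtain u where u: "u mod int p = (int \<xi> * h) mod int p" "2 * \<bar>u\<bar> \<le> int p" by blast
    have "norm (1 + addchar p (int \<xi> * h)) \<le> 2 - \<eta>\<^sup>2 / 16"
      by (rule norm_one_plus_addchar[OF p0 u h(2)[OF u(1)]]) (use \<eta> in simp)
    then show ?thesis unfolding F_def l_def by (rule norm_exp_sum_le[OF h(1)])
  qed
  have "{..<p} = insert 0 {1..<p}" using p by auto
  then have "of_real l ^ K = - (\<Sum>\<xi>\<in>{1..<p}. addchar p (- int \<xi> * y) * F \<xi> ^ K)"
    using zero F0 by (simp add: eq_neg_iff_add_eq_0)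
  then have "norm (complex_of_real l ^ K) = norm (\<Sum>\<xi>\<in>{1..<p}. addchar p (- int \<xi> * y) * F \<xi> ^ K)" by simp
  also have "\<dots> \<le> (\<Sum>\<xi>\<in>{1..<p}. norm (addchar p (- int \<xi> * y) * F \<xi> ^ K))" by (rule norm_sum)
  also have "\<dots> = (\<Sum>\<xi>\<in>{1..<p}. norm (F \<xi>) ^ K)" by (simp add: norm_mult norm_power)
  also have "\<dots> \<le> (\<Sum>\<xi>\<in>{1..<p}. (l - \<eta>\<^sup>2 / 16) ^ K)"
    by (intro sum_mono power_mono bnd) auto
  also have "\<dots> = real (p - 1) * (l - \<eta>\<^sup>2 / 16) ^ K" by simp
  finally have "norm (complex_of_real l ^ K) \<le> real (p - 1) * (l - \<eta>\<^sup>2 / 16) ^ K" .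
  moreover have l1: "l \<ge> 1" by (simp add: l_def)
  ultimately have main: "l ^ K \<le> real (p - 1) * (l - \<eta>\<^sup>2 / 16) ^ K" by (simp add: norm_power)
  define \<theta> where "\<theta> = \<eta>\<^sup>2 / (16 * l)"
  have eq: "l - \<eta>\<^sup>2 / 16 = l * (1 - \<theta>)" using l1 by (simp add: \<theta>_def field_simps)
  have th: "1 - \<theta> \<ge> 0"
  proof -
    have "0 \<le> l * (1 - \<theta>)" using order_trans[OF norm_ge_zero bnd[of 1]] p unfolding eq by simp
    then show ?thesis using l1 by (simp add: zero_le_mult_iff)
  qed
    have "(1 - \<theta>) ^ K \<le> exp (- \<theta>) ^ K" using th exp_ge_add_one_self[of "- \<theta>"] by (intro power_mono) auto
    also have "\<dots> = exp (- (real K * \<theta>))" by (simp add: exp_of_nat_mult[symmetric])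
    also have "\<dots> \<le> exp (- ln (real p))"
    proof -
      have "ln (real p) \<le> real K * \<theta>" using K l1 by (simp add: \<theta>_def l_def field_simps)
      then show ?thesis by simp
    qed
    also have "\<dots> = 1 / real p" using p by (simp add: exp_minus inverse_eq_divide)
    finally have "(1 - \<theta>) ^ K \<le> 1 / real p" .
    then have "real (p - 1) * (l ^ K * (1 - \<theta>) ^ K) \<le> real (p - 1) * (l ^ K * (1 / real p))"
      using l1 by (intro mult_left_mono) auto
    then have "l ^ K \<le> real (p - 1) * (l ^ K * (1 / real p))" using main unfolding eq power_mult_distrib by linarith
    also have "\<dots> = l ^ K * (real (p - 1) / real p)" by simp
    also have "\<dots> < l ^ K * 1" using p l1 by (intro mult_strict_left_mono) (auto simp: field_simps of_nat_diff)
    finally show False by simp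
qed

section \<open>Integral linear recurrences\<close>

lemma monic_prime_factor_mod:
  fixes f :: "int poly"
  assumes f: "lead_coeff f = 1 \<or> lead_coeff f = -1" and p: "prime (p::nat)" "int p dvd poly f x"
  shows "\<exists>g. monic g \<and> irreducible g \<and> g dvd f \<and> int p dvd poly g x"
proof -
  have f0: "f \<noteq> 0" using f by auto
  have pp: "prime (int p)" using p(1) by simp
  have "normalize (prod_mset (prime_factorization f)) = normalize f"
    using f0 by (rule prod_mset_prime_factorization_weak)
  then have "f dvd prod_mset (prime_factorization f)" by (simp add: associated_iff_dvd)
  then obtain k where "prod_mset (prime_factorization f) = f * k" by (elim dvdE)
  then have "int p dvd poly (prod_mset (prime_factorization f)) x" using p(2) by simp
  moreover have "\<exists>g\<in>#A. int p dvd poly g x" if "int p dvd poly (prod_mset A) x" for A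
    using that
  proof (induction A)
    case empty
    then show ?case using pp by simp
  next
    case (add a A)
    then have "int p dvd poly a x \<or> int p dvd poly (prod_mset A) x"
      using prime_dvd_mult_iff[OF pp] by simp
    then show ?case using add.IH by auto
  qed
  ultimately obtain g where g: "g \<in># prime_factorization f" "int p dvd poly g x" by blast
  have pg: "prime g" using g(1) by (rule in_prime_factors_imp_prime)
  have gf: "g dvd f" using g(1) by (rule in_prime_factors_imp_dvd)
  then obtain h where "f = g * h" by (elim dvdE)
  then have "lead_coeff g dvd lead_coeff f" by (simp add: lead_coeff_mult)
  then have u: "lead_coeff g dvd 1" using f by auto
  have "normalize g = g" using pg by (simp add: prime_def)
  moreover have "g \<noteq> 0" using pg by auto
  ultimately have "unit_factor g = 1" by (metis unit_factor_normalize)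
  then have "sgn (lead_coeff g) = 1" by (simp add: unit_factor_poly_def one_poly_eq_simps)
  then have "lead_coeff g > 0" by (simp add: sgn_1_pos)
  then have "monic g" using u by (simp add: zdvd1_eq)
  moreover have "irreducible g" using prime_imp_prime_elem[OF pg] by (rule prime_elem_imp_irreducible)
  ultimately show ?thesis using gf g(2) by blast
qed

text \<open>\<open>u l\<close> represents \<xi> x^(l+1), as the progression starts with the first
  power. The range \<open>D + degree P\<close> allows polynomials of length \<open>D\<close> to be
  shifted by every i < \<open>degree P\<close>. The two bounds on \<eta> keep the sums arising from
  \<open>box D \<kappa>\<close> and from \<open>P\<close> below \<open>p\<close>.\<close>

locale small_recurrence =
  fixes p :: nat and x :: int and \<xi> :: int and u :: "nat \<Rightarrow> int" and P :: "int poly" and D :: nat and \<kappa> \<eta> :: real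
  assumes p: "prime p" and x: "\<not> int p dvd x" and \<xi>: "\<not> int p dvd \<xi>"
    and lc: "lead_coeff P = 1 \<or> lead_coeff P = -1" and P1: "\<And>i. \<bar>coeff P i\<bar> \<le> 1" and Px: "int p dvd poly P x"
    and u: "\<And>l. l < D + degree P \<Longrightarrow> u l mod int p = (\<xi> * x ^ Suc l) mod int p"
    and ub: "\<And>l. l < D + degree P \<Longrightarrow> \<bar>real_of_int (u l)\<bar> < \<eta> * real p"
    and \<eta>: "\<eta> * real D * \<kappa> \<le> 1" "\<eta> * real (degree P + 1) \<le> 1" and D: "D > 0" and \<kappa>: "\<kappa> > 0"
begin

abbreviation "d \<equiv> degree P"
abbreviation "Q \<equiv> (of_int_poly P :: rat poly)"

text \<open>
  The functional vanishing on the multiples of \<open>P\<close> with \<open>X\<^sup>l \<mapsto> u\<^sub>l\<close> for \<open>l < degree P\<close>; smallness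
  extends the latter to \<open>l < D + degree P\<close>, see \<open>lam_monom\<close>.
\<close>

definition lam :: "int poly \<Rightarrow> rat" where
  "lam A = (\<Sum>i<d. coeff (of_int_poly A mod Q) i * of_int (u i))"

lemma lam_add: "lam (A + B) = lam A + lam B"
  by (simp add: lam_def hom_distribs poly_mod_add_left distrib_right sum.distrib)

lemma lam_smult: "lam (smult c A) = of_int c * lam A"
  by (simp add: lam_def hom_distribs mod_smult_left sum_distrib_left mult.assoc)

lemma lam_0 [simp]: "lam 0 = 0" by (simp add: lam_def)

lemma lam_sum: "lam (sum f S) = (\<Sum>i\<in>S. lam (f i))"
  by (induction S rule: infinite_finite_induct) (auto simp: lam_add)

lemma lam_multiple: "lam (P * A) = 0"
  by (simp add: lam_def hom_distribs)

lemma lam_monom_small: "l < d \<Longrightarrow> lam (monom 1 l) = of_int (u l)"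
proof -
  assume l: "l < d"
  have "of_int_poly (monom 1 l) mod Q = monom 1 l"
    using l by (subst mod_poly_less) (simp_all add: degree_monom_eq)
  then have "lam (monom 1 l) = (\<Sum>i<d. (if i = l then 1 else 0) * of_int (u i))"
    by (simp add: lam_def eq_commute)
  also have "\<dots> = (\<Sum>i<d. if i = l then of_int (u i) else 0)" by (intro sum.cong) auto
  also have "\<dots> = of_int (u l)" using l by (subst sum.delta) auto
  finally show ?thesis .
qed

lemma small_multiple_zero:
  assumes "int p dvd v" "\<bar>real_of_int v\<bar> < real p"
  shows "v = 0"
proof (rule ccontr)
  assume "v \<noteq> 0"
  then have "int p \<le> \<bar>v\<bar>" using assms(1) by (intro zdvd_imp_le) auto
  then show False using assms(2) by linarith
qed

lemma sum_u_dvd: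
  assumes "\<And>j. j \<ge> m \<Longrightarrow> coeff G j = 0" "i + m \<le> D + d"
  shows "int p dvd (\<Sum>j<m. coeff G j * u (i + j)) - \<xi> * x ^ Suc i * poly G x"
proof -
  have e: "poly G x = (\<Sum>j<m. coeff G j * x ^ j)"
  proof -
    have "poly G x = (\<Sum>j\<le>degree G. coeff G j * x ^ j)" by (rule poly_altdef)
    also have "\<dots> = (\<Sum>j\<in>{..degree G} \<union> {..<m}. coeff G j * x ^ j)"
      by (rule sum.mono_neutral_left) (auto simp: coeff_eq_0)
    also have "\<dots> = (\<Sum>j<m. coeff G j * x ^ j)"
      by (rule sum.mono_neutral_right) (use assms(1) in auto)
    finally show ?thesis .
  qed
  have "(\<Sum>j<m. coeff G j * u (i + j)) - \<xi> * x ^ Suc i * poly G x = (\<Sum>j<m. coeff G j * (u (i + j) - \<xi> * x ^ Suc (i + j)))"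
    unfolding e by (simp add: sum_distrib_left sum_subtractf algebra_simps power_add)
  also have "int p dvd \<dots>"
  proof (rule dvd_sum)
    fix j assume "j \<in> {..<m}"
    then have "i + j < D + d" using assms(2) by simp
    from u[OF this] have "int p dvd u (i + j) - \<xi> * x ^ Suc (i + j)" by (simp only: mod_eq_dvd_iff)
    then show "int p dvd coeff G j * (u (i + j) - \<xi> * x ^ Suc (i + j))" by (rule dvd_mult)
  qed
  finally show ?thesis .
qed

text \<open>Induction along the recurrence with characteristic polynomial \<open>P\<close>: it holds
  for \<open>lam\<close> by construction, and for \<open>u\<close> because the corresponding sum is
  divisible by \<open>p\<close> and smaller than \<open>p\<close>.\<close>

lemma lam_monom: "l < D + d \<Longrightarrow> lam (monom 1 l) = of_int (u l)"
proof (induction l rule: less_induct)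
  case (less l)
  show ?case
  proof (cases "l < d")
    case False
    define i where "i = l - d"
    have l: "l = i + d" using False by (simp add: i_def)
    have "P = (\<Sum>j<Suc d. smult (coeff P j) (monom 1 j))" by (rule poly_as_sum_below) (auto simp: coeff_eq_0)
    then have "P * monom 1 i = (\<Sum>j<Suc d. smult (coeff P j) (monom 1 j)) * monom 1 i" by (rule arg_cong)
    also have "\<dots> = (\<Sum>j<Suc d. smult (coeff P j) (monom 1 (i + j)))"
      by (simp only: sum_distrib_right mult_smult_left mult_monom mult_1 add.commute)
    finally have "lam (P * monom 1 i) = lam (\<Sum>j<Suc d. smult (coeff P j) (monom 1 (i + j)))" by (rule arg_cong)
    then have "0 = lam (\<Sum>j<Suc d. smult (coeff P j) (monom 1 (i + j)))" by (simp only: lam_multiple)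
    also have "\<dots> = (\<Sum>j<Suc d. of_int (coeff P j) * lam (monom 1 (i + j)))" by (simp only: lam_sum lam_smult)
    also have "\<dots> = (\<Sum>j<d. of_int (coeff P j) * lam (monom 1 (i + j))) + of_int (lead_coeff P) * lam (monom 1 l)"
      by (simp add: l)
    also have "(\<Sum>j<d. of_int (coeff P j) * lam (monom 1 (i + j))) = (\<Sum>j<d. of_int (coeff P j) * of_int (u (i + j)))"
      using less l by (intro sum.cong refl arg_cong2[of _ _ _ _ "(*)"]) auto
    also have "\<dots> = of_int (\<Sum>j<d. coeff P j * u (i + j))" by simp
    finally have e1: "of_int (lead_coeff P) * lam (monom 1 l) = of_int (- (\<Sum>j<d. coeff P j * u (i + j)))" by simp
    have "int p dvd (\<Sum>j<Suc d. coeff P j * u (i + j)) - \<xi> * x ^ Suc i * poly P x"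
      by (rule sum_u_dvd) (use less.prems l in \<open>auto simp: coeff_eq_0\<close>)
    from dvd_add[OF this dvd_mult[OF Px, of "\<xi> * x ^ Suc i"]] have dv: "int p dvd (\<Sum>j<Suc d. coeff P j * u (i + j))"
      by (simp only: diff_add_cancel)
    have "\<bar>real_of_int (\<Sum>j<Suc d. coeff P j * u (i + j))\<bar> < real p"
    proof -
      have "\<bar>real_of_int (\<Sum>j<Suc d. coeff P j * u (i + j))\<bar> \<le> (\<Sum>j<Suc d. \<bar>real_of_int (coeff P j * u (i + j))\<bar>)"
        by (simp only: of_int_sum sum_abs)
      also have "\<dots> < (\<Sum>j<Suc d. \<eta> * real p)"
      proof (rule sum_strict_mono)
        fix j assume "j \<in> {..<Suc d}"
        then have "i + j < D + d" using less.prems l by simp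
        then have b: "\<bar>real_of_int (u (i + j))\<bar> < \<eta> * real p" by (rule ub)
        have "\<bar>real_of_int (coeff P j)\<bar> \<le> 1" using P1[of j] by linarith
        then have "\<bar>real_of_int (coeff P j)\<bar> * \<bar>real_of_int (u (i + j))\<bar> \<le> 1 * \<bar>real_of_int (u (i + j))\<bar>" by (rule mult_right_mono) simp
        then show "\<bar>real_of_int (coeff P j * u (i + j))\<bar> < \<eta> * real p" using b by (simp add: abs_mult)
      qed auto
      also have "\<dots> = (\<eta> * real (d + 1)) * real p" by simp
      also have "\<dots> \<le> 1 * real p" by (rule mult_right_mono[OF \<eta>(2)]) simp
      finally show ?thesis by simp
    qed
    from small_multiple_zero[OF dv this] have "lead_coeff P * u l = - (\<Sum>j<d. coeff P j * u (i + j))" by (simp add: l)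
    then have "of_int (lead_coeff P) * lam (monom 1 l) = of_int (lead_coeff P * u l)" using e1 by simp
    then show ?thesis using lc by auto
  qed (rule lam_monom_small)
qed

lemma lam_shift:
  assumes "\<And>j. j \<ge> m \<Longrightarrow> coeff G j = 0" "i + m \<le> D + d"
  shows "lam (G * monom 1 i) = of_int (\<Sum>j<m. coeff G j * u (i + j))"
proof -
  have "G = (\<Sum>j<m. smult (coeff G j) (monom 1 j))" by (rule poly_as_sum_below) (rule assms(1))
  then have "G * monom 1 i = (\<Sum>j<m. smult (coeff G j) (monom 1 j)) * monom 1 i" by (rule arg_cong)
  also have "\<dots> = (\<Sum>j<m. smult (coeff G j) (monom 1 (i + j)))"
    by (simp only: sum_distrib_right mult_smult_left mult_monom mult_1 add.commute)
  finally have "lam (G * monom 1 i) = (\<Sum>j<m. of_int (coeff G j) * lam (monom 1 (i + j)))" by (simp only: lam_sum lam_smult)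
  also have "\<dots> = (\<Sum>j<m. of_int (coeff G j) * of_int (u (i + j)))"
    using assms(2) by (intro sum.cong refl arg_cong2[of _ _ _ _ "(*)"] lam_monom) auto
  finally show ?thesis by simp
qed

text \<open>Testing against all multiples, rather than only \<open>lam G = 0\<close>, makes this an
  ideal; it contains \<open>P\<close>.\<close>

definition Ann :: "int poly set" where "Ann = {G. \<forall>A. lam (G * A) = 0}"

text \<open>As \<open>lam\<close> kills the multiples of \<open>P\<close>, it suffices to test
  against X^i with i < \<open>degree P\<close>. There \<open>lam\<close> is an integer that is
  divisible by \<open>p\<close> and smaller than \<open>p\<close> in absolute value.\<close>

lemma small_in_Ann:
  assumes G: "G \<in> box D \<kappa>" "int p dvd poly G x"
  shows "G \<in> Ann"
proof -
  have G0: "coeff G j = 0" if "j \<ge> D" for j using G(1) that by (simp add: box_def)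
  have z: "lam (G * monom 1 i) = 0" if i: "i < d" for i
  proof -
    have "int p dvd (\<Sum>j<D. coeff G j * u (i + j)) - \<xi> * x ^ Suc i * poly G x"
      by (rule sum_u_dvd) (use G0 i in auto)
    from dvd_add[OF this dvd_mult[OF G(2), of "\<xi> * x ^ Suc i"]] have dv: "int p dvd (\<Sum>j<D. coeff G j * u (i + j))"
      by (simp only: diff_add_cancel)
    have "\<bar>real_of_int (\<Sum>j<D. coeff G j * u (i + j))\<bar> < real p"
    proof -
      have "\<bar>real_of_int (\<Sum>j<D. coeff G j * u (i + j))\<bar> \<le> (\<Sum>j<D. \<bar>real_of_int (coeff G j * u (i + j))\<bar>)"
        by (simp only: of_int_sum sum_abs)
      also have "\<dots> < (\<Sum>j<D. \<kappa> * (\<eta> * real p))"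
      proof (rule sum_strict_mono)
        fix j assume "j \<in> {..<D}"
        then have "i + j < D + d" using i by simp
        then have b: "\<bar>real_of_int (u (i + j))\<bar> < \<eta> * real p" by (rule ub)
        have "\<bar>real_of_int (coeff G j)\<bar> \<le> \<kappa>" using G(1) by (simp add: box_def)
        then have "\<bar>real_of_int (coeff G j)\<bar> * \<bar>real_of_int (u (i + j))\<bar> \<le> \<kappa> * \<bar>real_of_int (u (i + j))\<bar>" by (rule mult_right_mono) simp
        also have "\<dots> < \<kappa> * (\<eta> * real p)" using b \<kappa> by (rule mult_strict_left_mono)
        finally show "\<bar>real_of_int (coeff G j * u (i + j))\<bar> < \<kappa> * (\<eta> * real p)" by (simp add: abs_mult)
      qed (use D in auto)
      also have "\<dots> = (\<eta> * real D * \<kappa>) * real p" by simp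
      also have "\<dots> \<le> 1 * real p" by (rule mult_right_mono[OF \<eta>(1)]) simp
      finally show ?thesis by simp
    qed
    from small_multiple_zero[OF dv this] show ?thesis using lam_shift[of D G i] G0 i by simp
  qed
  show ?thesis unfolding Ann_def
  proof (intro CollectI allI)
    fix A
    define P' where "P' = smult (lead_coeff P) P"
    have "monic P'" "degree P' = d" using lc by (auto simp: P'_def)
    then obtain R where R: "\<And>i. i \<ge> d \<Longrightarrow> coeff R i = 0" "P' dvd A - R" using monic_division[of P' A] by auto
    obtain W where "A - R = P' * W" using R(2) by (elim dvdE)
    then have AR: "A = P * smult (lead_coeff P) W + R" by (simp add: P'_def algebra_simps)
    have "R = (\<Sum>j<d. smult (coeff R j) (monom 1 j))" by (rule poly_as_sum_below) (rule R(1))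
    then have "G * R = G * (\<Sum>j<d. smult (coeff R j) (monom 1 j))" by (rule arg_cong)
    also have "\<dots> = (\<Sum>j<d. smult (coeff R j) (G * monom 1 j))" by (simp only: sum_distrib_left mult_smult_right)
    finally have "lam (G * R) = 0" using z by (simp only: lam_sum lam_smult) simp
    moreover have "G * A = P * (G * smult (lead_coeff P) W) + G * R" unfolding AR by (simp add: algebra_simps)
    ultimately show "lam (G * A) = 0" by (simp only: lam_add lam_multiple)
  qed
qed

lemma Ann_ideal: "G \<in> Ann \<Longrightarrow> H \<in> Ann \<Longrightarrow> a * G + b * H \<in> Ann"
proof -
  assume *: "G \<in> Ann" "H \<in> Ann"
  have "lam ((a * G + b * H) * A) = 0" for A
  proof -
    have "(a * G + b * H) * A = G * (a * A) + H * (b * A)" by (simp add: algebra_simps)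
    then show ?thesis using * by (simp add: lam_add Ann_def)
  qed
  then show ?thesis by (simp add: Ann_def)
qed

lemma Ann_smultD: "smult c G \<in> Ann \<Longrightarrow> c \<noteq> 0 \<Longrightarrow> G \<in> Ann"
  by (simp add: Ann_def lam_smult)

text \<open>An ideal of integer polynomials need not be principal, but \<open>Ann\<close> is stable
  under division by integers (\<open>Ann_smultD\<close>), so the gcd from
  \<open>int_poly_bezout\<close> stays in it. The leading coefficient of \<open>P\<close> forces the
  remaining constant factor to be a unit.\<close>

lemma Ann_generator:
  "\<exists>D0. D0 dvd P \<and> D0 \<in> Ann \<and> (\<forall>G\<in>Ann. D0 dvd G)"
proof -
  have "P \<in> Ann" by (simp add: Ann_def lam_multiple)
  then obtain D0 where D0: "D0 dvd P" "D0 \<in> Ann" and min: "\<And>E. E dvd P \<Longrightarrow> E \<in> Ann \<Longrightarrow> degree D0 \<le> degree E"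
    using ex_has_least_nat[of "\<lambda>E. E dvd P \<and> E \<in> Ann" P degree] by auto
  have P0: "P \<noteq> 0" using lc by auto
  have D00: "D0 \<noteq> 0" using D0(1) P0 by auto
  have "D0 dvd G" if G: "G \<in> Ann" for G
  proof -
    obtain e c a b where e: "c \<noteq> 0" "e dvd G" "e dvd D0" "smult c e = a * G + b * D0"
      using int_poly_bezout[OF D00, of G] by blast
    have "e \<in> Ann" using Ann_ideal[OF G D0(2), of a b] e(1,4) by (metis Ann_smultD)
    then have le: "degree D0 \<le> degree e" using min e(3) D0(1) by (meson dvd_trans)
    obtain k where k: "D0 = e * k" using e(3) by (elim dvdE)
    have ek: "e \<noteq> 0" "k \<noteq> 0" using k D00 by auto
    then have "degree k = 0" using le k by (simp add: degree_mult_eq)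
    then obtain k0 where k0: "k = [:k0:]" by (rule degree_eq_zeroE)
    obtain w where w: "P = D0 * w" using D0(1) by (elim dvdE)
    have "lead_coeff P = lead_coeff e * k0 * lead_coeff w" unfolding w k k0 by (simp add: lead_coeff_mult)
    then have "k0 dvd lead_coeff P" by simp
    then have "k0 dvd 1" using lc by auto
    then have "k0 * k0 = 1" by (auto simp: zdvd1_eq abs_if split: if_splits)
    then have "e = D0 * k" unfolding k k0 by simp
    then have "D0 dvd e" by (rule dvdI)
    then show ?thesis using e(2) by (rule dvd_trans)
  qed
  then show ?thesis using D0 by blast
qed

text \<open>As \<open>lam\<close> vanishes at the generator \<open>D0\<close> and both \<xi> and x
  are invertible modulo \<open>p\<close>, \<open>D0\<close> has the root x modulo \<open>p\<close>.
  Hence so does one of its irreducible factors, and that factor divides all of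
  \<open>Ann\<close>.\<close>

theorem common_factor:
  "\<exists>g. monic g \<and> irreducible g \<and> g dvd P \<and> int p dvd poly g x \<and> (\<forall>G\<in>box D \<kappa>. int p dvd poly G x \<longrightarrow> g dvd G)"
proof -
  obtain D0 where D0: "D0 dvd P" "D0 \<in> Ann" "\<And>G. G \<in> Ann \<Longrightarrow> D0 dvd G" using Ann_generator by blast
  have P0: "P \<noteq> 0" using lc by auto
  have dD: "degree D0 \<le> d" using D0(1) P0 by (rule dvd_imp_degree_le)
  have z: "coeff D0 j = 0" if "j \<ge> Suc d" for j using that dD by (intro coeff_eq_0) auto
  have le: "0 + Suc d \<le> D + d" using D by simp
  have "lam (D0 * monom 1 0) = 0" using D0(2) unfolding Ann_def by blast
  then have "(\<Sum>j<Suc d. coeff D0 j * u (0 + j)) = 0"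
    using lam_shift[OF z le] by (simp only: of_int_eq_0_iff)
  then have "int p dvd 0 - \<xi> * x ^ Suc 0 * poly D0 x" using sum_u_dvd[OF z le] by simp
  then have "int p dvd \<xi> * (x * poly D0 x)" by (simp add: mult.assoc)
  then have Dx: "int p dvd poly D0 x" using p x \<xi> by (simp add: prime_dvd_mult_iff)
  obtain w where w: "P = D0 * w" using D0(1) by (elim dvdE)
  have "lead_coeff D0 dvd lead_coeff P" unfolding w by (simp add: lead_coeff_mult)
  then have "lead_coeff D0 dvd 1" using lc by auto
  then have "lead_coeff D0 = 1 \<or> lead_coeff D0 = -1" by (auto simp: zdvd1_eq)
  from monic_prime_factor_mod[OF this p Dx] obtain g where g: "monic g" "irreducible g" "g dvd D0" "int p dvd poly g x" by blast
  then show ?thesis using D0 small_in_Ann by (meson dvd_trans)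
qed

end

section \<open>From the Lehmer conjecture to wild primes\<close>

lemma card_image_le_if_determined:
  assumes "finite A" "\<And>a b. a \<in> A \<Longrightarrow> b \<in> A \<Longrightarrow> \<phi> a = \<phi> b \<Longrightarrow> f a = f b"
  shows "card (f ` A) \<le> card (\<phi> ` A)"
proof -
  define \<psi> where "\<psi> v = f (SOME a. a \<in> A \<and> \<phi> a = v)" for v
  have "f a = \<psi> (\<phi> a)" if a: "a \<in> A" for a
  proof -
    have "(SOME b. b \<in> A \<and> \<phi> b = \<phi> a) \<in> A \<and> \<phi> (SOME b. b \<in> A \<and> \<phi> b = \<phi> a) = \<phi> a"
      by (rule someI[of "\<lambda>b. b \<in> A \<and> \<phi> b = \<phi> a" a]) (use a in simp)
    then show ?thesis unfolding \<psi>_def using assms(2)[OF a] by metis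
  qed
  then have "f ` A \<subseteq> \<psi> ` \<phi> ` A" by auto
  then have "card (f ` A) \<le> card (\<psi> ` \<phi> ` A)" using assms(1) by (intro card_mono) auto
  also have "\<dots> \<le> card (\<phi> ` A)" using assms(1) by (intro card_image_le) auto
  finally show ?thesis .
qed

lemma small_relation_exists:
  assumes p: "p > 0" and m: "p < 2 ^ m"
  shows "\<exists>P::int poly. (lead_coeff P = 1 \<or> lead_coeff P = -1) \<and> (\<forall>i. \<bar>coeff P i\<bar> \<le> 1) \<and> degree P < m \<and> int p dvd poly P x"
proof -
  define \<phi> where "\<phi> f = poly f x mod int p" for f :: "int poly"
  have "\<phi> ` nbox m 2 \<subseteq> {0..<int p}" using p by (auto simp: \<phi>_def)
  then have "card (\<phi> ` nbox m 2) \<le> card {0..<int p}" by (intro card_mono) auto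
  then have "card (\<phi> ` nbox m 2) < card (nbox m 2)" using m card_nbox[of m 2] by simp
  then have "\<not> inj_on \<phi> (nbox m 2)" using card_image by force
  then obtain f h where fh: "f \<in> nbox m 2" "h \<in> nbox m 2" "\<phi> f = \<phi> h" "f \<noteq> h" by (auto simp: inj_on_def)
  define P where "P = f - h"
  have P0: "P \<noteq> 0" using fh(4) by (simp add: P_def)
  have c0: "coeff P i = 0" if "i \<ge> m" for i using fh(1,2) that by (simp add: P_def nbox_def)
  have c1: "\<bar>coeff P i\<bar> \<le> 1" for i
  proof (cases "i < m")
    case True
    then have "coeff f i \<in> {0..<2}" "coeff h i \<in> {0..<2}" using fh(1,2) by (auto simp: nbox_def)
    then show ?thesis by (auto simp: P_def)
  next
    case False
    then show ?thesis using c0[of i] by simp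
  qed
  have "lead_coeff P \<noteq> 0" using P0 by simp
  then have "lead_coeff P = 1 \<or> lead_coeff P = -1" using c1[of "degree P"] by linarith
  moreover have "degree P < m"
  proof (rule ccontr)
    assume "\<not> degree P < m"
    then show False using c0[of "degree P"] P0 by simp
  qed
  moreover have "int p dvd poly P x" using fh(3) unfolding \<phi>_def P_def by (simp add: mod_eq_dvd_iff)
  ultimately show ?thesis using c1 by blast
qed

lemma int_min_poly_eq:
  assumes "irreducible g" "monic g" "cpoly g \<alpha> = 0"
  shows "algebraic \<alpha>" "int_min_poly \<alpha> = g"
proof -
  show alg: "algebraic \<alpha>"
    by (rule algebraicI[of "of_int_poly g"]) (use assms in auto)
  have "is_int_min_poly \<alpha> g" using assms by (simp add: is_int_min_poly_def)
  then show "int_min_poly \<alpha> = g" unfolding int_min_poly_def by (rule the1_equality[OF ex1_int_min_poly[OF alg]])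
qed

text \<open>Transfers \<open>small_multiplier_exists\<close> to the notions of wildness; the
  \<open>- 1\<close> in the last hypothesis pays for rounding the permitted number of summands down
  to an integer.\<close>

lemma not_sum_imp_small_multiples:
  assumes p: "prime p" and C: "C > 0" and y: "\<not> sum_of_at_most (log 2 (real p) powr C) p (geom_prog C p x) y"
    and \<eta>: "\<eta> > 0" and K: "(log 2 (real p) powr C - 1) * \<eta>\<^sup>2 \<ge> 16 * (C * log 2 (real p) + 1) * ln (real p)"
  shows "\<exists>\<xi> u. \<not> int p dvd \<xi> \<and> (\<forall>l. real (Suc l) \<le> C * log 2 (real p) \<longrightarrow>
     u l mod int p = (\<xi> * int x ^ Suc l) mod int p \<and> \<bar>real_of_int (u l)\<bar> < \<eta> * real p)"
proof -
  define ll where "ll = log 2 (real p)"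
  define L where "L = nat \<lfloor>C * ll\<rfloor>"
  define K' where "K' = nat \<lfloor>ll powr C\<rfloor>"
  define hs where "hs = map (\<lambda>i. int (x ^ i mod p)) [1..<Suc L]"
  have set_hs: "set hs = (\<lambda>i. int (x ^ i mod p)) ` {1..L}"
    unfolding hs_def by (simp only: set_map set_upt atLeastLessThanSuc_atLeastAtMost)
  have len_hs: "length hs = L" by (simp add: hs_def del: upt_Suc)
  have p1: "p > 1" by (rule prime_gt_1_nat[OF p])
  have ll0: "ll \<ge> 0" using p1 by (simp add: ll_def)
  have Lr: "real L \<le> C * ll" unfolding L_def using C ll0 by (intro of_nat_floor) auto
  have K'r: "real K' \<le> ll powr C" "ll powr C - 1 \<le> real K'" unfolding K'_def by (auto intro: of_nat_floor)
  have norep: "\<not> (\<exists>xs. set xs \<subseteq> set hs \<and> length xs \<le> K' \<and> int p dvd int y - sum_list xs)"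
  proof
    assume "\<exists>xs. set xs \<subseteq> set hs \<and> length xs \<le> K' \<and> int p dvd int y - sum_list xs"
    then obtain xs where xs: "set xs \<subseteq> set hs" "length xs \<le> K'" "int p dvd int y - sum_list xs" by blast
    have sub: "nat h \<in> geom_prog C p x \<and> int (nat h) = h" if "h \<in> set hs" for h
    proof -
      obtain i where i: "i \<in> {1..L}" "h = int (x ^ i mod p)" using \<open>h \<in> set hs\<close> unfolding set_hs by (elim imageE)
      have "nat h = x ^ i mod p" unfolding i(2) by (rule nat_int)
      moreover have "x ^ i mod p \<in> geom_prog C p x"
        unfolding geom_prog_def using i(1) by (auto simp: L_def ll_def)
      ultimately show ?thesis by (simp only: i(2))
    qed
    define ys where "ys = map nat xs"
    have "set ys \<subseteq> geom_prog C p x" using xs(1) sub by (auto simp: ys_def)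
    moreover have "real (length ys) \<le> log 2 (real p) powr C" using xs(2) K'r(1) by (simp add: ys_def ll_def)
    moreover have "int (sum_list ys) = sum_list xs"
      using xs(1) unfolding ys_def
    proof (induction xs)
      case (Cons h xs)
      then show ?case using sub[of h] by simp
    qed simp
    then have "int p dvd int y - int (sum_list ys)" using xs(3) by simp
    then have "int y mod int p = int (sum_list ys) mod int p" by (simp only: mod_eq_dvd_iff)
    then have "int (sum_list ys mod p) = int (y mod p)" by (simp only: zmod_int)
    then have "[sum_list ys = y] (mod p)" unfolding unique_euclidean_semiring_class.cong_def by (simp only: of_nat_eq_iff)
    ultimately show False using y unfolding sum_of_at_most_def by blast
  qed
  have "16 * (real (length hs) + 1) * ln (real p) \<le> 16 * (C * ll + 1) * ln (real p)"
    using Lr p1 by (intro mult_right_mono) (auto simp: len_hs)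
  also have "\<dots> \<le> (ll powr C - 1) * \<eta>\<^sup>2" using K by (simp add: ll_def)
  also have "\<dots> \<le> real K' * \<eta>\<^sup>2" using K'r(2) by (intro mult_right_mono) auto
  finally have Kc: "real K' * \<eta>\<^sup>2 \<ge> 16 * (real (length hs) + 1) * ln (real p)" .
  obtain \<xi> where \<xi>: "\<xi> \<in> {1..<p}" "\<And>h. h \<in> set hs \<Longrightarrow> \<exists>u. u mod int p = (int \<xi> * h) mod int p \<and> \<bar>real_of_int u\<bar> < \<eta> * real p"
    using small_multiplier_exists[OF p1 norep \<eta> Kc] by blast
  have "\<exists>v. real (Suc l) \<le> C * ll \<longrightarrow> v mod int p = (int \<xi> * int x ^ Suc l) mod int p \<and> \<bar>real_of_int v\<bar> < \<eta> * real p" for l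
  proof (cases "real (Suc l) \<le> C * ll")
    case True
    then have "Suc l \<le> L" unfolding L_def by (simp add: le_nat_floor)
    then have "int (x ^ Suc l mod p) \<in> set hs" unfolding set_hs by (intro imageI) simp
    from \<xi>(2)[OF this] obtain v where v: "v mod int p = (int \<xi> * int (x ^ Suc l mod p)) mod int p" "\<bar>real_of_int v\<bar> < \<eta> * real p" by blast
    have "(int \<xi> * int (x ^ Suc l mod p)) mod int p = (int \<xi> * int x ^ Suc l) mod int p"
      by (simp only: zmod_int of_nat_power mod_mult_right_eq) (simp add: zmod_int mod_mult_right_eq)
    then show ?thesis using v by auto
  qed simp
  then obtain u where "\<And>l. real (Suc l) \<le> C * ll \<longrightarrow> u l mod int p = (int \<xi> * int x ^ Suc l) mod int p \<and> \<bar>real_of_int (u l)\<bar> < \<eta> * real p"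
    by metis
  moreover have "\<not> int p dvd int \<xi>" using \<xi>(1) nat_dvd_not_less[of \<xi> p] by auto
  ultimately show ?thesis unfolding ll_def by blast
qed

context monic_irreducible
begin

lemma root_exists: "\<exists>\<alpha>. \<alpha> \<in> roots"
  using card_roots n_pos by (metis card.empty equals0I less_irrefl)

text \<open>If a root of \<open>g\<close> is a root of unity, its order, and hence that of
  \<open>x\<close>, is at most 2 n^2, so (log p)^2 \<le> 2 n^2. But polynomials of length
  \<open>n\<close> with coefficients 0 to 7 take distinct values at \<open>x\<close> modulo
  \<open>p\<close>, so 8^n \<le> p and 9 n^2 \<le> (log p)^2. Otherwise there are at most
  \<open>p\<close> classes of polynomials of length \<open>D\<close>, while \<open>msr ^ D\<close>
  exceeds p^2.\<close>

lemma contradiction_if_relations_divisible: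
  assumes p: "prime p" and x: "x \<in> {1..<p}" "real (ord p x) \<ge> (log 2 (real p))\<^sup>2"
    and gx: "int p dvd poly g (int x)"
    and P: "g dvd P" "lead_coeff P = 1 \<or> lead_coeff P = -1" "\<And>i. \<bar>coeff P i\<bar> \<le> 1"
    and rel: "\<And>G. G \<in> box D \<kappa> \<Longrightarrow> int p dvd poly G (int x) \<Longrightarrow> g dvd G"
    and \<kappa>: "\<kappa> \<ge> 2 * real (degree P + 2)" "\<kappa> \<ge> 7" and D: "D \<ge> n" "D > 0" "real p ^ 2 \<le> (1 + c0) ^ D"
    and lehmer: "\<And>\<alpha>. algebraic \<alpha> \<Longrightarrow> \<alpha> \<noteq> 0 \<Longrightarrow> \<not> (\<exists>n>0. \<alpha> ^ n = 1) \<Longrightarrow> algebraic_mahler_measure \<alpha> > 1 + c0" and c0: "c0 > 0"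
  shows False
proof -
  have p0: "p > 0" using p by (simp add: prime_gt_0_nat)
  have p1: "p > 1" by (rule prime_gt_1_nat[OF p])
  have px: "\<not> int p dvd int x" using x(1) nat_dvd_not_less[of x p] by auto
  define \<phi> where "\<phi> f = poly f (int x) mod int p" for f :: "int poly"
  have card\<phi>: "card (\<phi> ` A) \<le> p" for A
  proof -
    have "card (\<phi> ` A) \<le> card {0..<int p}" using p0 by (intro card_mono) (auto simp: \<phi>_def)
    then show ?thesis by simp
  qed
  have determined: "g dvd a - b" if "a \<in> box D k1" "b \<in> box D k2" "k1 + k2 \<le> \<kappa>" "\<phi> a = \<phi> b" for a b k1 k2
  proof (rule rel)
    show "int p dvd poly (a - b) (int x)" using that(4) unfolding \<phi>_def by (simp add: mod_eq_dvd_iff)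
    show "a - b \<in> box D \<kappa>"
    proof (rule boxI)
      fix i
      have "\<bar>real_of_int (coeff a i)\<bar> \<le> k1" "\<bar>real_of_int (coeff b i)\<bar> \<le> k2" using that(1,2) by (auto simp: box_def)
      then show "\<bar>real_of_int (coeff (a - b) i)\<bar> \<le> \<kappa>" using that(3) by simp
    qed (use that(1,2) in \<open>simp add: box_def\<close>)
  qed
  obtain \<alpha> where \<alpha>: "\<alpha> \<in> roots" using root_exists by blast
  have g\<alpha>: "cpoly g \<alpha> = 0" using \<alpha> by (simp add: roots_def)
  have \<alpha>0: "\<alpha> \<noteq> 0"
  proof
    assume "\<alpha> = 0"
    then have "cpoly (monom 1 1) \<alpha> = 0" by (simp add: poly_monom)
    then have "g dvd monom 1 1" by (rule root_imp_dvd[OF \<alpha>])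
    then obtain k where k: "monom 1 1 = g * k" by (elim dvdE)
    have "poly (monom 1 1) (int x) = poly (g * k) (int x)" by (simp only: k)
    then have "int x = poly g (int x) * poly k (int x)" by (simp add: poly_monom)
    then have "int p dvd int x" using gx by (metis dvd_mult2)
    then show False using px by simp
  qed
  show False
  proof (cases "\<exists>k>0. \<alpha> ^ k = 1")
    case True
    then obtain m where m: "m > 0" "\<alpha> ^ m = 1" "m \<le> 2 * n\<^sup>2" using root_of_unity_order_le[OF \<alpha>] by blast
    have "g dvd monom 1 m - 1" by (rule root_imp_dvd[OF \<alpha>]) (use m(2) in \<open>simp add: poly_monom\<close>)
    then obtain k where k: "monom 1 m - 1 = g * k" by (elim dvdE)
    have "poly (monom 1 m - 1) (int x) = poly (g * k) (int x)" by (simp only: k)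
    then have "int x ^ m - 1 = poly g (int x) * poly k (int x)" by (simp add: poly_monom)
    then have "int p dvd int x ^ m - 1" using gx by simp
    then have "[int (x ^ m) = int 1] (mod int p)" by (simp add: cong_iff_dvd_diff)
    then have "[x ^ m = 1] (mod p)" by (simp only: cong_int_iff)
    then have "ord p x dvd m" by (simp only: ord_divides)
    then have "ord p x \<le> m" using m(1) by (rule dvd_imp_le)
    then have "real (ord p x) \<le> real (2 * n\<^sup>2)" using m(3) by (simp only: of_nat_le_iff)
    then have l2: "(log 2 (real p))\<^sup>2 \<le> 2 * (real n)\<^sup>2" using x(2) by simp
    have "inj_on \<phi> (nbox n 8)"
    proof (rule inj_onI)
      fix a b assume ab: "a \<in> nbox n 8" "b \<in> nbox n 8" "\<phi> a = \<phi> b"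
      have "g dvd a - b"
      proof (rule rel)
        show "int p dvd poly (a - b) (int x)" using ab(3) unfolding \<phi>_def by (simp add: mod_eq_dvd_iff)
        show "a - b \<in> box D \<kappa>"
        proof (rule boxI)
          show "coeff (a - b) i = 0" if "i \<ge> D" for i using ab(1,2) that D(1) by (simp add: nbox_def)
          fix i
          show "\<bar>real_of_int (coeff (a - b) i)\<bar> \<le> \<kappa>"
          proof (cases "i < n")
            case True
            then have "coeff a i \<in> {0..<8}" "coeff b i \<in> {0..<8}" using ab(1,2) by (auto simp: nbox_def)
            then have "\<bar>coeff a i - coeff b i\<bar> \<le> 7" by auto
            then have "\<bar>real_of_int (coeff (a - b) i)\<bar> \<le> 7" unfolding coeff_diff by linarith
            then show ?thesis using \<kappa>(2) by linarith
          next
            case False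
            then show ?thesis using ab(1,2) \<kappa>(2) by (simp add: nbox_def)
          qed
        qed
      qed
      then have "a - b = 0" by (rule dvd_small_zero) (use ab(1,2) in \<open>simp add: nbox_def\<close>)
      then show "a = b" by simp
    qed
    then have "card (nbox n 8) = card (\<phi> ` nbox n 8)" by (simp add: card_image)
    then have "8 ^ n \<le> p" using card\<phi>[of "nbox n 8"] card_nbox[of n 8] by simp
    then have "real (8 ^ n) \<le> real p" by (simp only: of_nat_le_iff)
    then have "log 2 (real (8 ^ n)) \<le> log 2 (real p)" by (intro log_mono) auto
    moreover have "log 2 (real (8 ^ n)) = 3 * real n"
    proof -
      have "log 2 8 = log 2 (2 ^ 3 :: real)" by simp
      also have "\<dots> = 3" by (simp only: log_nat_power) simp
      finally show ?thesis by (simp add: log_nat_power)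
    qed
    ultimately have "3 * real n \<le> log 2 (real p)" by simp
    then have "(3 * real n)\<^sup>2 \<le> (log 2 (real p))\<^sup>2" by (intro power_mono) auto
    then have "9 * (real n)\<^sup>2 \<le> (log 2 (real p))\<^sup>2" by (simp add: power_mult_distrib)
    then have "7 * (real n)\<^sup>2 \<le> 0" using l2 by linarith
    then show False using n_pos by simp
  next
    case False
    have msr_gt: "msr > 1 + c0"
      using lehmer[OF int_min_poly_eq(1)[OF irr monic g\<alpha>] \<alpha>0 False] int_min_poly_eq(2)[OF irr monic g\<alpha>] mahler_g
      by (simp add: algebraic_mahler_measure_def msr_def)
    let ?k = "real (degree P + 2)"
    have fin: "finite (box D ?k)" using card_box[of ?k D] by simp
    have "card (red ` box D ?k) \<le> card (\<phi> ` box D ?k)"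
    proof (rule card_image_le_if_determined[OF fin])
      fix a b assume "a \<in> box D ?k" "b \<in> box D ?k" "\<phi> a = \<phi> b"
      then have "g dvd a - b" using \<kappa>(1) by (intro determined[of a ?k b ?k]) auto
      then show "red a = red b" by (simp only: red_eq_iff)
    qed
    then have "card (red ` box D ?k) \<le> p" using card\<phi> le_trans by blast
    then have "real (card (red ` box D ?k)) ^ 2 \<le> real p ^ 2" by (intro power_mono) auto
    then have "msr ^ D \<le> (1 + c0) ^ D" using msr_power_le[OF P D(2)] D(3) by linarith
    moreover have "(1 + c0) ^ D < msr ^ D" using msr_gt c0 D(2) by (intro power_strict_mono) auto
    ultimately show False by linarith
  qed
qed

end

theorem lehmer_imp_not_wild:
  assumes lehmer_conjecture
  shows "\<exists>C>1. \<exists>p0. \<forall>p\<ge>p0. \<not> wild C p"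
proof -
  obtain c0 where c0: "c0 > 0" and leh: "\<And>\<alpha>. algebraic \<alpha> \<Longrightarrow> \<alpha> \<noteq> 0 \<Longrightarrow> \<not> (\<exists>n>0. \<alpha> ^ n = 1) \<Longrightarrow> algebraic_mahler_measure \<alpha> > 1 + c0"
    using assms unfolding lehmer_conjecture_def by blast
  \<comment> \<open>Then (1 + c0)^(b log p) = p^2, the bound for the square of the number of
    classes.\<close>
  define b where "b = 2 / log 2 (1 + c0)"
  have lg: "log 2 (1 + c0) > 0" using c0 by simp
  have b: "b > 0" using lg by (simp add: b_def)
  \<comment> \<open>The surplus 20 lets the progression cover \<open>D + degree P\<close> terms and
    leaves a power of log p large enough for the Fourier argument with \<eta> = (log
    p)^(-3).\<close>
  define C where "C = b + 20"
  have "\<forall>\<^sub>F l::real in at_top. 1 \<le> l \<and> 16 * (C * l + 1) * l \<le> (l ^ 20 - 1) * (1 / l ^ 3)\<^sup>2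
      \<and> (b * l + l + 3) * (2 * l + 20) \<le> l ^ 3"
    using b unfolding C_def by (intro eventually_conj) real_asymp+
  then obtain l0 where l0: "\<And>l::real. l \<ge> l0 \<Longrightarrow> 1 \<le> l \<and> 16 * (C * l + 1) * l \<le> (l ^ 20 - 1) * (1 / l ^ 3)\<^sup>2
      \<and> (b * l + l + 3) * (2 * l + 20) \<le> l ^ 3"
    by (auto simp: eventually_at_top_linorder)
  have "\<not> wild C p" if pl: "p \<ge> nat \<lceil>2 powr l0\<rceil>" for p
  proof
    assume w: "wild C p"
    then have p: "prime p" by (simp add: wild_def)
    obtain x y where x: "x \<in> {1..<p}" "real (ord p x) \<ge> (log 2 (real p))\<^sup>2"
      and y: "\<not> sum_of_at_most (log 2 (real p) powr C) p (geom_prog C p x) y"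
      using w unfolding wild_def by blast
    define ll where "ll = log 2 (real p)"
    have p0: "real p > 0" using p by (simp add: prime_gt_0_nat)
    have "2 powr l0 \<le> real p" using pl by linarith
    then have "l0 \<le> ll" unfolding ll_def using p0 by (subst le_log_iff) auto
    from l0[OF this] have l1: "1 \<le> ll" and l2: "16 * (C * ll + 1) * ll \<le> (ll ^ 20 - 1) * (1 / ll ^ 3)\<^sup>2"
      and l3: "(b * ll + ll + 3) * (2 * ll + 20) \<le> ll ^ 3" by auto
    \<comment> \<open>The cube suffices because \<open>D * \<kappa>\<close> is only of order (log
      p)^2.\<close>
    define \<eta> where "\<eta> = 1 / ll ^ 3"
    have \<eta>: "\<eta> > 0" using l1 by (simp add: \<eta>_def)
    have C1: "C > 1" using b by (simp add: C_def)
    have K: "(log 2 (real p) powr C - 1) * \<eta>\<^sup>2 \<ge> 16 * (C * log 2 (real p) + 1) * ln (real p)"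
    proof -
      have "ln (real p) = ll * ln 2" by (simp add: ll_def log_def)
      also have "\<dots> \<le> ll * 1" using l1 ln_le_minus_one[of "2::real"] by (intro mult_left_mono) auto
      finally have "16 * (C * ll + 1) * ln (real p) \<le> 16 * (C * ll + 1) * ll"
        using C1 l1 by (intro mult_left_mono) auto
      also have "\<dots> \<le> (ll ^ 20 - 1) * \<eta>\<^sup>2" using l2 by (simp add: \<eta>_def)
      also have "\<dots> \<le> (ll powr C - 1) * \<eta>\<^sup>2"
      proof (rule mult_right_mono)
        have "ll ^ 20 = ll powr 20" using l1 by (simp add: powr_numeral)
        also have "\<dots> \<le> ll powr C" using l1 b by (intro powr_mono) (auto simp: C_def)
        finally show "ll ^ 20 - 1 \<le> ll powr C - 1" by simp
      qed simp
      finally show ?thesis by (simp add: ll_def)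
    qed
    have C0: "C > 0" using C1 by simp
    obtain \<xi> u where \<xi>: "\<not> int p dvd \<xi>" and uu: "\<And>l. real (Suc l) \<le> C * ll \<Longrightarrow>
       u l mod int p = (\<xi> * int x ^ Suc l) mod int p \<and> \<bar>real_of_int (u l)\<bar> < \<eta> * real p"
      using not_sum_imp_small_multiples[OF p C0 y \<eta> K] unfolding ll_def by blast
    have u: "\<And>l. real (Suc l) \<le> C * ll \<Longrightarrow> u l mod int p = (\<xi> * int x ^ Suc l) mod int p"
      "\<And>l. real (Suc l) \<le> C * ll \<Longrightarrow> \<bar>real_of_int (u l)\<bar> < \<eta> * real p"
      using uu by blast+
    define m where "m = nat \<lfloor>ll\<rfloor> + 1"
    have mr: "ll < real m" "real m \<le> ll + 1" using l1 unfolding m_def by linarith+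
    have "real p = 2 powr ll" using p0 by (simp add: ll_def)
    also have "\<dots> < 2 powr real m" using mr by simp
    also have "\<dots> = real (2 ^ m)" by (simp add: powr_realpow)
    finally have "p < 2 ^ m" by (simp only: of_nat_less_iff)
    then obtain P :: "int poly" where P: "lead_coeff P = 1 \<or> lead_coeff P = -1" "\<And>i. \<bar>coeff P i\<bar> \<le> 1" "degree P < m" "int p dvd poly P (int x)"
      using small_relation_exists[of p m "int x"] p0 by auto
    define D where "D = nat \<lceil>b * ll\<rceil> + m"
    have dr: "real (degree P) \<le> ll" using P(3) mr by linarith
    have Dr: "b * ll \<le> real D" "real D \<le> b * ll + ll + 2"
      using b l1 mr mult_nonneg_nonneg[of b ll] unfolding D_def by linarith+
    \<comment> \<open>Large enough for differences of two polynomials of height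
      \<open>degree P + 2\<close> and for differences of digits between 0 and 7.\<close>
    define \<kappa> where "\<kappa> = 2 * real (degree P + 2) + 7"
    have kr: "\<kappa> \<le> 2 * ll + 20" "\<kappa> > 0" using dr by (auto simp: \<kappa>_def)
    have CL: "real (Suc l) \<le> C * ll" if "l < D + degree P" for l
    proof -
      have "real (Suc l) \<le> real D + real (degree P)" using that by linarith
      also have "\<dots> \<le> b * ll + ll + 2 + ll" using Dr dr by linarith
      also have "\<dots> \<le> C * ll" using l1 by (simp add: C_def algebra_simps)
      finally show ?thesis .
    qed
    have e1: "\<eta> * real D * \<kappa> \<le> 1"
    proof -
      have "real D * \<kappa> \<le> (b * ll + ll + 3) * (2 * ll + 20)" using Dr kr b l1 by (intro mult_mono) auto
      then have "real D * \<kappa> \<le> ll ^ 3" using l3 by linarith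
      then show ?thesis using l1 by (simp add: \<eta>_def)
    qed
    have e2: "\<eta> * real (degree P + 1) \<le> 1"
    proof -
      have "real (degree P + 1) \<le> real D" using P(3) by (simp add: D_def)
      also have "\<dots> \<le> real D * \<kappa>" using mult_left_mono[of 1 \<kappa> "real D"] by (simp add: \<kappa>_def)
      finally have "\<eta> * real (degree P + 1) \<le> \<eta> * (real D * \<kappa>)" using \<eta> by (intro mult_left_mono) auto
      then show ?thesis using e1 by (simp add: mult.assoc)
    qed
    have D0: "D > 0" by (simp add: D_def m_def)
    have px: "\<not> int p dvd int x" using x(1) nat_dvd_not_less[of x p] by auto
    interpret R: small_recurrence p "int x" \<xi> u P D \<kappa> \<eta>
      by unfold_locales (use p px \<xi> P CL u e1 e2 D0 kr in auto)
    obtain g where g: "monic g" "irreducible g" "g dvd P" "int p dvd poly g (int x)"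
      "\<And>G. G \<in> box D \<kappa> \<Longrightarrow> int p dvd poly G (int x) \<Longrightarrow> g dvd G"
      using R.common_factor by blast
    interpret G: monic_irreducible g "degree g" by unfold_locales (use g in auto)
    have "degree g \<le> degree P" using g(3) P(1) by (intro dvd_imp_degree_le) auto
    then have Dn: "D \<ge> degree g" using P(3) by (simp add: D_def)
    have "real p ^ 2 \<le> (1 + c0) ^ D"
    proof -
      have "real p ^ 2 = 2 powr (2 * ll)" using p0 by (simp add: ll_def powr_mult_base powr_powr[symmetric] mult.commute[of 2] powr_numeral)
      also have "2 * ll = log 2 (1 + c0) * (b * ll)" using lg by (simp add: b_def)
      also have "2 powr (log 2 (1 + c0) * (b * ll)) = (2 powr log 2 (1 + c0)) powr (b * ll)" by (simp only: powr_powr)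
      also have "\<dots> = (1 + c0) powr (b * ll)" using c0 by simp
      also have "\<dots> \<le> (1 + c0) powr real D" using c0 Dr by (intro powr_mono) auto
      also have "\<dots> = (1 + c0) ^ D" using c0 by (simp add: powr_realpow)
      finally show ?thesis .
    qed
    note pD = this
    have k1: "\<kappa> \<ge> 2 * real (degree P + 2)" "\<kappa> \<ge> 7" by (simp_all add: \<kappa>_def)
    show False
      by (rule G.contradiction_if_relations_divisible[OF p x g(4) g(3) P(1) _ _ k1 Dn D0 pD _ c0]; (rule P(2) | erule(1) g(5) | erule(2) leh))
  qed
  moreover have "C > 1" using b by (simp add: C_def)
  ultimately show ?thesis by blast
qed

text \<open>The numerator is at most \<open>p0\<close>, while the number of primes is
  unbounded.\<close>

lemma finite_primes_small_o:
  assumes "\<And>p. p \<ge> p0 \<Longrightarrow> \<not> w p"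
  shows "(\<lambda>X::real. real (card {p::nat. real p \<le> X \<and> prime p \<and> w p})) \<in> o[at_top](\<lambda>X. real (card {p::nat. real p \<le> X \<and> prime p}))"
proof (rule landau_o.smallI)
  fix c :: real assume c: "c > 0"
  define M where "M = nat \<lceil>real p0 / c\<rceil>"
  have "infinite {p::nat. prime p}" by (rule primes_infinite)
  then obtain S where S: "finite S" "card S = M" "S \<subseteq> {p::nat. prime p}" using infinite_arbitrarily_large by blast
  define X0 where "X0 = real (\<Sum>S)"
  show "\<forall>\<^sub>F X in at_top. norm (real (card {p::nat. real p \<le> X \<and> prime p \<and> w p})) \<le> c * norm (real (card {p::nat. real p \<le> X \<and> prime p}))"
    using eventually_ge_at_top[of X0]
  proof eventually_elim
    case (elim X)
    have "{p::nat. real p \<le> X \<and> prime p \<and> w p} \<subseteq> {..<p0}" using assms by (auto simp: not_le[symmetric])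
    then have "card {p::nat. real p \<le> X \<and> prime p \<and> w p} \<le> card {..<p0}" by (intro card_mono) auto
    then have 1: "real (card {p::nat. real p \<le> X \<and> prime p \<and> w p}) \<le> real p0" by simp
    have "S \<subseteq> {p::nat. real p \<le> X \<and> prime p}"
    proof
      fix p assume ps: "p \<in> S"
      then have "p \<le> \<Sum>S" using S(1) member_le_sum[of p S "\<lambda>q. q"] by simp
      then have "real p \<le> X0" unfolding X0_def by (simp only: of_nat_le_iff)
      then have "real p \<le> X" using elim by simp
      then show "p \<in> {p::nat. real p \<le> X \<and> prime p}" using ps S(3) by auto
    qed
    moreover have "finite {p::nat. real p \<le> X \<and> prime p}"
      by (rule finite_subset[of _ "{..nat \<lfloor>X\<rfloor>}"]) (auto simp: le_nat_floor)
    ultimately have "M \<le> card {p::nat. real p \<le> X \<and> prime p}" using S(2) card_mono by metis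
    then have "real M \<le> real (card {p::nat. real p \<le> X \<and> prime p})" by simp
    moreover have "real p0 / c \<le> real M" unfolding M_def by linarith
    ultimately have "real p0 / c \<le> real (card {p::nat. real p \<le> X \<and> prime p})" by linarith
    then have "real p0 \<le> c * real (card {p::nat. real p \<le> X \<and> prime p})" using c by (simp add: field_simps)
    then show ?case using 1 by simp
  qed
qed

theorem theorem3:
  shows "lehmer_conjecture \<longleftrightarrow>
    (\<exists>C>1. (\<lambda>X::real. real (card {p::nat. real p \<le> X \<and> prime p \<and> wild C p}))
       \<in> o[at_top](\<lambda>X. real (card {p::nat. real p \<le> X \<and> prime p})))"
proof
  assume lehmer_conjecture
  then obtain C p0 where C: "C > 1" "\<And>p. p \<ge> p0 \<Longrightarrow> \<not> wild C p" using lehmer_imp_not_wild by blast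
  then show "\<exists>C>1. (\<lambda>X::real. real (card {p::nat. real p \<le> X \<and> prime p \<and> wild C p}))
       \<in> o[at_top](\<lambda>X. real (card {p::nat. real p \<le> X \<and> prime p}))"
    using finite_primes_small_o[of p0 "wild C"] by blast
next
  assume "\<exists>C>1. (\<lambda>X::real. real (card {p::nat. real p \<le> X \<and> prime p \<and> wild C p}))
       \<in> o[at_top](\<lambda>X. real (card {p::nat. real p \<le> X \<and> prime p}))"
  then show lehmer_conjecture using sparse_wild_imp_lehmer by blast
qed

end
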